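(* Let $G$ be an affine algebraic group. For any finite system of $n$ equations (possibly with coefficients) over $G$ in $m$ unknowns, the dimension of each irreducible component of the variety of solutions to this system in $G^m$ is at least $(m-n)\cdot\dim G$.
   Context: Algebraic groups and varieties are over an algebraically closed field (of arbitrary characteristic); varieties are not necessarily irreducible, and the topology is the Zariski topology. An equation over a group $G$ in the unknowns $x_1,\dots,x_m$ is an expression $v(x_1,\dots,x_m)=1$, where $v$ is a word whose letters are unknowns, their inverses, and elements of $G$ (called coefficients); i.e. $v$ is an element of the free product $G*F(x_1,\dots,x_m)$ of $G$ and the free group $F(x_1,\dots,x_m)$. A solution to a system of such equations is a tuple in $G^m$ satisfying all equations; for an affine algebraic group $G$ the solutions form a closed subvariety of $G^m$. *)

theory Defs
  imports
    "HOL-Analysis.Abstract_Topology"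
    "HOL-Library.Extended_Real"
    "HOL-Library.FuncSet"
    "HOL-Computational_Algebra.Polynomial"
    "HOL-Algebra.Group"
begin

section \<open>Affine space and the Zariski topology\<close>

text \<open>
  For a finite index set \<open>I\<close>, the affine space over the field \<open>'k\<close> with coordinates indexed
  by \<open>I\<close> is the set of extensional functions \<open>I \<rightarrow>\<^sub>E UNIV\<close>. Polynomials occur only through
  the functions they define.
\<close>

abbreviation affine_space :: "'i set \<Rightarrow> ('i \<Rightarrow> 'k) set" where
  "affine_space I \<equiv> I \<rightarrow>\<^sub>E UNIV"

inductive_set poly_funs :: "'i set \<Rightarrow> (('i \<Rightarrow> 'k::field) \<Rightarrow> 'k) set"
  for I :: "'i set" where
  const: "(\<lambda>x. c) \<in> poly_funs I"
| coord: "i \<in> I \<Longrightarrow> (\<lambda>x. x i) \<in> poly_funs I"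
| add: "p \<in> poly_funs I \<Longrightarrow> q \<in> poly_funs I \<Longrightarrow> (\<lambda>x. p x + q x) \<in> poly_funs I"
| mult: "p \<in> poly_funs I \<Longrightarrow> q \<in> poly_funs I \<Longrightarrow> (\<lambda>x. p x * q x) \<in> poly_funs I"

definition zeros :: "'i set \<Rightarrow> (('i \<Rightarrow> 'k::field) \<Rightarrow> 'k) set \<Rightarrow> ('i \<Rightarrow> 'k) set" where
  "zeros I P = {x \<in> affine_space I. \<forall>p\<in>P. p x = 0}"

definition zariski :: "'i set \<Rightarrow> ('i \<Rightarrow> 'k::field) topology" where
  "zariski I = topology (\<lambda>U. \<exists>P\<subseteq>poly_funs I. U = affine_space I - zeros I P)"

lemma istopology_zariski:
  "istopology (\<lambda>U. \<exists>P\<subseteq>poly_funs I. U = affine_space I - zeros I (P :: (('i \<Rightarrow> 'k::field) \<Rightarrow> 'k) set))"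
  (is "istopology ?open")
  unfolding istopology_def
proof (intro conjI allI impI)
  fix U V assume "?open U" "?open V"
  then obtain P Q where P: "P \<subseteq> poly_funs I" "U = affine_space I - zeros I P"
    and Q: "Q \<subseteq> poly_funs I" "V = affine_space I - zeros I Q"
    by blast
  let ?R = "{\<lambda>x. p x * q x | p q. p \<in> P \<and> q \<in> Q}"
  have "?R \<subseteq> poly_funs I"
    using P(1) Q(1) by (auto intro!: poly_funs.mult)
  moreover have "x \<in> zeros I ?R \<longleftrightarrow> x \<in> zeros I P \<or> x \<in> zeros I Q" for x
  proof -
    have "(\<forall>r\<in>?R. r x = 0) \<longleftrightarrow> (\<forall>p\<in>P. \<forall>q\<in>Q. p x * q x = 0)"
      by fastforce
    also have "\<dots> \<longleftrightarrow> (\<forall>p\<in>P. p x = 0) \<or> (\<forall>q\<in>Q. q x = 0)"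
      unfolding mult_eq_0_iff by blast
    finally show ?thesis
      unfolding zeros_def mem_Collect_eq[of x] by argo
  qed
  then have "U \<inter> V = affine_space I - zeros I ?R"
    unfolding P(2) Q(2) by blast
  ultimately show "?open (U \<inter> V)"
    by blast
next
  fix \<K> assume "\<forall>U\<in>\<K>. ?open U"
  then obtain P where P: "\<And>U. U \<in> \<K> \<Longrightarrow> P U \<subseteq> poly_funs I \<and> U = affine_space I - zeros I (P U)"
    by metis
  have "\<Union>\<K> = (\<Union>U\<in>\<K>. affine_space I - zeros I (P U))"
    using P by auto
  also have "\<dots> = affine_space I - zeros I (\<Union>U\<in>\<K>. P U)"
    by (auto simp: zeros_def)
  finally show "?open (\<Union>\<K>)"
    using P by (intro exI[of _ "\<Union>U\<in>\<K>. P U"]) auto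
qed

lemma openin_zariski:
  "openin (zariski I) U \<longleftrightarrow> (\<exists>P\<subseteq>poly_funs I. U = affine_space I - zeros I P)"
  by (simp add: zariski_def topology_inverse'[OF istopology_zariski])

lemma topspace_zariski: "topspace (zariski I :: ('i \<Rightarrow> 'k::field) topology) = affine_space I"
proof (rule antisym)
  show "topspace (zariski I :: ('i \<Rightarrow> 'k) topology) \<subseteq> affine_space I"
    using openin_topspace[of "zariski I :: ('i \<Rightarrow> 'k) topology"] unfolding openin_zariski by auto
  have "openin (zariski I) (affine_space I :: ('i \<Rightarrow> 'k) set)"
    unfolding openin_zariski
    by (rule exI[of _ "{\<lambda>x. 1}"]) (auto simp: zeros_def intro: poly_funs.const)
  then show "affine_space I \<subseteq> topspace (zariski I :: ('i \<Rightarrow> 'k) topology)"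
    by (rule openin_subset)
qed

lemma closedin_zariski:
  "closedin (zariski I) S \<longleftrightarrow> (\<exists>P\<subseteq>poly_funs I. S = zeros I P)"
proof -
  have "zeros I P \<subseteq> affine_space I" for P :: "(('a \<Rightarrow> 'b) \<Rightarrow> 'b) set"
    by (auto simp: zeros_def)
  then have "S \<subseteq> affine_space I \<and> affine_space I - S = affine_space I - zeros I P \<longleftrightarrow> S = zeros I P" for P
    by (metis double_diff order_refl)
  then show ?thesis
    unfolding closedin_def topspace_zariski openin_zariski by metis
qed


section \<open>Irreducibility and dimension of topological spaces\<close>

definition irreducible_in :: "'a topology \<Rightarrow> 'a set \<Rightarrow> bool" where
  "irreducible_in T S \<longleftrightarrow> S \<subseteq> topspace T \<and> S \<noteq> {} \<and>
     (\<forall>A B. closedin T A \<longrightarrow> closedin T B \<longrightarrow> S \<subseteq> A \<union> B \<longrightarrow> S \<subseteq> A \<or> S \<subseteq> B)"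

definition irreducible_component_of :: "'a topology \<Rightarrow> 'a set \<Rightarrow> bool" where
  "irreducible_component_of T C \<longleftrightarrow>
     irreducible_in T C \<and> (\<forall>D. irreducible_in T D \<longrightarrow> C \<subseteq> D \<longrightarrow> D = C)"

text \<open>
  The dimension is the supremum of the lengths \<open>n\<close> of chains
  \<open>Z 0 \<subset> Z 1 \<subset> \<dots> \<subset> Z n\<close> of irreducible closed subsets; the empty space has dimension \<open>-\<infinity>\<close>.
\<close>

definition krull_dim :: "'a topology \<Rightarrow> ereal" where
  "krull_dim T = Sup {ereal (real n) | n. \<exists>Z :: nat \<Rightarrow> 'a set.
     (\<forall>k\<le>n. closedin T (Z k) \<and> irreducible_in T (Z k)) \<and> (\<forall>k<n. Z k \<subset> Z (Suc k))}"

abbreviation variety_dim :: "'i set \<Rightarrow> ('i \<Rightarrow> 'k::field) set \<Rightarrow> ereal" where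
  "variety_dim I X \<equiv> krull_dim (subtopology (zariski I) X)"


section \<open>Affine algebraic groups\<close>

definition polynomial_map ::
  "'i set \<Rightarrow> ('i \<Rightarrow> 'k::field) set \<Rightarrow> 'j set \<Rightarrow> (('i \<Rightarrow> 'k) \<Rightarrow> ('j \<Rightarrow> 'k)) \<Rightarrow> bool" where
  "polynomial_map I X J f \<longleftrightarrow> (\<forall>j\<in>J. \<exists>p\<in>poly_funs I. \<forall>x\<in>X. f x j = p x)"

text \<open>
  The power \<open>X\<^sup>m\<close> of \<open>X \<subseteq> affine_space I\<close> lives in the affine space with coordinates
  \<open>{..<m} \<times> I\<close>; \<open>entry I x j\<close> is the \<open>j\<close>-th entry of the tuple \<open>x\<close>, with \<open>j\<close> counted from \<open>0\<close>.
\<close>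

definition entry :: "'i set \<Rightarrow> (nat \<times> 'i \<Rightarrow> 'k) \<Rightarrow> nat \<Rightarrow> 'i \<Rightarrow> 'k" where
  "entry I x j = (\<lambda>i\<in>I. x (j, i))"

definition power_set :: "'i set \<Rightarrow> ('i \<Rightarrow> 'k) set \<Rightarrow> nat \<Rightarrow> (nat \<times> 'i \<Rightarrow> 'k) set" where
  "power_set I X m = {x \<in> affine_space ({..<m} \<times> I). \<forall>j<m. entry I x j \<in> X}"

locale affine_algebraic_group = group G
  for I :: "'i set" and G :: "('i \<Rightarrow> 'k::alg_closed_field) monoid" (structure) +
  assumes finite_coords: "finite I"
    and closed_carrier: "closedin (zariski I) (carrier G)"
    and polynomial_mult:
      "polynomial_map ({..<2} \<times> I) (power_set I (carrier G) 2) I (\<lambda>x. entry I x 0 \<otimes> entry I x 1)"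
    and polynomial_inv: "polynomial_map I (carrier G) I (\<lambda>x. inv x)"


section \<open>Equations over a group\<close>

text \<open>
  The word \<open>v\<close>, a list of letters, stands for the equation \<open>v = 1\<close>. Words need not be reduced:
  every element of the free product \<open>G * F\<close> is represented by some word, and the value of a word
  depends only on the element it represents.
\<close>

datatype 'g letter = Unknown nat | Inv_Unknown nat | Coefficient 'g

definition letters :: "('g, 'b) monoid_scheme \<Rightarrow> nat \<Rightarrow> 'g letter set" where
  "letters G m = Unknown ` {..<m} \<union> Inv_Unknown ` {..<m} \<union> Coefficient ` carrier G"

fun letter_value :: "('g, 'b) monoid_scheme \<Rightarrow> (nat \<Rightarrow> 'g) \<Rightarrow> 'g letter \<Rightarrow> 'g" where
  "letter_value G g (Unknown j) = g j"
| "letter_value G g (Inv_Unknown j) = inv\<^bsub>G\<^esub> (g j)"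
| "letter_value G g (Coefficient a) = a"

definition word_value :: "('g, 'b) monoid_scheme \<Rightarrow> (nat \<Rightarrow> 'g) \<Rightarrow> 'g letter list \<Rightarrow> 'g" where
  "word_value G g v = foldr (\<lambda>l y. letter_value G g l \<otimes>\<^bsub>G\<^esub> y) v \<one>\<^bsub>G\<^esub>"

definition solutions ::
  "'i set \<Rightarrow> ('i \<Rightarrow> 'k) monoid \<Rightarrow> nat \<Rightarrow> ('i \<Rightarrow> 'k) letter list list \<Rightarrow> (nat \<times> 'i \<Rightarrow> 'k) set" where
  "solutions I G m vs =
     {x \<in> power_set I (carrier G) m. \<forall>v\<in>set vs. word_value G (entry I x) v = \<one>\<^bsub>G\<^esub>}"

end

theory Submission
  imports Defs "HOL-Library.Function_Algebras"
begin

text \<open>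
  The estimate is local at a point \<open>p\<close> of the component \<open>C\<close> lying on no other component of the
  solution variety. Put \<open>d = dim G\<close> and \<open>c = dim C\<close>. Choose \<open>d\<close> polynomials on \<open>G\<close> having \<open>1\<close> as an
  isolated common zero, and \<open>c\<close> polynomials having \<open>p\<close> as an isolated common zero on \<open>C\<close>. Composing
  the former with the \<open>n\<close> word maps and adding the latter gives \<open>n d + c\<close> polynomials for which \<open>p\<close>
  is an isolated common zero in \<open>G\<^sup>m\<close>. On the other hand, a chain of length \<open>d\<close> in \<open>G\<close> can be
  translated to start at any given point, so products of such chains form a chain of length \<open>m d\<close>
  of irreducible closed subsets of \<open>G\<^sup>m\<close> starting at \<open>p\<close>.

  It remains to see that a chain of length \<open>t\<close> starting at an isolated common zero of \<open>s\<close> polynomials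
  has \<open>t \<le> s\<close>. Let \<open>M\<close> be the maximal ideal of \<open>p\<close> in the coordinate ring \<open>A\<close> of the largest
  member. By the Artin--Rees lemma each step of the chain raises the order of growth of
  \<open>dim A / M\<^sup>N\<close> in \<open>N\<close> by one, so that it is at least \<open>t\<close>; by the Nullstellensatz some power of \<open>M\<close>
  lies in the ideal of the \<open>s\<close> polynomials near \<open>p\<close>, so that it is at most \<open>s\<close>.
\<close>

section \<open>Noetherian subrings\<close>

text \<open>The number d enters on both sides for different reasons. The definition of dimension
  yields a chain of length d only somewhere in G, and in a general variety a given point may lie on
  components of smaller dimension only; homogeneity of G is what brings such a chain to every entry
  of p. Conversely, no chain in G is longer than d, and this alone yields d polynomials isolating 1.
  They may have further common zeros away from 1, so the argument has to stay local at p. An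
  equation v = 1 asks a polynomial map to hit a single point, hence costs d polynomials, and the
  count reads m d <= n d + c.

  Neither localizations nor quotients are formed. A neighbourhood of p is given by a polynomial g
  with g(p) nonzero, and dim A / M^N is estimated inside the ring of all polynomial functions: from
  below by elements independent modulo L + M^N, from above by elements spanning modulo L + M^N,
  where L is the vanishing ideal of the largest member of the chain. The lower bound is a binomial
  coefficient, the upper bound a number of monomials.\<close>

definition is_subring :: "'r::comm_ring_1 set \<Rightarrow> bool" where
  "is_subring A \<longleftrightarrow> 1 \<in> A \<and> (\<forall>x\<in>A. \<forall>y\<in>A. x - y \<in> A \<and> x * y \<in> A)"

definition is_ideal :: "'r::comm_ring_1 set \<Rightarrow> 'r set \<Rightarrow> bool" where
  "is_ideal A J \<longleftrightarrow> J \<subseteq> A \<and> 0 \<in> J \<and> (\<forall>x\<in>J. \<forall>y\<in>J. x + y \<in> J) \<and> (\<forall>a\<in>A. \<forall>x\<in>J. a * x \<in> J)"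

text \<open>Only the multipliers are confined to \<open>A\<close>; the generators may lie outside.
  With \<open>A\<close> the ring of constants this becomes the linear span used later for counting
  dimensions.\<close>

inductive_set ideal_gen :: "'r::comm_ring_1 set \<Rightarrow> 'r set \<Rightarrow> 'r set" for A F where
  zero: "0 \<in> ideal_gen A F"
| step: "a \<in> A \<Longrightarrow> f \<in> F \<Longrightarrow> x \<in> ideal_gen A F \<Longrightarrow> a * f + x \<in> ideal_gen A F"

definition noetherian :: "'r::comm_ring_1 set \<Rightarrow> bool" where
  "noetherian A \<longleftrightarrow> is_subring A \<and> (\<forall>J. is_ideal A J \<longrightarrow> (\<exists>F. finite F \<and> F \<subseteq> J \<and> J \<subseteq> ideal_gen A F))"

lemma noetherian_subring: "noetherian A \<Longrightarrow> is_subring A"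
  by (simp add: noetherian_def)

context
  fixes A :: "'r::comm_ring_1 set"
  assumes A: "is_subring A"
begin

lemma subring_one: "1 \<in> A" and subring_diff: "x \<in> A \<Longrightarrow> y \<in> A \<Longrightarrow> x - y \<in> A"
  and subring_mult: "x \<in> A \<Longrightarrow> y \<in> A \<Longrightarrow> x * y \<in> A"
  using A by (auto simp: is_subring_def)

lemma subring_zero: "0 \<in> A"
  using subring_diff[OF subring_one subring_one] by simp

lemma subring_uminus: "x \<in> A \<Longrightarrow> - x \<in> A"
  using subring_diff[OF subring_zero] by fastforce

lemma subring_add: "x \<in> A \<Longrightarrow> y \<in> A \<Longrightarrow> x + y \<in> A"
  using subring_diff[OF _ subring_uminus] by fastforce

lemma subring_power: "x \<in> A \<Longrightarrow> x ^ n \<in> A"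
  by (induction n) (auto intro: subring_one subring_mult)

lemma subring_sum: "(\<And>i. i \<in> S \<Longrightarrow> f i \<in> A) \<Longrightarrow> sum f S \<in> A"
  by (induction S rule: infinite_finite_induct) (auto intro: subring_zero subring_add)

lemma subring_prod: "(\<And>i. i \<in> S \<Longrightarrow> f i \<in> A) \<Longrightarrow> prod f S \<in> A"
  by (induction S rule: infinite_finite_induct) (auto intro: subring_one subring_mult)

lemma ideal_uminus: "is_ideal A J \<Longrightarrow> x \<in> J \<Longrightarrow> - x \<in> J"
  using subring_uminus[OF subring_one] unfolding is_ideal_def by (metis mult_minus1)

lemma ideal_diff: "is_ideal A J \<Longrightarrow> x \<in> J \<Longrightarrow> y \<in> J \<Longrightarrow> x - y \<in> J"
  using ideal_uminus[of J y] unfolding is_ideal_def by (metis diff_conv_add_uminus)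

lemma ideal_sum_closed: "is_ideal A J \<Longrightarrow> (\<And>i. i \<in> S \<Longrightarrow> f i \<in> J) \<Longrightarrow> sum f S \<in> J"
  by (induction S rule: infinite_finite_induct) (auto simp: is_ideal_def)

lemma ideal_gen_add: "x \<in> ideal_gen A F \<Longrightarrow> y \<in> ideal_gen A F \<Longrightarrow> x + y \<in> ideal_gen A F"
  by (induction x rule: ideal_gen.induct) (auto simp: add.assoc intro: ideal_gen.intros)

lemma ideal_gen_mult: "x \<in> ideal_gen A F \<Longrightarrow> a \<in> A \<Longrightarrow> a * x \<in> ideal_gen A F"
proof (induction x rule: ideal_gen.induct)
  case (step b f x)
  then have "(a * b) * f + a * x \<in> ideal_gen A F"
    by (intro ideal_gen.step subring_mult) auto
  then show ?case by (simp add: algebra_simps)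
qed (auto intro: ideal_gen.intros)

lemma ideal_gen_base: "f \<in> F \<Longrightarrow> f \<in> ideal_gen A F"
  using ideal_gen.step[OF subring_one _ ideal_gen.zero, of f F] by simp

lemma ideal_gen_least: "is_ideal A J \<Longrightarrow> F \<subseteq> J \<Longrightarrow> ideal_gen A F \<subseteq> J"
proof
  fix x assume "x \<in> ideal_gen A F" and *: "is_ideal A J" "F \<subseteq> J"
  then show "x \<in> J"
    by (induction x rule: ideal_gen.induct) (use * in \<open>auto simp: is_ideal_def\<close>)
qed

lemma is_ideal_self: "is_ideal A A"
  by (simp add: is_ideal_def subring_zero subring_add subring_mult)

lemma is_ideal_gen: "F \<subseteq> A \<Longrightarrow> is_ideal A (ideal_gen A F)"
  using ideal_gen_least[OF is_ideal_self, of F]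
  by (auto simp: is_ideal_def ideal_gen.zero ideal_gen_add ideal_gen_mult)

lemma is_ideal_set_plus:
  assumes "is_ideal A J" "is_ideal A K"
  shows "is_ideal A {x + y | x y. x \<in> J \<and> y \<in> K}"
  unfolding is_ideal_def
proof (intro conjI ballI)
  show "{x + y | x y. x \<in> J \<and> y \<in> K} \<subseteq> A"
    using assms subring_add by (auto simp: is_ideal_def)
  show "0 \<in> {x + y | x y. x \<in> J \<and> y \<in> K}"
    using assms by (force simp: is_ideal_def)
next
  fix u v assume "u \<in> {x + y | x y. x \<in> J \<and> y \<in> K}" "v \<in> {x + y | x y. x \<in> J \<and> y \<in> K}"
  then obtain x y x' y' where "u = x + y" "v = x' + y'" "x \<in> J" "x' \<in> J" "y \<in> K" "y' \<in> K" by blast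
  then have "u + v = (x + x') + (y + y')" "x + x' \<in> J" "y + y' \<in> K"
    using assms by (auto simp: is_ideal_def algebra_simps)
  then show "u + v \<in> {x + y | x y. x \<in> J \<and> y \<in> K}" by blast
next
  fix a u assume "a \<in> A" "u \<in> {x + y | x y. x \<in> J \<and> y \<in> K}"
  then obtain x y where "u = x + y" "x \<in> J" "y \<in> K" by blast
  then have "a * u = a * x + a * y" "a * x \<in> J" "a * y \<in> K"
    using assms \<open>a \<in> A\<close> by (auto simp: is_ideal_def algebra_simps)
  then show "a * u \<in> {x + y | x y. x \<in> J \<and> y \<in> K}" by blast
qed

end

lemma ideal_gen_mono: "A \<subseteq> B \<Longrightarrow> F \<subseteq> G \<Longrightarrow> ideal_gen A F \<subseteq> ideal_gen B G"
proof
  fix x assume "x \<in> ideal_gen A F" "A \<subseteq> B" "F \<subseteq> G"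
  then show "x \<in> ideal_gen B G"
    by (induction x rule: ideal_gen.induct) (auto intro: ideal_gen.intros)
qed

lemma noetherian_chain_stabilizes:
  fixes J :: "nat \<Rightarrow> 'r::comm_ring_1 set"
  assumes A: "noetherian A" and J: "\<And>n. is_ideal A (J n)" and mono: "\<And>n. J n \<subseteq> J (Suc n)"
  shows "\<exists>N. \<forall>n\<ge>N. J n = J N"
proof -
  have mono': "J m \<subseteq> J n" if "m \<le> n" for m n
    using lift_Suc_mono_le[of J, OF mono that] .
  have "is_ideal A (\<Union>n. J n)"
    unfolding is_ideal_def
  proof (intro conjI ballI)
    fix x y assume "x \<in> (\<Union>n. J n)" "y \<in> (\<Union>n. J n)"
    then obtain m n where "x \<in> J m" "y \<in> J n" by blast
    then have "x \<in> J (max m n)" "y \<in> J (max m n)" using mono' by (meson max.cobounded1 max.cobounded2 subsetD)+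
    then show "x + y \<in> (\<Union>n. J n)" using J[of "max m n"] by (auto simp: is_ideal_def)
  next
    show "(\<Union>n. J n) \<subseteq> A" "0 \<in> (\<Union>n. J n)"
      using J unfolding is_ideal_def by blast+
    show "a * x \<in> (\<Union>n. J n)" if "a \<in> A" "x \<in> (\<Union>n. J n)" for a x
      using J that unfolding is_ideal_def by blast
  qed
  then obtain F where F: "finite F" "F \<subseteq> (\<Union>n. J n)" "(\<Union>n. J n) \<subseteq> ideal_gen A F"
    using A unfolding noetherian_def by blast
  have "\<exists>N. F \<subseteq> J N"
    using F(1,2)
  proof (induction F)
    case (insert f F)
    then obtain m n where "f \<in> J m" "F \<subseteq> J n" by blast
    then have "insert f F \<subseteq> J (max m n)" using mono'[of m "max m n"] mono'[of n "max m n"] by auto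
    then show ?case by blast
  qed auto
  then obtain N where "F \<subseteq> J N" by blast
  then have "ideal_gen A F \<subseteq> J N"
    by (rule ideal_gen_least[OF noetherian_subring[OF A] J])
  then have "J n = J N" if "n \<ge> N" for n
    using F(3) mono'[OF that] by blast
  then show ?thesis by blast
qed

section \<open>The Hilbert basis theorem\<close>

definition polys_over :: "'r::comm_ring_1 set \<Rightarrow> 'r poly set" where
  "polys_over A = {P. \<forall>i. coeff P i \<in> A}"

definition adjoin :: "'r::comm_ring_1 set \<Rightarrow> 'r \<Rightarrow> 'r set" where
  "adjoin A t = (\<lambda>P. poly P t) ` polys_over A"

lemma polys_over_subring:
  assumes "is_subring A"
  shows "is_subring (polys_over A)"
  unfolding is_subring_def polys_over_def
  by (auto simp: coeff_mult coeff_1 intro!: subring_sum[OF assms]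
      subring_mult[OF assms] subring_diff[OF assms] subring_one[OF assms] subring_zero[OF assms])

lemma polys_over_monom: "is_subring A \<Longrightarrow> a \<in> A \<Longrightarrow> monom a n \<in> polys_over A"
  by (auto simp: polys_over_def subring_zero)

lemma polys_over_const: "is_subring A \<Longrightarrow> a \<in> A \<Longrightarrow> [:a:] \<in> polys_over A"
  using polys_over_monom[of A a 0] by (simp add: monom_0)

lemma polys_over_smult: "is_subring A \<Longrightarrow> a \<in> A \<Longrightarrow> P \<in> polys_over A \<Longrightarrow> smult a P \<in> polys_over A"
  by (auto simp: polys_over_def subring_mult)

lemma adjoin_subring:
  assumes "is_subring A"
  shows "is_subring (adjoin A t)"
  unfolding is_subring_def adjoin_def
proof (intro conjI ballI)
  note P = polys_over_subring[OF assms]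
  show "1 \<in> (\<lambda>P. poly P t) ` polys_over A"
    using subring_one[OF P] by force
  fix x y assume "x \<in> (\<lambda>P. poly P t) ` polys_over A" "y \<in> (\<lambda>P. poly P t) ` polys_over A"
  then obtain Q R where "x = poly Q t" "y = poly R t" "Q \<in> polys_over A" "R \<in> polys_over A" by blast
  then have "x - y = poly (Q - R) t" "x * y = poly (Q * R) t" "Q - R \<in> polys_over A" "Q * R \<in> polys_over A"
    using subring_diff[OF P] subring_mult[OF P] by auto
  then show "x - y \<in> (\<lambda>P. poly P t) ` polys_over A" "x * y \<in> (\<lambda>P. poly P t) ` polys_over A"
    by blast+
qed

lemma adjoin_base: "is_subring A \<Longrightarrow> A \<subseteq> adjoin A t"
  using polys_over_const unfolding adjoin_def by force

lemma adjoin_elem: "is_subring A \<Longrightarrow> t \<in> adjoin A t"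
  using polys_over_monom[OF _ subring_one, of A 1] unfolding adjoin_def
  by (force simp: poly_monom)

lemma adjoin_least:
  assumes "is_subring B" "A \<subseteq> B" "t \<in> B"
  shows "adjoin A t \<subseteq> B"
  using assms unfolding adjoin_def polys_over_def
  by (auto simp: poly_altdef intro!: subring_sum subring_mult subring_power)

text \<open>\<open>t\<close> may satisfy relations over \<open>A\<close>, so the leading coefficient
  argument is run on the polynomials whose value at \<open>t\<close> lies in \<open>J\<close>, not
  on the elements of \<open>J\<close> themselves.\<close>

lemma hilbert_basis:
  fixes A :: "'r::comm_ring_1 set"
  assumes A: "noetherian A"
  shows "noetherian (adjoin A t)"
  unfolding noetherian_def
proof (intro conjI allI impI)
  note sub = noetherian_subring[OF A]
  note subP = polys_over_subring[OF sub]
  define B where "B = adjoin A t"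
  show "is_subring (adjoin A t)" by (rule adjoin_subring[OF sub])
  then have subB: "is_subring B" by (simp add: B_def)
  fix J assume "is_ideal (adjoin A t) J"
  then have J: "is_ideal B J" by (simp add: B_def)
  have tB: "t \<in> B" using adjoin_elem[OF sub] by (simp add: B_def)
  have AB: "A \<subseteq> B" using adjoin_base[OF sub] by (simp add: B_def)
  \<comment> \<open>Polynomials of degree below \<open>n\<close> contribute the coefficient 0; this
    is what makes \<open>L n\<close> closed under addition.\<close>
  define L where "L n = {coeff P n | P. P \<in> polys_over A \<and> degree P \<le> n \<and> poly P t \<in> J}" for n
  have L: "is_ideal A (L n)" for n
    unfolding is_ideal_def
  proof (intro conjI ballI)
    show "L n \<subseteq> A" by (auto simp: L_def polys_over_def)
    show "0 \<in> L n"
      unfolding L_def using J subring_zero[OF subP] by (auto intro!: exI[of _ 0] simp: is_ideal_def)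
  next
    fix x y assume "x \<in> L n" "y \<in> L n"
    then obtain P Q where "P \<in> polys_over A" "degree P \<le> n" "poly P t \<in> J" "x = coeff P n"
       "Q \<in> polys_over A" "degree Q \<le> n" "poly Q t \<in> J" "y = coeff Q n"
      unfolding L_def by blast
    then show "x + y \<in> L n" unfolding L_def
      using J by (auto intro!: exI[of _ "P + Q"] subring_add[OF subP] degree_add_le simp: is_ideal_def)
  next
    fix a x assume "a \<in> A" "x \<in> L n"
    then obtain P where "P \<in> polys_over A" "degree P \<le> n" "poly P t \<in> J" "x = coeff P n"
      unfolding L_def by blast
    then show "a * x \<in> L n" unfolding L_def
      using J \<open>a \<in> A\<close> AB
      by (auto intro!: exI[of _ "smult a P"] polys_over_smult[OF sub] simp: is_ideal_def
           intro: order.trans[OF degree_smult_le])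
  qed
  have mono: "L n \<subseteq> L (Suc n)" for n
  proof
    fix x assume "x \<in> L n"
    then obtain P where P: "P \<in> polys_over A" "degree P \<le> n" "poly P t \<in> J" "x = coeff P n"
      unfolding L_def by blast
    have "pCons 0 P \<in> polys_over A"
      using P(1) subring_zero[OF sub] by (auto simp: polys_over_def coeff_pCons split: nat.split)
    moreover have "degree (pCons 0 P) \<le> Suc n" using P(2) by (simp add: degree_pCons_le order.trans[OF degree_pCons_le])
    moreover have "poly (pCons 0 P) t \<in> J" using P(3) tB J by (simp add: is_ideal_def)
    ultimately show "x \<in> L (Suc n)" unfolding L_def using P(4)
      by (auto intro!: exI[of _ "pCons 0 P"])
  qed
  obtain N where N: "\<And>n. n \<ge> N \<Longrightarrow> L n = L N"
    using noetherian_chain_stabilizes[of A L] A L mono by blast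
  obtain F where F: "\<And>n. finite (F n) \<and> F n \<subseteq> L n \<and> L n \<subseteq> ideal_gen A (F n)"
  proof -
    have "\<forall>n. \<exists>F. finite F \<and> F \<subseteq> L n \<and> L n \<subseteq> ideal_gen A F"
      using A L unfolding noetherian_def by blast
    then show ?thesis using that by metis
  qed
  have "\<forall>n. \<forall>a\<in>L n. \<exists>P. P \<in> polys_over A \<and> degree P \<le> n \<and> poly P t \<in> J \<and> coeff P n = a"
    unfolding L_def by auto
  then obtain W where W: "\<And>n a. a \<in> L n \<Longrightarrow> W n a \<in> polys_over A \<and> degree (W n a) \<le> n
     \<and> poly (W n a) t \<in> J \<and> coeff (W n a) n = a"
    by metis
  define G where "G = (\<Union>n\<le>N. (\<lambda>a. poly (W n a) t) ` F n)"
  have finG: "finite G" unfolding G_def using F by auto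
  have GJ: "G \<subseteq> J" unfolding G_def using F W by fast
  have lift: "\<exists>Q\<in>polys_over A. degree Q \<le> k \<and> coeff Q k = a \<and> poly Q t \<in> ideal_gen B G"
    if "a \<in> ideal_gen A (F k)" "k \<le> N" for a k
    using that
  proof (induction a rule: ideal_gen.induct)
    case zero
    then show ?case using subring_zero[OF subP] by (auto intro!: bexI[of _ 0] ideal_gen.zero)
  next
    case (step a f x)
    then obtain Q where Q: "Q\<in>polys_over A" "degree Q \<le> k" "coeff Q k = x" "poly Q t \<in> ideal_gen B G"
      by blast
    have f: "f \<in> L k" using step F by blast
    have "poly (W k f) t \<in> G" unfolding G_def using step by auto
    then have "a * poly (W k f) t + poly Q t \<in> ideal_gen B G"
      using Q(4) step AB by (intro ideal_gen.step) auto
    then show ?case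
      using W[OF f] Q step
      by (intro bexI[of _ "smult a (W k f) + Q"] conjI)
         (auto intro!: degree_add_le subring_add[OF subP] polys_over_smult[OF sub]
           intro: order.trans[OF degree_smult_le])
  qed
  have main: "poly P t \<in> ideal_gen B G" if "P \<in> polys_over A" "degree P \<le> n" "poly P t \<in> J" for n P
    using that
  proof (induction n arbitrary: P)
    case (0 P)
    have "coeff P 0 \<in> L 0" unfolding L_def using 0 by blast
    then obtain Q where Q: "Q\<in>polys_over A" "degree Q \<le> 0" "coeff Q 0 = coeff P 0" "poly Q t \<in> ideal_gen B G"
      using lift[of "coeff P 0" 0] F by blast
    have "Q = P" using Q(2,3) 0(2) by (metis le_zero_eq degree_0_id)
    then show ?case using Q by simp
  next
    case (Suc n P)
    \<comment> \<open>From \<open>N\<close> on the ideals \<open>L\<close> agree, so some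
      \<open>Q\<close> of degree at most \<open>k\<close> has the required top coefficient. A power
      of the variable lifts it to degree \<open>Suc n\<close>, and subtracting it lowers the degree
      of \<open>P\<close>.\<close>
    define k where "k = min (Suc n) N"
    have "coeff P (Suc n) \<in> L (Suc n)" unfolding L_def using Suc by blast
    also have "L (Suc n) = L k" using N[of "Suc n"] by (auto simp: k_def min_def)
    finally obtain Q where Q: "Q\<in>polys_over A" "degree Q \<le> k" "coeff Q k = coeff P (Suc n)"
        "poly Q t \<in> ideal_gen B G"
      using lift[of "coeff P (Suc n)" k] F by (auto simp: k_def)
    define R where "R = monom 1 (Suc n - k) * Q"
    have "k \<le> Suc n" by (simp add: k_def)
    have RA: "R \<in> polys_over A" unfolding R_def
      by (intro subring_mult[OF subP] polys_over_monom sub subring_one Q)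
    have "poly R t = t ^ (Suc n - k) * poly Q t" by (simp add: R_def poly_monom)
    then have Rg: "poly R t \<in> ideal_gen B G"
      using ideal_gen_mult[OF subB Q(4)] subring_power[OF subB tB] by simp
    then have RJ: "poly R t \<in> J" using ideal_gen_least[OF subB J GJ] by blast
    have Rc: "coeff R (Suc n) = coeff P (Suc n)"
      using Q(3) \<open>k \<le> Suc n\<close> by (simp add: R_def coeff_monom_mult)
    have Rd: "degree R \<le> Suc n"
      unfolding R_def using degree_mult_le[of "monom (1::'r) (Suc n - k)" Q] degree_monom_le[of "1::'r" "Suc n - k"] Q(2) \<open>k \<le> Suc n\<close>
      by linarith
    have "degree (P - R) \<le> n"
    proof (rule degree_le, intro allI impI)
      fix i assume "n < i"
      show "coeff (P - R) i = 0"
      proof (cases "i = Suc n")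
        case False
        then have "degree P < i" "degree R < i" using \<open>n < i\<close> Suc.prems(2) Rd by auto
        then show ?thesis by (simp add: coeff_eq_0)
      qed (simp add: Rc)
    qed
    then have "poly (P - R) t \<in> ideal_gen B G"
      using Suc.IH[of "P - R"] subring_diff[OF subP Suc.prems(1) RA] ideal_diff[OF subB J Suc.prems(3) RJ]
      by simp
    then show ?case using ideal_gen_add[OF subB _ Rg, of "poly (P - R) t"] by simp
  qed
  have "J \<subseteq> ideal_gen B G"
  proof
    fix x assume "x \<in> J"
    then obtain P where "P \<in> polys_over A" "x = poly P t"
      using J unfolding is_ideal_def B_def adjoin_def by blast
    then show "x \<in> ideal_gen B G" using main[of P "degree P"] \<open>x \<in> J\<close> by blast
  qed
  then show "\<exists>F. finite F \<and> F \<subseteq> J \<and> J \<subseteq> ideal_gen (adjoin A t) F"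
    using finG GJ by (auto simp: B_def)
qed

section \<open>Powers of an ideal and the Artin--Rees lemma\<close>

text \<open>Factors are taken from \<open>Y\<close> itself rather than from the ideal it generates,
  which matches the generators y T of the Rees ring below.\<close>

primrec ipow :: "'r::comm_ring_1 set \<Rightarrow> 'r set \<Rightarrow> nat \<Rightarrow> 'r set" where
  "ipow A Y 0 = A"
| "ipow A Y (Suc n) = ideal_gen A {y * g | y g. y \<in> Y \<and> g \<in> ipow A Y n}"

context
  fixes A :: "'r::comm_ring_1 set" and Y
  assumes A: "is_subring A" and Y: "Y \<subseteq> A"
begin

lemma is_ideal_ipow: "is_ideal A (ipow A Y n)"
proof (induction n)
  case (Suc n)
  then have "{y * g | y g. y \<in> Y \<and> g \<in> ipow A Y n} \<subseteq> A"
    using Y by (auto intro!: subring_mult[OF A] simp: is_ideal_def)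
  then show ?case by (simp add: is_ideal_gen[OF A])
qed (simp add: is_ideal_self[OF A])

lemma ipow_subset: "ipow A Y n \<subseteq> A"
  using is_ideal_ipow by (simp add: is_ideal_def)

lemma ipow_Suc_mono: "ipow A Y (Suc n) \<subseteq> ipow A Y n"
  using ideal_gen_least[OF A is_ideal_ipow, of "{y * g | y g. y \<in> Y \<and> g \<in> ipow A Y n}" n]
    is_ideal_ipow[of n] Y by (fastforce simp: is_ideal_def)

lemma ipow_mono: "m \<le> n \<Longrightarrow> ipow A Y n \<subseteq> ipow A Y m"
  using lift_Suc_antimono_le[of "ipow A Y", OF ipow_Suc_mono] .

lemma ipow_gen_mult: "y \<in> Y \<Longrightarrow> g \<in> ipow A Y n \<Longrightarrow> y * g \<in> ipow A Y (Suc n)"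
  by (auto intro: ideal_gen_base[OF A])

lemma ipow_mult: "a \<in> ipow A Y m \<Longrightarrow> b \<in> ipow A Y n \<Longrightarrow> a * b \<in> ipow A Y (m + n)"
proof (induction m arbitrary: a)
  case 0
  then show ?case using is_ideal_ipow[of n] by (auto simp: is_ideal_def)
next
  case (Suc m)
  from Suc.prems(1) have "a \<in> ideal_gen A {y * g | y g. y \<in> Y \<and> g \<in> ipow A Y m}" by simp
  then show ?case
  proof (induction a rule: ideal_gen.induct)
    case zero
    show ?case using is_ideal_ipow[of "Suc m + n"] by (simp only: is_ideal_def mult_zero_left)
  next
    case (step c f x)
    then obtain y g where yg: "f = y * g" "y \<in> Y" "g \<in> ipow A Y m" by blast
    have "y * (g * b) \<in> ipow A Y (Suc m + n)"
      using ipow_gen_mult[OF yg(2) Suc.IH[OF yg(3) Suc.prems(2)]] by simp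
    then have "c * (y * (g * b)) + x * b \<in> ipow A Y (Suc m + n)"
      using is_ideal_ipow[of "Suc m + n"] step unfolding is_ideal_def by blast
    then show ?case by (simp add: yg(1) algebra_simps)
  qed
qed

text \<open>\<open>S\<close> is the Rees ring, the sum of the M^n T^n inside A[T], where M is the
  ideal generated by \<open>Y\<close>. It arises from a copy of \<open>A\<close> by adjoining the
  finitely many elements y T, so the basis theorem is applied once for each of them.\<close>

lemma noetherian_rees:
  assumes N: "noetherian A" and "finite Y"
  obtains S where "noetherian S" "\<And>a n. a \<in> ipow A Y n \<Longrightarrow> monom a n \<in> S"
    "\<And>F n. F \<in> S \<Longrightarrow> coeff F n \<in> ipow A Y n"
proof -
  define C where "C = (\<lambda>a. [:a:]) ` A"
  define R where "R = {F. \<forall>n. coeff F n \<in> ipow A Y n}"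
  have subR: "is_subring R"
    unfolding is_subring_def
  proof (intro conjI ballI)
    show "1 \<in> R"
      unfolding R_def using is_ideal_ipow by (auto simp: coeff_1 is_ideal_def subring_one[OF A])
    fix F G assume "F \<in> R" "G \<in> R"
    then show "F - G \<in> R" unfolding R_def using ideal_diff[OF A is_ideal_ipow] by auto
    show "F * G \<in> R" unfolding R_def
    proof (intro CollectI allI)
      fix n
      have "coeff F i * coeff G (n - i) \<in> ipow A Y n" if "i \<le> n" for i
        using ipow_mult[of "coeff F i" i "coeff G (n - i)" "n - i"] that \<open>F \<in> R\<close> \<open>G \<in> R\<close> by (simp add: R_def)
      then show "coeff (F * G) n \<in> ipow A Y n"
        unfolding coeff_mult by (intro ideal_sum_closed[OF A is_ideal_ipow]) auto
    qed
  qed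
  have "is_subring C"
    unfolding is_subring_def C_def
    using subring_one[OF A] subring_diff[OF A] subring_mult[OF A]
    by (auto simp: image_iff one_pCons)
  moreover have "\<exists>F. finite F \<and> F \<subseteq> J \<and> J \<subseteq> ideal_gen C F" if J: "is_ideal C J" for J
  proof -
    define J0 where "J0 = {a. [:a:] \<in> J}"
    have "is_ideal A J0"
      unfolding is_ideal_def
    proof (intro conjI ballI)
      show "J0 \<subseteq> A" using J by (auto simp: is_ideal_def J0_def C_def)
      show "0 \<in> J0" using J by (simp add: is_ideal_def J0_def)
      fix x y assume "y \<in> J0"
      show "x + y \<in> J0" if "x \<in> J0"
      proof -
        have "[:x:] + [:y:] \<in> J" using J \<open>y \<in> J0\<close> that unfolding is_ideal_def J0_def by blast
        then show ?thesis by (simp add: J0_def)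
      qed
      show "x * y \<in> J0" if "x \<in> A"
      proof -
        have "[:x:] \<in> C" using that by (simp add: C_def)
        then have "[:x:] * [:y:] \<in> J" using J \<open>y \<in> J0\<close> unfolding is_ideal_def J0_def by blast
        then show ?thesis by (simp add: J0_def mult.commute)
      qed
    qed
    then obtain F where F: "finite F" "F \<subseteq> J0" "J0 \<subseteq> ideal_gen A F"
      using N unfolding noetherian_def by blast
    have *: "[:a:] \<in> ideal_gen C ((\<lambda>a. [:a:]) ` F)" if "a \<in> ideal_gen A F" for a
      using that
    proof (induction a rule: ideal_gen.induct)
      case (step a f x)
      then have "[:a:] * [:f:] + [:x:] \<in> ideal_gen C ((\<lambda>a. [:a:]) ` F)"
        by (intro ideal_gen.step) (auto simp: C_def)
      then show ?case by (simp add: mult.commute)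
    qed (simp add: ideal_gen.zero)
    have "J \<subseteq> ideal_gen C ((\<lambda>a. [:a:]) ` F)"
    proof
      fix P assume "P \<in> J"
      then obtain a where "P = [:a:]" using J by (auto simp: is_ideal_def C_def)
      then show "P \<in> ideal_gen C ((\<lambda>a. [:a:]) ` F)" using * F(3) \<open>P \<in> J\<close> by (auto simp: J0_def)
    qed
    then show ?thesis using F by (intro exI[of _ "(\<lambda>a. [:a:]) ` F"]) (auto simp: J0_def)
  qed
  ultimately have NC: "noetherian C" unfolding noetherian_def by blast
  have CR: "C \<subseteq> R"
    unfolding C_def R_def using is_ideal_ipow by (auto simp: coeff_pCons is_ideal_def ideal_gen.zero split: nat.split)
  have YR: "monom y 1 \<in> R" if "y \<in> Y" for y
  proof -
    have "y \<in> ipow A Y 1" using ipow_gen_mult[OF that, of 1 0] subring_one[OF A] by simp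
    then show ?thesis using is_ideal_ipow by (auto simp: R_def is_ideal_def simp del: ipow.simps)
  qed
  have "\<exists>S. noetherian S \<and> C \<subseteq> S \<and> (\<forall>y\<in>Y0. monom y 1 \<in> S) \<and> S \<subseteq> R" if "finite Y0" "Y0 \<subseteq> Y" for Y0
    using that
  proof (induction Y0)
    case empty
    show ?case using NC CR by auto
  next
    case (insert y Y0)
    then obtain S where S: "noetherian S" "C \<subseteq> S" "\<forall>y\<in>Y0. monom y 1 \<in> S" "S \<subseteq> R" by blast
    note subS = noetherian_subring[OF S(1)]
    show ?case
      using hilbert_basis[OF S(1), of "monom y 1"] adjoin_base[OF subS, of "monom y 1"]
        adjoin_elem[OF subS, of "monom y 1"] adjoin_least[OF subR S(4) YR[of y]] S insert.prems
      by (intro exI[of _ "adjoin S (monom y 1)"]) auto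
  qed
  from this[OF \<open>finite Y\<close>] obtain S where S: "noetherian S" "C \<subseteq> S" "\<forall>y\<in>Y. monom y 1 \<in> S" "S \<subseteq> R" by blast
  note subS = noetherian_subring[OF S(1)]
  have "monom a n \<in> S" if "a \<in> ipow A Y n" for a n
    using that
  proof (induction n arbitrary: a)
    case 0
    then show ?case using S(2) by (auto simp: C_def monom_0)
  next
    case (Suc n)
    then have "a \<in> ideal_gen A {y * g | y g. y \<in> Y \<and> g \<in> ipow A Y n}" by simp
    then show ?case
    proof (induction a rule: ideal_gen.induct)
      case zero
      show ?case using subring_zero[OF subS] by simp
    next
      case (step c f x)
      then obtain y g where yg: "f = y * g" "y \<in> Y" "g \<in> ipow A Y n" by blast
      have "[:c:] * (monom y 1 * monom g n) + monom x (Suc n) \<in> S"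
        using Suc.IH[OF yg(3)] S(2,3) yg(2) step
        by (intro subring_add[OF subS] subring_mult[OF subS]) (auto simp: C_def)
      then show ?case by (simp add: mult_monom smult_monom yg(1) add_monom)
    qed
  qed
  then show ?thesis using that[OF S(1)] S(4) unfolding R_def by blast
qed

text \<open>The members of the Rees ring with all coefficients in \<open>K\<close> form an ideal,
  which is finitely generated. If \<open>c\<close> bounds the degrees of its generators, then in
  degree \<open>n + c\<close> a generator can only meet cofactor coefficients of degree at least
  \<open>n\<close>, and these lie in \<open>ipow A Y n\<close>.\<close>

lemma artin_rees:
  assumes N: "noetherian A" and "finite Y" and K: "is_ideal A K"
  shows "\<exists>c. \<forall>n. ipow A Y (n + c) \<inter> K \<subseteq> ideal_gen A {k * m | k m. k \<in> K \<and> m \<in> ipow A Y n}"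
proof -
  obtain S where S: "noetherian S" "\<And>a n. a \<in> ipow A Y n \<Longrightarrow> monom a n \<in> S"
    "\<And>F n. F \<in> S \<Longrightarrow> coeff F n \<in> ipow A Y n"
    using noetherian_rees[OF N \<open>finite Y\<close>] by blast
  note subS = noetherian_subring[OF S(1)]
  define J where "J = {F\<in>S. \<forall>n. coeff F n \<in> K}"
  have "is_ideal S J"
    unfolding is_ideal_def
  proof (intro conjI ballI)
    fix F G assume "F \<in> S" "G \<in> J"
    have "coeff (F * G) n \<in> K" for n
    proof -
      have "coeff F i * coeff G (n - i) \<in> K" for i
        using K \<open>G \<in> J\<close> S(3)[OF \<open>F \<in> S\<close>] ipow_subset by (fastforce simp: J_def is_ideal_def)
      then show ?thesis unfolding coeff_mult by (intro ideal_sum_closed[OF A K])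
    qed
    then show "F * G \<in> J" using \<open>F \<in> S\<close> \<open>G \<in> J\<close> subring_mult[OF subS] by (auto simp: J_def)
  qed (use K subring_zero[OF subS] subring_add[OF subS] in \<open>auto simp: J_def is_ideal_def\<close>)
  then obtain F where F: "finite F" "F \<subseteq> J" "J \<subseteq> ideal_gen S F"
    using S(1) unfolding noetherian_def by blast
  \<comment> \<open>The inserted 0 keeps \<open>Max\<close> defined when there are no
    generators.\<close>
  define c where "c = Max (insert 0 (degree ` F))"
  have c: "degree f \<le> c" if "f \<in> F" for f
    unfolding c_def using F(1) that by (intro Max_ge) auto
  have "a \<in> ideal_gen A {k * m | k m. k \<in> K \<and> m \<in> ipow A Y n}" (is "_ \<in> ?I")
    if a: "a \<in> ipow A Y (n + c)" "a \<in> K" for a n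
  proof -
    have "coeff H (n + c) \<in> ?I" if "H \<in> ideal_gen S F" for H
      using that
    proof (induction H rule: ideal_gen.induct)
      case (step G f H)
      have "coeff G i * coeff f (n + c - i) \<in> ?I" for i
      proof (cases "i \<ge> n")
        case True
        then have "coeff G i \<in> ipow A Y n" using S(3)[OF step(1), of i] ipow_mono by blast
        moreover have "coeff f (n + c - i) \<in> K" using step(2) F(2) by (auto simp: J_def)
        ultimately show ?thesis
          by (intro ideal_gen_base[OF A] CollectI exI[of _ "coeff f (n + c - i)"] exI[of _ "coeff G i"])
            (auto simp: mult.commute)
      next
        case False
        then have "coeff f (n + c - i) = 0" using c[OF step(2)] by (intro coeff_eq_0) auto
        then show ?thesis by (simp add: ideal_gen.zero)
      qed
      then have "(\<Sum>i\<in>T. coeff G i * coeff f (n + c - i)) \<in> ?I" for T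
        by (induction T rule: infinite_finite_induct) (auto intro: ideal_gen.zero ideal_gen_add[OF A])
      then show ?case using step by (auto simp: coeff_mult intro: ideal_gen_add[OF A])
    qed (simp add: ideal_gen.zero)
    moreover have "monom a (n + c) \<in> J"
      using a S(2)[OF a(1)] K by (auto simp: J_def is_ideal_def)
    ultimately have "coeff (monom a (n + c)) (n + c) \<in> ?I" using F(3) by blast
    then show ?thesis by simp
  qed
  then show ?thesis by blast
qed

end

section \<open>Rings of polynomial functions\<close>

lemma sum_fun_apply: "(\<Sum>i\<in>S. f i) x = (\<Sum>i\<in>S. f i x :: 'b::comm_monoid_add)"
  by (induction S rule: infinite_finite_induct) auto

lemma power_fun_apply: "(f ^ n) x = (f x :: 'b::comm_monoid_mult) ^ n"
  by (induction n) auto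

lemma prod_fun_apply: "(\<Prod>i\<in>S. f i) x = (\<Prod>i\<in>S. f i x :: 'b::comm_monoid_mult)"
  by (induction S rule: infinite_finite_induct) auto

lemma minus_fun_apply': "(f - g) x = (f x - g x :: 'b::ab_group_add)"
  by (metis add_diff_cancel diff_add_cancel plus_fun_apply)

lemma poly_funs_subring: "is_subring (poly_funs I :: (('i \<Rightarrow> 'k::field) \<Rightarrow> 'k) set)"
  unfolding is_subring_def
proof (intro conjI ballI)
  show "1 \<in> (poly_funs I :: (('i \<Rightarrow> 'k) \<Rightarrow> 'k) set)"
    unfolding one_fun_def by (rule poly_funs.const)
  fix f g :: "('i \<Rightarrow> 'k) \<Rightarrow> 'k" assume "f \<in> poly_funs I" "g \<in> poly_funs I"
  then show "f * g \<in> poly_funs I" unfolding times_fun_def by (rule poly_funs.mult)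
  have "(\<lambda>x. f x + (- 1) * g x) \<in> poly_funs I"
    using \<open>f \<in> poly_funs I\<close> \<open>g \<in> poly_funs I\<close> by (intro poly_funs.intros)
  also have "(\<lambda>x. f x + (- 1) * g x) = f - g"
    by (simp add: fun_eq_iff minus_fun_apply')
  finally show "f - g \<in> poly_funs I" .
qed

lemmas poly_funs_ring = subring_one[OF poly_funs_subring] subring_diff[OF poly_funs_subring]
  subring_mult[OF poly_funs_subring] subring_zero[OF poly_funs_subring]
  subring_add[OF poly_funs_subring] subring_power[OF poly_funs_subring]
  subring_sum[OF poly_funs_subring] subring_prod[OF poly_funs_subring]
  subring_uminus[OF poly_funs_subring]

lemma poly_funs_mono: "I \<subseteq> J \<Longrightarrow> poly_funs I \<subseteq> poly_funs J"
proof
  fix f :: "('a \<Rightarrow> 'b::field) \<Rightarrow> 'b" assume "f \<in> poly_funs I" "I \<subseteq> J"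
  then show "f \<in> poly_funs J"
    by (induction f rule: poly_funs.induct) (auto intro: poly_funs.intros)
qed

lemma poly_funs_cong:
  "f \<in> poly_funs I \<Longrightarrow> (\<And>i. i \<in> I \<Longrightarrow> x i = y i) \<Longrightarrow> f x = f y"
  by (induction f rule: poly_funs.induct) auto

lemma poly_funs_compose:
  assumes "f \<in> poly_funs I" "\<And>i. i \<in> I \<Longrightarrow> (\<lambda>x. \<phi> x i) \<in> poly_funs J"
  shows "(\<lambda>x. f (\<phi> x)) \<in> poly_funs J"
  using assms by (induction f rule: poly_funs.induct) (auto intro: poly_funs.intros)

lemma poly_funs_insert:
  "poly_funs (insert i I) = (adjoin (poly_funs I) (\<lambda>x. x i) :: (('i \<Rightarrow> 'k::field) \<Rightarrow> 'k) set)"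
proof
  let ?B = "adjoin (poly_funs I) (\<lambda>x. x i) :: (('i \<Rightarrow> 'k) \<Rightarrow> 'k) set"
  note subB = adjoin_subring[OF poly_funs_subring, of I "\<lambda>x. x i"]
  show "?B \<subseteq> poly_funs (insert i I)"
    by (intro adjoin_least poly_funs_subring poly_funs_mono poly_funs.coord) auto
  show "poly_funs (insert i I) \<subseteq> ?B"
  proof
    fix f :: "('i \<Rightarrow> 'k) \<Rightarrow> 'k" assume "f \<in> poly_funs (insert i I)"
    then show "f \<in> ?B"
    proof (induction f rule: poly_funs.induct)
      case (const c)
      show ?case using adjoin_base[OF poly_funs_subring] poly_funs.const by blast
    next
      case (coord j)
      then show ?case
        using adjoin_base[OF poly_funs_subring] adjoin_elem[OF poly_funs_subring] poly_funs.coord[of j I]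
        by (cases "j = i") blast+
    next
      case (add f g)
      then show ?case using subring_add[OF subB] by (fastforce simp: plus_fun_def)
    next
      case (mult f g)
      then show ?case using subring_mult[OF subB] by (fastforce simp: times_fun_def)
    qed
  qed
qed

lemma poly_funs_empty: "poly_funs {} = range (\<lambda>c x. c)"
proof
  show "poly_funs {} \<subseteq> (range (\<lambda>c x. c) :: (('a \<Rightarrow> 'b::field) \<Rightarrow> 'b) set)"
  proof
    fix f :: "('a \<Rightarrow> 'b) \<Rightarrow> 'b" assume "f \<in> poly_funs {}"
    then show "f \<in> range (\<lambda>c x. c)" by (induction f rule: poly_funs.induct) auto
  qed
qed (auto intro: poly_funs.const)

lemma noetherian_poly_funs:
  assumes "finite I"
  shows "noetherian (poly_funs I :: (('i \<Rightarrow> 'k::field) \<Rightarrow> 'k) set)"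
  using assms
proof (induction I)
  case empty
  show ?case unfolding noetherian_def
  proof (intro conjI poly_funs_subring allI impI)
    fix J :: "(('i \<Rightarrow> 'k) \<Rightarrow> 'k) set" assume J: "is_ideal (poly_funs {}) J"
    show "\<exists>F. finite F \<and> F \<subseteq> J \<and> J \<subseteq> ideal_gen (poly_funs {}) F"
    proof (cases "J = {0}")
      case True
      then show ?thesis by (intro exI[of _ "{}"]) (auto intro: ideal_gen.zero)
    next
      case False
      then obtain c where c: "(\<lambda>x. c) \<in> J" "c \<noteq> 0"
        using J unfolding is_ideal_def poly_funs_empty by (fastforce simp: zero_fun_def)
      have "J \<subseteq> ideal_gen (poly_funs {}) {\<lambda>x. c}"
      proof
        fix f assume "f \<in> J"
        then obtain a where f: "f = (\<lambda>x. a)" using J by (auto simp: is_ideal_def poly_funs_empty)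
        have "(\<lambda>x. a / c) * (\<lambda>x. c) + 0 \<in> ideal_gen (poly_funs {}) {\<lambda>x :: 'i \<Rightarrow> 'k. c}"
          by (intro ideal_gen.intros poly_funs.const) auto
        also have "(\<lambda>x :: 'i \<Rightarrow> 'k. a / c) * (\<lambda>x. c) + 0 = f" using c by (auto simp: f times_fun_def)
        finally show "f \<in> ideal_gen (poly_funs {}) {\<lambda>x. c}" .
      qed
      then show ?thesis using c by (intro exI[of _ "{\<lambda>x. c}"]) auto
    qed
  qed
next
  case (insert i I)
  then show ?case by (simp add: poly_funs_insert hilbert_basis)
qed

section \<open>Hilbert's Nullstellensatz\<close>

definition is_prime_ideal :: "'r::comm_ring_1 set \<Rightarrow> 'r set \<Rightarrow> bool" where
  "is_prime_ideal A P \<longleftrightarrow> is_ideal A P \<and> 1 \<notin> P \<and> (\<forall>x\<in>A. \<forall>y\<in>A. x * y \<in> P \<longrightarrow> x \<in> P \<or> y \<in> P)"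

lemma prime_ideal_contraction:
  assumes A: "is_subring A" "A \<subseteq> B" and P: "is_prime_ideal B P"
  shows "is_prime_ideal A (P \<inter> A)"
proof -
  have P': "is_ideal B P" "1 \<notin> P" "\<And>x y. x \<in> B \<Longrightarrow> y \<in> B \<Longrightarrow> x * y \<in> P \<Longrightarrow> x \<in> P \<or> y \<in> P"
    using P by (auto simp: is_prime_ideal_def)
  show ?thesis
    unfolding is_prime_ideal_def is_ideal_def
  proof (intro conjI ballI impI)
    show "0 \<in> P \<inter> A" using P'(1) subring_zero[OF A(1)] by (simp add: is_ideal_def)
    show "1 \<notin> P \<inter> A" using P'(2) by simp
    fix x y
    show "x + y \<in> P \<inter> A" if "x \<in> P \<inter> A" "y \<in> P \<inter> A"
      using that P'(1) subring_add[OF A(1)] by (auto simp: is_ideal_def)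
    show "x * y \<in> P \<inter> A" if "x \<in> A" "y \<in> P \<inter> A"
      using that P'(1) subring_mult[OF A(1)] A(2) by (auto simp: is_ideal_def)
    show "x \<in> P \<inter> A \<or> y \<in> P \<inter> A" if "x \<in> A" "y \<in> A" "x * y \<in> P \<inter> A"
      using that P'(3) A(2) by blast
  qed simp
qed

lemma prime_power: "is_subring A \<Longrightarrow> is_prime_ideal A P \<Longrightarrow> x \<in> A \<Longrightarrow> x ^ n \<in> P \<Longrightarrow> x \<in> P"
proof (induction n)
  case (Suc n)
  then show ?case using subring_power[of A x n] unfolding is_prime_ideal_def power_Suc by blast
qed (simp add: is_prime_ideal_def)

text \<open>Powers of the leading coefficient take the place of inverses. Degrees are bounded by
  vanishing of coefficients, so that a constant \<open>D\<close> forces the remainder 0 and the zero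
  polynomial needs no separate treatment. The bound on \<open>Q\<close> later shows that the
  cofactor of a nonconstant divisor has smaller degree than the dividend.\<close>

lemma pseudo_division:
  fixes A :: "'r::comm_ring_1 set"
  assumes A: "is_subring A" and D: "D \<in> polys_over A"
    and G: "G \<in> polys_over A" "\<And>j. j \<ge> n \<Longrightarrow> coeff G j = 0"
  shows "\<exists>e. \<exists>Q\<in>polys_over A. \<exists>R\<in>polys_over A. smult (lead_coeff D ^ e) G = Q * D + R \<and>
    (\<forall>j\<ge>degree D. coeff R j = 0) \<and> (\<forall>j. j + degree D \<ge> n \<longrightarrow> coeff Q j = 0)"
  using G
proof (induction n arbitrary: G)
  case 0
  then show ?case
    using subring_zero[OF polys_over_subring[OF A]]
    by (intro exI[of _ 0] bexI[of _ 0] bexI[of _ G]) auto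
next
  case (Suc n G)
  note subP = polys_over_subring[OF A]
  have lcA: "lead_coeff D \<in> A" "coeff G n \<in> A" using D Suc.prems by (auto simp: polys_over_def)
  show ?case
  proof (cases "degree D \<le> n")
    case False
    then show ?thesis
      using subring_zero[OF subP] Suc.prems
      by (intro exI[of _ 0] bexI[of _ 0] bexI[of _ G]) auto
  next
    case True
    define m where "m = monom (coeff G n) (n - degree D)"
    have mA: "m \<in> polys_over A" unfolding m_def by (rule polys_over_monom[OF A lcA(2)])
    define G' where "G' = smult (lead_coeff D) G - m * D"
    have G'A: "G' \<in> polys_over A" unfolding G'_def
      using mA D Suc.prems(1) lcA by (intro subring_diff[OF subP] subring_mult[OF subP] polys_over_smult[OF A])
    have "coeff G' j = 0" if "j \<ge> n" for j
    proof (cases "j = n")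
      case True
      have "coeff (m * D) n = coeff G n * lead_coeff D"
        using \<open>degree D \<le> n\<close> by (simp add: m_def coeff_monom_mult)
      then show ?thesis using True by (simp add: G'_def)
    next
      case False
      then have "coeff G j = 0" "coeff D (j - (n - degree D)) = 0"
        using that Suc.prems(2)[of j] \<open>degree D \<le> n\<close> by (auto intro!: coeff_eq_0)
      then show ?thesis by (simp add: G'_def m_def coeff_monom_mult)
    qed
    from Suc.IH[OF G'A this] obtain e Q R where QR: "Q \<in> polys_over A" "R \<in> polys_over A"
      "smult (lead_coeff D ^ e) G' = Q * D + R" "\<forall>j\<ge>degree D. coeff R j = 0"
      "\<forall>j. j + degree D \<ge> n \<longrightarrow> coeff Q j = 0"
      by blast
    define Q' where "Q' = Q + smult (lead_coeff D ^ e) m"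
    have "smult (lead_coeff D ^ Suc e) G = smult (lead_coeff D ^ e) G' + smult (lead_coeff D ^ e) m * D"
      by (simp add: G'_def algebra_simps smult_diff_right)
    also have "\<dots> = Q' * D + R" by (simp add: QR(3) Q'_def algebra_simps)
    finally have "smult (lead_coeff D ^ Suc e) G = Q' * D + R" .
    moreover have "Q' \<in> polys_over A" unfolding Q'_def
      using QR(1) mA lcA by (intro subring_add[OF subP] polys_over_smult[OF A] subring_power[OF A])
    moreover have "\<forall>j. j + degree D \<ge> Suc n \<longrightarrow> coeff Q' j = 0"
      using QR(5) True by (auto simp: Q'_def m_def)
    ultimately show ?thesis using QR(2,4) by blast
  qed
qed

lemma polys_over_ideal:
  assumes "is_subring A" "is_ideal A P"
  shows "is_ideal (polys_over A) (polys_over P)"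
  unfolding is_ideal_def
proof (intro conjI ballI)
  fix F G assume "F \<in> polys_over A" "G \<in> polys_over P"
  show "F * G \<in> polys_over P"
    unfolding polys_over_def
  proof (intro CollectI allI)
    fix n
    have "coeff F i * coeff G (n - i) \<in> P" for i
      using assms(2) \<open>F \<in> polys_over A\<close> \<open>G \<in> polys_over P\<close> by (auto simp: polys_over_def is_ideal_def)
    then show "coeff (F * G) n \<in> P"
      unfolding coeff_mult by (intro ideal_sum_closed[OF assms])
  qed
qed (use assms(2) in \<open>auto simp: polys_over_def is_ideal_def\<close>)

text \<open>Over the quotient by \<open>P\<close> the degree is read off from the last coefficient
  outside \<open>P\<close>; dropping the terms above it gives a polynomial whose leading coefficient
  survives modulo \<open>P\<close>. The last conclusion ties the new degree to a coefficient of
  \<open>F\<close>, hence bounds it wherever coefficients of \<open>F\<close> are known to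
  vanish.\<close>

lemma truncate_mod:
  assumes A: "is_subring A" and P: "is_ideal A P" and F: "F \<in> polys_over A" "F \<notin> polys_over P"
  obtains F' where "F' \<in> polys_over A" "F - F' \<in> polys_over P" "lead_coeff F' \<notin> P"
    "coeff F (degree F') \<notin> P"
proof -
  define S where "S = {j. coeff F j \<notin> P}"
  have S0: "S \<subseteq> {..degree F}"
  proof
    fix j assume "j \<in> S"
    then have "coeff F j \<noteq> 0" using P by (auto simp: S_def is_ideal_def)
    then show "j \<in> {..degree F}" by (simp add: le_degree)
  qed
  have fS: "finite S" using S0 by (rule finite_subset) simp
  have S1: "S \<noteq> {}" using F(2) by (auto simp: S_def polys_over_def)
  define d where "d = Max S"
  have d: "d \<in> S" and dm: "\<And>j. j \<in> S \<Longrightarrow> j \<le> d"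
    using Max_in[OF fS S1] Max_ge[OF fS] by (auto simp: d_def)
  define F' where "F' = poly_cutoff (Suc d) F"
  have c: "coeff F' j = (if j \<le> d then coeff F j else 0)" for j
    by (simp add: F'_def coeff_poly_cutoff less_Suc_eq_le)
  have P0: "0 \<in> P" using P by (simp add: is_ideal_def)
  have "coeff F d \<noteq> 0" using d P0 by (auto simp: S_def)
  then have deg: "degree F' = d"
    by (intro antisym degree_le le_degree) (auto simp: c)
  show ?thesis
  proof (rule that)
    show "F' \<in> polys_over A" using F(1) subring_zero[OF A] by (auto simp: polys_over_def c)
    show "F - F' \<in> polys_over P" using P0 dm by (auto simp: polys_over_def c S_def not_le[symmetric])
    show "lead_coeff F' \<notin> P" "coeff F (degree F') \<notin> P" using d by (auto simp: deg c S_def)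
  qed
qed

text \<open>
  The algebraic case of one elimination step: over the fraction field of \<open>A\<close> modulo \<open>P\<close>, \<open>F\<close> is the
  minimal polynomial of \<open>t\<close>, and it is coprime to every \<open>H\<close> not vanishing at \<open>t\<close>.
\<close>

lemma minimal_polynomial:
  fixes A :: "'r::comm_ring_1 set"
  assumes A: "is_subring A" and P: "is_prime_ideal (adjoin A t) P"
    and F0: "F0 \<in> polys_over A" "F0 \<notin> polys_over (P \<inter> A)" "poly F0 t \<in> P"
  obtains F where "F \<in> polys_over A" "degree F > 0" "lead_coeff F \<notin> P" "poly F t \<in> P"
    "\<And>G. G \<in> polys_over A \<Longrightarrow> poly G t \<in> P \<Longrightarrow> \<exists>e. \<exists>Q\<in>polys_over A. \<exists>R\<in>polys_over (P \<inter> A).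
        smult (lead_coeff F ^ e) G = Q * F + R"
    "\<And>H. H \<in> polys_over A \<Longrightarrow> poly H t \<notin> P \<Longrightarrow> \<exists>d\<in>A - P. \<exists>U\<in>polys_over A. \<exists>V\<in>polys_over A.
        [:d:] - U * F - V * H \<in> polys_over (P \<inter> A)"
proof -
  define B where "B = adjoin A t"
  have subB: "is_subring B" using adjoin_subring[OF A] by (simp add: B_def)
  have AB: "A \<subseteq> B" using adjoin_base[OF A] by (simp add: B_def)
  have PB: "is_ideal B P" "1 \<notin> P" and Pprime: "\<And>x y. x \<in> B \<Longrightarrow> y \<in> B \<Longrightarrow> x * y \<in> P \<Longrightarrow> x \<in> P \<or> y \<in> P"
    using P by (auto simp: is_prime_ideal_def B_def)
  have Ppow: "x \<in> B \<Longrightarrow> x ^ e \<in> P \<Longrightarrow> x \<in> P" for x e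
    using prime_power[OF subB, of P x e] P by (simp add: B_def)
  have evB: "G \<in> polys_over A \<Longrightarrow> poly G t \<in> B" for G by (auto simp: B_def adjoin_def)
  define P0 where "P0 = P \<inter> A"
  have P0: "is_ideal A P0"
    using prime_ideal_contraction[OF A AB] P by (simp add: P0_def B_def is_prime_ideal_def)
  note subP = polys_over_subring[OF A] and idP = polys_over_ideal[OF A P0]
  have ev0: "poly R t \<in> P" if "R \<in> polys_over P0" for R
  proof -
    have "t \<in> B" using adjoin_elem[OF A] by (simp add: B_def)
    then have "t ^ i * coeff R i \<in> P" for i
      using that PB(1) subring_power[OF subB] unfolding is_ideal_def polys_over_def P0_def by blast
    then show ?thesis
      unfolding poly_altdef by (intro ideal_sum_closed[OF subB PB(1)]) (simp add: mult.commute)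
  qed
  define Z where "Z F \<longleftrightarrow> F \<in> polys_over A \<and> lead_coeff F \<notin> P \<and> poly F t \<in> P" for F
  have reduce: "\<exists>F. Z F \<and> coeff G (degree F) \<notin> P0"
    if G: "G \<in> polys_over A" "G \<notin> polys_over P0" "poly G t \<in> P" for G
  proof -
    obtain F where F: "F \<in> polys_over A" "G - F \<in> polys_over P0" "lead_coeff F \<notin> P0" "coeff G (degree F) \<notin> P0"
      using truncate_mod[OF A P0 G(1,2)] by blast
    have "poly G t - poly (G - F) t \<in> P" by (intro ideal_diff[OF subB PB(1)] G ev0 F)
    then have "poly F t \<in> P" by simp
    moreover have "lead_coeff F \<notin> P" using F by (auto simp: P0_def polys_over_def)
    ultimately show ?thesis using F by (auto simp: Z_def)
  qed
  obtain F1 where "Z F1" using reduce[OF F0[folded P0_def]] by blast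
  \<comment> \<open>\<open>Z\<close> admits only leading coefficients that stay nonzero modulo
    \<open>P\<close>, so the least degree in \<open>Z\<close> is the degree of \<open>t\<close> over
    the fraction field.\<close>
  then obtain F where F: "Z F" and Fmin: "\<And>G. Z G \<Longrightarrow> degree F \<le> degree G"
    using ex_has_least_nat[of Z F1 degree] by blast
  have FA: "F \<in> polys_over A" "lead_coeff F \<notin> P" "poly F t \<in> P" using F by (auto simp: Z_def)
  have lcF: "lead_coeff F \<in> A" using FA by (simp add: polys_over_def)
  \<comment> \<open>A counterexample, truncated to its last coefficient outside \<open>P\<close>,
    would be a member of \<open>Z\<close> of degree below that of \<open>F\<close>.\<close>
  have low: "G \<in> polys_over P0"
    if "G \<in> polys_over A" "poly G t \<in> P" "\<And>j. j \<ge> degree F \<Longrightarrow> coeff G j = 0" for G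
  proof (rule ccontr)
    assume "G \<notin> polys_over P0"
    from reduce[OF that(1) this that(2)] obtain F' where F': "Z F'" "coeff G (degree F') \<notin> P0" by blast
    then have "degree F' < degree F"
      using that(3)[of "degree F'"] P0 by (auto simp: is_ideal_def not_le[symmetric])
    then show False using Fmin[OF F'(1)] by simp
  qed
  have dF: "degree F > 0"
  proof (rule ccontr)
    assume "\<not> degree F > 0"
    then have "F = [:lead_coeff F:]" by (simp add: degree_0_id)
    then have "poly F t = lead_coeff F" by (metis mult_zero_right poly_0 poly_pCons add.right_neutral)
    then show False using FA by simp
  qed
  have div: "\<exists>e. \<exists>Q\<in>polys_over A. \<exists>R\<in>polys_over P0. smult (lead_coeff F ^ e) G = Q * F + R"
    if G: "G \<in> polys_over A" "poly G t \<in> P" for G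
  proof -
    obtain e Q R where QR: "Q \<in> polys_over A" "R \<in> polys_over A" "smult (lead_coeff F ^ e) G = Q * F + R"
      "\<forall>j\<ge>degree F. coeff R j = 0"
      using pseudo_division[OF A FA(1) G(1), of "Suc (degree G)"] by (auto simp: coeff_eq_0)
    have "R = smult (lead_coeff F ^ e) G - Q * F" using QR(3) by simp
    then have "poly R t = lead_coeff F ^ e * poly G t - poly Q t * poly F t" by simp
    moreover have "lead_coeff F ^ e \<in> B" using subring_power[OF A lcF] AB by blast
    ultimately have "poly R t \<in> P"
      using PB(1) G FA evB[OF QR(1)] ideal_diff[OF subB PB(1)] by (simp add: is_ideal_def)
    then have "R \<in> polys_over P0" using low QR by blast
    then show ?thesis using QR by blast
  qed
  have cop: "\<exists>d\<in>A - P. \<exists>U\<in>polys_over A. \<exists>V\<in>polys_over A. [:d:] - U * F - V * H \<in> polys_over P0"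
    if H: "H \<in> polys_over A" "poly H t \<notin> P" for H
  proof -
    \<comment> \<open>\<open>E\<close> is the ideal generated by \<open>F\<close> and
      \<open>H\<close> modulo \<open>P0\<close>. Its element \<open>D\<close> of least degree with
      leading coefficient outside \<open>P\<close> plays the part of their greatest common divisor;
      the aim is that \<open>D\<close> is constant.\<close>
    define E where "E = {D \<in> polys_over A. \<exists>U\<in>polys_over A. \<exists>V\<in>polys_over A. D - U * F - V * H \<in> polys_over P0}"
    have zeroP: "0 \<in> polys_over A" "1 \<in> polys_over A" "0 \<in> polys_over P0"
      using subring_zero[OF subP] subring_one[OF subP] idP by (auto simp: is_ideal_def)
    have "F \<in> E" unfolding E_def using FA zeroP by (intro CollectI conjI bexI[of _ 1] bexI[of _ 0]) auto
    have "H \<in> E" unfolding E_def using H zeroP by (intro CollectI conjI bexI[of _ 0] bexI[of _ 1]) auto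
    have Esub: "G - Q * D \<in> E" if GD: "G \<in> E" "D \<in> E" "Q \<in> polys_over A" for G D Q
    proof -
      from GD obtain U V U' V' where 1: "U \<in> polys_over A" "V \<in> polys_over A" "U' \<in> polys_over A" "V' \<in> polys_over A"
        "G - U * F - V * H \<in> polys_over P0" "D - U' * F - V' * H \<in> polys_over P0"
        unfolding E_def by blast
      have "Q * (D - U' * F - V' * H) \<in> polys_over P0"
        using 1(6) GD(3) idP by (simp add: is_ideal_def)
      from ideal_diff[OF subP idP 1(5) this]
      have "G - Q * D - (U - Q * U') * F - (V - Q * V') * H \<in> polys_over P0"
        by (simp add: algebra_simps)
      moreover have "U - Q * U' \<in> polys_over A" "V - Q * V' \<in> polys_over A" "G - Q * D \<in> polys_over A"
        using 1 GD by (auto simp: E_def intro!: subring_diff[OF subP] subring_mult[OF subP])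
      ultimately show ?thesis unfolding E_def by blast
    qed
    have Emult: "smult c G \<in> E" if "c \<in> A" "G \<in> E" for c G
    proof -
      have "[:- c:] \<in> polys_over A" using polys_over_const[OF A] subring_uminus[OF A] that by blast
      moreover have "0 \<in> E" using Esub[OF \<open>F \<in> E\<close> \<open>F \<in> E\<close> zeroP(2)] by simp
      ultimately show ?thesis using Esub[of 0 G "[:- c:]"] that by simp
    qed
    define Y where "Y D \<longleftrightarrow> D \<in> E \<and> lead_coeff D \<notin> P" for D
    have "Y F" using \<open>F \<in> E\<close> FA by (simp add: Y_def)
    then obtain D where D: "Y D" and Dmin: "\<And>G. Y G \<Longrightarrow> degree D \<le> degree G"
      using ex_has_least_nat[of Y F degree] by blast
    have DE: "D \<in> E" and DA: "D \<in> polys_over A" and lcD: "lead_coeff D \<notin> P" "lead_coeff D \<in> A"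
      using D by (auto simp: Y_def E_def polys_over_def)
    have divE: "\<exists>e. \<exists>Q\<in>polys_over A. \<exists>R\<in>polys_over P0. smult (lead_coeff D ^ e) G = Q * D + R
        \<and> (\<forall>j. j + degree D > degree G \<longrightarrow> coeff Q j = 0)"
      if G: "G \<in> E" for G
    proof -
      have GA: "G \<in> polys_over A" using G by (simp add: E_def)
      obtain e Q R where QR: "Q \<in> polys_over A" "R \<in> polys_over A" "smult (lead_coeff D ^ e) G = Q * D + R"
        "\<forall>j\<ge>degree D. coeff R j = 0" "\<forall>j. j + degree D \<ge> Suc (degree G) \<longrightarrow> coeff Q j = 0"
        using pseudo_division[OF A DA GA, of "Suc (degree G)"] by (auto simp: coeff_eq_0)
      have R: "R = smult (lead_coeff D ^ e) G - Q * D" using QR(3) by simp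
      have RE: "R \<in> E" unfolding R
        by (intro Esub Emult subring_power[OF A] lcD G DE QR)
      have "R \<in> polys_over P0"
      proof (rule ccontr)
        assume "R \<notin> polys_over P0"
        then obtain R' where R': "R' \<in> polys_over A" "R - R' \<in> polys_over P0" "lead_coeff R' \<notin> P0"
          "coeff R (degree R') \<notin> P0"
          using truncate_mod[OF A P0 QR(2)] by blast
        have "R' \<in> E"
        proof -
          obtain U V where UV: "U \<in> polys_over A" "V \<in> polys_over A" "R - U * F - V * H \<in> polys_over P0"
            using RE by (auto simp: E_def)
          have eq: "R' - U * F - V * H = (R - U * F - V * H) - (R - R')" by (simp add: algebra_simps)
          have "R' - U * F - V * H \<in> polys_over P0" unfolding eq by (rule ideal_diff[OF subP idP UV(3) R'(2)])
          then show ?thesis unfolding E_def using UV R' by blast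
        qed
        moreover have "lead_coeff R' \<notin> P" using R' by (auto simp: P0_def polys_over_def)
        ultimately have "degree D \<le> degree R'" using Dmin by (simp add: Y_def)
        then have "coeff R (degree R') = 0" using QR(4) by blast
        then show False using R'(4) P0 by (simp add: is_ideal_def)
      qed
      then show ?thesis using QR by (auto simp: Suc_le_eq)
    qed
    \<comment> \<open>\<open>D\<close> divides \<open>H\<close> up to a power of its leading
      coefficient, so \<open>poly D t\<close> in \<open>P\<close> would force
      \<open>poly H t\<close> into \<open>P\<close>.\<close>
    have evD: "poly D t \<notin> P"
    proof
      assume *: "poly D t \<in> P"
      obtain e Q R where QR: "Q \<in> polys_over A" "R \<in> polys_over P0" "smult (lead_coeff D ^ e) H = Q * D + R"
        using divE[OF \<open>H \<in> E\<close>] by blast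
      have "lead_coeff D ^ e * poly H t = poly Q t * poly D t + poly R t"
        using arg_cong[OF QR(3), of "\<lambda>F. poly F t"] by simp
      also have "\<dots> \<in> P" using * ev0[OF QR(2)] evB[OF QR(1)] PB(1) by (simp add: is_ideal_def)
      finally have "lead_coeff D ^ e \<in> P \<or> poly H t \<in> P"
        using Pprime[of "lead_coeff D ^ e" "poly H t"] subring_power[OF A lcD(2)] AB evB[OF H(1)] by blast
      then show False using H(2) Ppow[of "lead_coeff D" e] lcD AB by blast
    qed
    \<comment> \<open>\<open>D\<close> also divides \<open>F\<close> in this sense. As
      \<open>poly D t\<close> lies outside \<open>P\<close>, the cofactor vanishes at
      \<open>t\<close>. If \<open>D\<close> were nonconstant, the cofactor would have smaller degree
      than \<open>F\<close> and so be zero modulo \<open>P\<close>, and with it the product of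
      \<open>F\<close> and a power of \<open>lead_coeff D\<close>.\<close>
    have "degree D = 0"
    proof (rule ccontr)
      assume D0: "degree D \<noteq> 0"
      obtain e Q R where QR: "Q \<in> polys_over A" "R \<in> polys_over P0" "smult (lead_coeff D ^ e) F = Q * D + R"
        "\<forall>j. j + degree D > degree F \<longrightarrow> coeff Q j = 0"
        using divE[OF \<open>F \<in> E\<close>] by blast
      have lcDe: "lead_coeff D ^ e \<in> A" by (rule subring_power[OF A lcD(2)])
      have "Q * D = smult (lead_coeff D ^ e) F - R" using QR(3) by simp
      then have "poly Q t * poly D t = lead_coeff D ^ e * poly F t - poly R t"
        by (metis poly_diff poly_mult poly_smult)
      also have "\<dots> \<in> P"
        using FA(3) lcDe AB PB(1) by (intro ideal_diff[OF subB PB(1)] ev0[OF QR(2)]) (auto simp: is_ideal_def)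
      finally have "poly Q t \<in> P" using Pprime evB[OF QR(1)] evB[OF DA] evD by blast
      then have "Q \<in> polys_over P0"
        using D0 QR(4) by (intro low QR(1)) auto
      then have "D * Q + R \<in> polys_over P0" using QR(2) DA idP by (simp add: is_ideal_def)
      then have "smult (lead_coeff D ^ e) F \<in> polys_over P0" using QR(3) by (simp add: mult.commute)
      then have "lead_coeff D ^ e * lead_coeff F \<in> P" by (auto simp: polys_over_def P0_def)
      then have "lead_coeff D ^ e \<in> P \<or> lead_coeff F \<in> P" using Pprime lcDe lcF AB by blast
      then show False using FA(2) Ppow[of "lead_coeff D" e] lcD AB by blast
    qed
    then have "D = [:lead_coeff D:]" by (simp add: degree_0_id)
    then have "\<exists>U\<in>polys_over A. \<exists>V\<in>polys_over A. [:lead_coeff D:] - U * F - V * H \<in> polys_over P0"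
      using DE by (simp add: E_def)
    then show ?thesis using lcD by blast
  qed
  show ?thesis using that[OF FA(1) dF FA(2,3)] div cop by (simp add: P0_def)
qed

section \<open>Common zeros of a prime ideal, one coordinate at a time\<close>

lemma infinite_UNIV_alg_closed: "infinite (UNIV :: 'k::alg_closed_field set)"
proof
  assume fin: "finite (UNIV :: 'k set)"
  define p :: "'k poly" where "p = (\<Prod>a\<in>UNIV. [:- a, 1:])"
  have "degree p = card (UNIV :: 'k set)"
    unfolding p_def by (subst degree_prod_eq_sum_degree) auto
  then have "degree p > 0" using fin by (simp add: card_gt_0_iff)
  then have "degree (p + 1) > 0" by (simp add: degree_add_eq_left)
  then obtain x where "poly (p + 1) x = 0" using alg_closed_imp_poly_has_root by blast
  moreover have "poly p x = 0" using fin by (auto simp: p_def poly_prod prod_zero_iff)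
  ultimately show False by simp
qed

lemma poly_coord_apply:
  assumes "F \<in> polys_over (poly_funs I)" "i \<notin> I"
  shows "poly F (\<lambda>x. x i) (x(i := a)) = poly (map_poly (\<lambda>f. f x) F) (a :: 'k::field)"
proof -
  have "coeff F j (x(i := a)) = coeff F j x" for j
  proof (rule poly_funs_cong[of "coeff F j" I])
    show "coeff F j \<in> poly_funs I" using assms(1) by (simp add: polys_over_def)
    fix l assume "l \<in> I"
    then show "(x(i := a)) l = x l" using assms(2) by auto
  qed
  then have "poly F (\<lambda>x. x i) (x(i := a)) = (\<Sum>j\<le>degree F. coeff F j x * a ^ j)"
    by (simp add: poly_altdef sum_fun_apply power_fun_apply)
  also have "\<dots> = (\<Sum>j\<le>degree (map_poly (\<lambda>f. f x) F). coeff F j x * a ^ j)"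
  proof (rule sum.mono_neutral_right)
    show "\<forall>j\<in>{..degree F} - {..degree (map_poly (\<lambda>f. f x) F)}. coeff F j x * a ^ j = 0"
    proof
      fix j assume "j \<in> {..degree F} - {..degree (map_poly (\<lambda>f. f x) F)}"
      then have "coeff (map_poly (\<lambda>f. f x) F) j = 0" by (intro coeff_eq_0) auto
      then show "coeff F j x * a ^ j = 0" by (simp add: coeff_map_poly)
    qed
    have "degree (map_poly (\<lambda>f. f x) F) \<le> degree F"
      by (intro degree_le allI impI) (simp add: coeff_map_poly coeff_eq_0)
    then show "{..degree (map_poly (\<lambda>f. f x) F)} \<subseteq> {..degree F}" by simp
  qed simp
  finally show ?thesis by (simp add: poly_altdef coeff_map_poly)
qed

lemma poly_coord_apply_zero:
  assumes "F \<in> polys_over P" "P \<subseteq> poly_funs I" "i \<notin> I" "\<And>f. f \<in> P \<Longrightarrow> f x = 0"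
  shows "poly F (\<lambda>x. x i) (x(i := a)) = (0 :: 'k::field)"
proof -
  have "map_poly (\<lambda>f. f x) F = 0"
    using assms by (auto simp: poly_eq_iff coeff_map_poly polys_over_def)
  moreover have "F \<in> polys_over (poly_funs I)" using assms by (auto simp: polys_over_def)
  ultimately show ?thesis using poly_coord_apply[OF _ assms(3), of F x a] by simp
qed

text \<open>The function \<open>b\<close> that must not vanish makes the induction over the
  coordinates work: the zero found for fewer coordinates can be kept away from the zeros of those
  coefficients on which the choice of the next coordinate depends. The zero need not be extensional;
  \<open>nullstellensatz\<close> restricts it.\<close>

lemma prime_ideal_has_zero:
  fixes P :: "(('i \<Rightarrow> 'k::alg_closed_field) \<Rightarrow> 'k) set"
  assumes "finite I" "is_prime_ideal (poly_funs I) P" "b \<in> poly_funs I" "b \<notin> P"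
  shows "\<exists>x. (\<forall>f\<in>P. f x = 0) \<and> b x \<noteq> 0"
  using assms
proof (induction I arbitrary: P b)
  case empty
  have id: "is_ideal (poly_funs {}) P" using empty by (simp add: is_prime_ideal_def)
  have "f = 0" if "f \<in> P" for f
  proof (rule ccontr)
    assume "f \<noteq> 0"
    have "f \<in> range (\<lambda>c x. c)" using id that unfolding is_ideal_def poly_funs_empty by blast
    then obtain c where f: "f = (\<lambda>x. c)" by blast
    then have "c \<noteq> 0" using \<open>f \<noteq> 0\<close> by (auto simp: zero_fun_def)
    have "(\<lambda>x. 1 / c) * f \<in> P" using id that unfolding is_ideal_def by (blast intro: poly_funs.const)
    also have "(\<lambda>x. 1 / c) * f = 1" using \<open>c \<noteq> 0\<close> by (auto simp: f times_fun_def)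
    finally show False using empty unfolding is_prime_ideal_def by blast
  qed
  moreover obtain c where "b = (\<lambda>x. c)" using empty by (auto simp: poly_funs_empty)
  moreover have "b \<noteq> 0" using id empty by (auto simp: is_ideal_def)
  ultimately show ?case by (auto simp: zero_fun_def)
next
  case (insert i I)
  let ?A = "poly_funs I :: (('i \<Rightarrow> 'k) \<Rightarrow> 'k) set"
  define t :: "('i \<Rightarrow> 'k) \<Rightarrow> 'k" where "t = (\<lambda>x. x i)"
  have B: "poly_funs (insert i I) = adjoin ?A t" by (simp add: poly_funs_insert t_def)
  note subA = poly_funs_subring[of I, where 'k = 'k]
  note subB = adjoin_subring[OF subA, of t]
  have AB: "?A \<subseteq> adjoin ?A t" by (rule adjoin_base[OF subA])
  have P: "is_prime_ideal (adjoin ?A t) P" using insert.prems B by simp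
  then have idP: "is_ideal (adjoin ?A t) P" by (simp add: is_prime_ideal_def)
  have PB: "f \<in> adjoin ?A t" if "f \<in> P" for f
    using that idP by (auto simp: is_ideal_def)
  define P0 where "P0 = P \<inter> ?A"
  have P0A: "P0 \<subseteq> ?A" by (simp add: P0_def)
  have P0: "is_prime_ideal ?A P0"
    unfolding P0_def by (rule prime_ideal_contraction[OF subA AB P])
  obtain H where H: "H \<in> polys_over ?A" "poly H t = b" using insert.prems B by (auto simp: adjoin_def)
  show ?case
  proof (cases "\<exists>F. F \<in> polys_over ?A \<and> F \<notin> polys_over P0 \<and> poly F t \<in> P")
    \<comment> \<open>Without a relation modulo \<open>P\<close> the new coordinate is free, and all
      but finitely many of its values keep \<open>b\<close> nonzero.\<close>
    case False
    have "H \<notin> polys_over P0"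
    proof
      assume "H \<in> polys_over P0"
      then have "t ^ j * coeff H j \<in> P" for j
        using idP subring_power[OF subB adjoin_elem[OF subA]]
        unfolding polys_over_def P0_def is_ideal_def by blast
      then have "poly H t \<in> P"
        unfolding poly_altdef by (intro ideal_sum_closed[OF subB idP]) (simp add: mult.commute)
      then show False using H(2) insert.prems by simp
    qed
    then obtain j where j: "coeff H j \<notin> P0" by (auto simp: polys_over_def)
    have "coeff H j \<in> ?A" using H(1) by (simp add: polys_over_def)
    then obtain x where x: "\<And>f. f \<in> P0 \<Longrightarrow> f x = 0" "coeff H j x \<noteq> 0"
      using insert.IH[OF P0 _ j] by blast
    have "map_poly (\<lambda>f. f x) H \<noteq> 0"
      using x(2) by (auto simp: poly_eq_iff coeff_map_poly intro!: exI[of _ j])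
    then obtain a where a: "poly (map_poly (\<lambda>f. f x) H) a \<noteq> 0"
      using poly_roots_finite infinite_UNIV_alg_closed by (metis (mono_tags, lifting) UNIV_eq_I mem_Collect_eq)
    have "f (x(i := a)) = 0" if "f \<in> P" for f
    proof -
      obtain F where F: "F \<in> polys_over ?A" "poly F t = f"
        using PB[OF \<open>f \<in> P\<close>] by (auto simp: adjoin_def)
      then have "F \<in> polys_over P0" using False that by blast
      then show ?thesis using poly_coord_apply_zero[of F P0 I i x a] P0A insert.hyps(2) x(1) F by (simp add: t_def)
    qed
    moreover have "b (x(i := a)) \<noteq> 0"
      using a H(2) poly_coord_apply[OF H(1) insert.hyps(2)] by (simp add: t_def)
    ultimately show ?thesis by blast
  next
    case True
    then obtain F0 where "F0 \<in> polys_over ?A" "F0 \<notin> polys_over (P \<inter> ?A)" "poly F0 t \<in> P"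
      by (auto simp: P0_def)
    then obtain F where F: "F \<in> polys_over ?A" "degree F > 0" "lead_coeff F \<notin> P" "poly F t \<in> P"
      and div: "\<And>G. G \<in> polys_over ?A \<Longrightarrow> poly G t \<in> P \<Longrightarrow> \<exists>e. \<exists>Q\<in>polys_over ?A. \<exists>R\<in>polys_over (P \<inter> ?A).
        smult (lead_coeff F ^ e) G = Q * F + R"
      and cop: "\<And>H. H \<in> polys_over ?A \<Longrightarrow> poly H t \<notin> P \<Longrightarrow> \<exists>d\<in>?A - P. \<exists>U\<in>polys_over ?A. \<exists>V\<in>polys_over ?A.
        [:d:] - U * F - V * H \<in> polys_over (P \<inter> ?A)"
      by (rule minimal_polynomial[OF subA P]) blast
    obtain d U V where d: "d \<in> ?A" "d \<notin> P" and UV: "U \<in> polys_over ?A" "V \<in> polys_over ?A"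
      "[:d:] - U * F - V * H \<in> polys_over P0"
      using cop[of H] H insert.prems by (auto simp: P0_def)
    have lcF: "lead_coeff F \<in> ?A" using F(1) by (simp add: polys_over_def)
    \<comment> \<open>Two conditions are imposed on \<open>x\<close> at once. If
      \<open>lead_coeff F\<close> is nonzero there, \<open>F\<close> keeps its positive degree, so
      that it has a root to serve as new coordinate, and powers of \<open>lead_coeff F\<close> can
      be cancelled. If \<open>d\<close> is nonzero there, the relation d = U F + V H modulo
      \<open>P0\<close> keeps \<open>b\<close> nonzero at that root.\<close>
    have "lead_coeff F * d \<notin> P0"
      using P0 lcF d F(3) by (auto simp: is_prime_ideal_def P0_def)
    then obtain x where x: "\<And>f. f \<in> P0 \<Longrightarrow> f x = 0" "(lead_coeff F * d) x \<noteq> 0"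
      using insert.IH[OF P0, of "lead_coeff F * d"] subring_mult[OF subA lcF d(1)] by blast
    have "degree F \<le> degree (map_poly (\<lambda>f. f x) F)"
      using x(2) by (intro le_degree) (simp add: coeff_map_poly)
    then obtain a where a: "poly (map_poly (\<lambda>f. f x) F) a = 0"
      using alg_closed_imp_poly_has_root[of "map_poly (\<lambda>f. f x) F"] F(2) by auto
    define y where "y = x(i := a)"
    have Fy: "poly F t y = 0"
      using a poly_coord_apply[OF F(1) insert.hyps(2)] by (simp add: t_def y_def)
    have Ry: "poly R t y = 0" if "R \<in> polys_over P0" for R
      using poly_coord_apply_zero[of R P0 I i x a] that P0A insert.hyps(2) x(1) by (simp add: t_def y_def)
    have cy: "c y = c x" if "c \<in> ?A" for c
    proof (rule poly_funs_cong[OF that])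
      fix l assume "l \<in> I"
      then show "y l = x l" using insert.hyps(2) by (auto simp: y_def)
    qed
    have "f y = 0" if "f \<in> P" for f
    proof -
      obtain G where G: "G \<in> polys_over ?A" "poly G t = f"
        using PB[OF \<open>f \<in> P\<close>] by (auto simp: adjoin_def)
      then obtain e Q R where QR: "R \<in> polys_over P0" "smult (lead_coeff F ^ e) G = Q * F + R"
        using div[OF G(1)] \<open>f \<in> P\<close> by (auto simp: P0_def)
      have "lead_coeff F ^ e * f = poly Q t * poly F t + poly R t"
        using arg_cong[OF QR(2), of "\<lambda>F. poly F t"] G(2) by simp
      then have "(lead_coeff F ^ e * f) y = (poly Q t * poly F t + poly R t) y" by simp
      then have "lead_coeff F x ^ e * f y = 0"
        using Fy Ry[OF QR(1)] cy[OF lcF] by (simp add: power_fun_apply)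
      then show ?thesis using x(2) by simp
    qed
    moreover have "b y \<noteq> 0"
    proof
      assume "b y = 0"
      have "poly ([:d:] - U * F - V * H) t = d - poly U t * poly F t - poly V t * b"
        using H(2) by simp
      then have "d y - poly U t y * poly F t y - poly V t y * b y = 0"
        using Ry[OF UV(3)] by (simp add: minus_fun_apply')
      then show False using x(2) Fy \<open>b y = 0\<close> cy[OF d(1)] by simp
    qed
    ultimately show ?thesis by blast
  qed
qed

text \<open>An ideal maximal among those that contain \<open>J\<close> and no power of
  \<open>q\<close> is prime, and the ascending chain condition supplies one. The power
  \<open>q ^ 0\<close> accounts for properness.\<close>

lemma ex_prime_ideal_avoiding_powers:
  fixes A :: "'r::comm_ring_1 set"
  assumes A: "noetherian A" and J: "is_ideal A J" and q: "q \<in> A" "\<And>k. q ^ k \<notin> J"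
  obtains P where "is_prime_ideal A P" "J \<subseteq> P" "q \<notin> P"
proof -
  note subA = noetherian_subring[OF A]
  define \<S> where "\<S> = {K. is_ideal A K \<and> J \<subseteq> K \<and> (\<forall>k. q ^ k \<notin> K)}"
  have "\<exists>P\<in>\<S>. \<forall>K\<in>\<S>. P \<subseteq> K \<longrightarrow> K = P"
  proof (rule ccontr)
    assume "\<not> ?thesis"
    then have "\<forall>P\<in>\<S>. \<exists>K\<in>\<S>. P \<subset> K" by blast
    then obtain nxt where nxt: "\<And>P. P \<in> \<S> \<Longrightarrow> nxt P \<in> \<S> \<and> P \<subset> nxt P" by metis
    define ch where "ch n = (nxt ^^ n) J" for n
    have "J \<in> \<S>" using J q by (simp add: \<S>_def)
    then have ch: "ch n \<in> \<S>" for n by (induction n) (auto simp: ch_def nxt)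
    have lt: "ch n \<subset> ch (Suc n)" for n using nxt[OF ch[of n]] by (simp add: ch_def)
    have "is_ideal A (ch n)" for n using ch[of n] by (simp add: \<S>_def)
    then obtain N where "\<forall>n\<ge>N. ch n = ch N" using noetherian_chain_stabilizes[OF A] lt by (metis psubset_imp_subset)
    then have "ch (Suc N) = ch N" using le_SucI by blast
    then show False using lt[of N] by blast
  qed
  then obtain P where P: "P \<in> \<S>" and Pmax: "\<And>K. K \<in> \<S> \<Longrightarrow> P \<subseteq> K \<Longrightarrow> K = P" by blast
  have idP: "is_ideal A P" and JP: "J \<subseteq> P" and qP: "\<And>k. q ^ k \<notin> P" using P by (auto simp: \<S>_def)
  have grow: "\<exists>k p a. p \<in> P \<and> a \<in> A \<and> q ^ k = p + a * x" if x: "x \<in> A" "x \<notin> P" for x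
  proof -
    define K where "K = {u + v | u v. u \<in> P \<and> v \<in> (\<lambda>a. a * x) ` A}"
    have "is_ideal A ((\<lambda>a. a * x) ` A)"
      unfolding is_ideal_def
    proof (intro conjI ballI)
      show "(\<lambda>a. a * x) ` A \<subseteq> A" using x subring_mult[OF subA] by auto
      show "0 \<in> (\<lambda>a. a * x) ` A" using subring_zero[OF subA] by force
      fix u v assume "v \<in> (\<lambda>a. a * x) ` A"
      then obtain b where b: "b \<in> A" "v = b * x" by blast
      show "u + v \<in> (\<lambda>a. a * x) ` A" if "u \<in> (\<lambda>a. a * x) ` A"
        using that b subring_add[OF subA] by (auto simp: distrib_right[symmetric])
      show "u * v \<in> (\<lambda>a. a * x) ` A" if "u \<in> A"
        using that b subring_mult[OF subA] by (auto simp: mult.assoc[symmetric])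
    qed
    then have "is_ideal A K" unfolding K_def by (intro is_ideal_set_plus[OF subA] idP)
    moreover have "P \<subseteq> K"
    proof
      fix p assume "p \<in> P"
      then have "p = p + 0 * x" "0 \<in> A" using subring_zero[OF subA] by auto
      then show "p \<in> K" unfolding K_def using \<open>p \<in> P\<close> by blast
    qed
    moreover have "x \<in> K"
    proof -
      have "x = 0 + 1 * x" "0 \<in> P" using idP by (auto simp: is_ideal_def)
      then show ?thesis unfolding K_def using subring_one[OF subA] by blast
    qed
    ultimately have "K \<notin> \<S>" using Pmax[of K] x by blast
    then obtain k where "q ^ k \<in> K" using \<open>is_ideal A K\<close> \<open>P \<subseteq> K\<close> JP by (auto simp: \<S>_def)
    then show ?thesis by (auto simp: K_def)
  qed
  have "x \<in> P \<or> y \<in> P" if xy: "x \<in> A" "y \<in> A" "x * y \<in> P" for x y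
  proof (rule ccontr)
    assume "\<not> (x \<in> P \<or> y \<in> P)"
    then obtain k p a l r b where *: "p \<in> P" "a \<in> A" "q ^ k = p + a * x" "r \<in> P" "b \<in> A" "q ^ l = r + b * y"
      using grow[of x] grow[of y] xy by blast
    have "q ^ (k + l) = (r + b * y) * p + (a * x) * r + (a * b) * (x * y)"
      using * by (simp add: power_add algebra_simps)
    also have "\<dots> \<in> P"
    proof -
      have "r + b * y \<in> A" "a * x \<in> A" "a * b \<in> A"
        using * xy idP subring_mult[OF subA] subring_add[OF subA] by (auto simp: is_ideal_def)
      then have "(r + b * y) * p \<in> P" "(a * x) * r \<in> P" "(a * b) * (x * y) \<in> P"
        using idP * xy unfolding is_ideal_def by blast+
      then show ?thesis using idP unfolding is_ideal_def by blast
    qed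
    finally show False using qP by blast
  qed
  moreover have "1 \<notin> P" using qP[of 0] by simp
  ultimately have "is_prime_ideal A P" using idP by (simp add: is_prime_ideal_def)
  then show ?thesis using that JP qP[of 1] by simp
qed

text \<open>Instead of adjoining an inverse of \<open>q\<close>, a prime ideal over \<open>J\<close>
  avoiding all powers of \<open>q\<close> is chosen; it has a zero at which \<open>q\<close> does
  not vanish.\<close>

lemma nullstellensatz:
  fixes J :: "(('i \<Rightarrow> 'k::alg_closed_field) \<Rightarrow> 'k) set"
  assumes I: "finite I" and J: "is_ideal (poly_funs I) J" and q: "q \<in> poly_funs I"
    and van: "\<And>x. x \<in> affine_space I \<Longrightarrow> (\<And>f. f \<in> J \<Longrightarrow> f x = 0) \<Longrightarrow> q x = 0"
  shows "\<exists>k. q ^ k \<in> J"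
proof (rule ccontr)
  assume "\<not> (\<exists>k. q ^ k \<in> J)"
  then obtain P where P: "is_prime_ideal (poly_funs I) P" "J \<subseteq> P" "q \<notin> P"
    using ex_prime_ideal_avoiding_powers[OF noetherian_poly_funs[OF I] J q] by blast
  obtain x where x: "\<And>f. f \<in> P \<Longrightarrow> f x = 0" "q x \<noteq> 0"
    using prime_ideal_has_zero[OF I P(1) q P(3)] by blast
  have "f (restrict x I) = f x" if "f \<in> poly_funs I" for f
    using that by (rule poly_funs_cong) simp
  moreover have "J \<subseteq> poly_funs I" using J by (simp add: is_ideal_def)
  ultimately have "f (restrict x I) = 0" if "f \<in> J" for f using x P(2) that by (metis subsetD)
  then have "q (restrict x I) = 0" by (intro van) auto
  moreover have "q (restrict x I) = q x" using q by (rule poly_funs_cong) simp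
  ultimately show False using x(2) by simp
qed

section \<open>Growth of the powers of an ideal\<close>

abbreviation ideal_sum :: "'r::comm_ring_1 set \<Rightarrow> 'r set \<Rightarrow> 'r set" where
  "ideal_sum J K \<equiv> {x + y | x y. x \<in> J \<and> y \<in> K}"

lemma ideal_sum_mono: "J \<subseteq> J' \<Longrightarrow> K \<subseteq> K' \<Longrightarrow> ideal_sum J K \<subseteq> ideal_sum J' K'"
  by blast

lemma ideal_sum_left: "0 \<in> K \<Longrightarrow> J \<subseteq> ideal_sum J K"
  by force

lemma ideal_sum_right: "0 \<in> J \<Longrightarrow> K \<subseteq> ideal_sum J K"
  by force

text \<open>Artin--Rees for the principal ideal of \<open>x\<close> in the quotient by
  \<open>L\<close>. There \<open>x\<close> is not a zero divisor, as \<open>L\<close> is prime, so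
  dividing by \<open>x\<close> makes sense and loses at most \<open>c\<close> powers.\<close>

lemma artin_rees_quotient:
  fixes A :: "'r::comm_ring_1 set"
  assumes A: "noetherian A" and Y: "finite Y" "Y \<subseteq> A" and L: "is_prime_ideal A L" and x: "x \<in> A" "x \<notin> L"
  shows "\<exists>c. \<forall>n. \<forall>e\<in>A. x * e \<in> ideal_sum L (ipow A Y (n + c)) \<longrightarrow> e \<in> ideal_sum L (ipow A Y n)"
proof -
  note subA = noetherian_subring[OF A]
  have idL: "is_ideal A L" using L by (simp add: is_prime_ideal_def)
  note idM = is_ideal_ipow[OF subA Y(2)]
  define K where "K = ideal_gen A (insert x L)"
  have sub: "insert x L \<subseteq> A" using x idL by (auto simp: is_ideal_def)
  have idK: "is_ideal A K" unfolding K_def by (rule is_ideal_gen[OF subA sub])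
  have LK: "L \<subseteq> K" and xK: "x \<in> K" using ideal_gen_base[OF subA] by (auto simp: K_def)
  obtain c where c: "\<And>n. ipow A Y (n + c) \<inter> K \<subseteq> ideal_gen A {k * m | k m. k \<in> K \<and> m \<in> ipow A Y n}"
    using artin_rees[OF subA Y(2) A Y(1) idK] by blast
  \<comment> \<open>Modulo \<open>L\<close> every element of \<open>K\<close> is a multiple of
    \<open>x\<close>; hence elements of \<open>K\<close> times a power of the ideal become
    \<open>x\<close> times elements of that power.\<close>
  have Kx: "\<exists>a\<in>A. k - x * a \<in> L" if "k \<in> K" for k
    using that unfolding K_def
  proof (induction k rule: ideal_gen.induct)
    case zero
    then show ?case using idL subring_zero[OF subA] by (intro bexI[of _ 0]) (auto simp: is_ideal_def)
  next
    case (step a f k)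
    then obtain b where b: "b \<in> A" "k - x * b \<in> L" by blast
    show ?case
    proof (cases "f = x")
      case True
      then have "a * f + k - x * (a + b) = k - x * b" by (simp add: algebra_simps)
      then show ?thesis using b step subring_add[OF subA] by (metis (no_types))
    next
      case False
      then have "a * f + (k - x * b) \<in> L" using idL b step by (auto simp: is_ideal_def)
      then show ?thesis using b by (intro bexI[of _ b]) (auto simp: algebra_simps)
    qed
  qed
  have gen: "\<exists>m\<in>ipow A Y n. g - x * m \<in> L"
    if "g \<in> ideal_gen A {k * m | k m. k \<in> K \<and> m \<in> ipow A Y n}" for g n
    using that
  proof (induction g rule: ideal_gen.induct)
    case zero
    then show ?case using idL idM[of n] by (intro bexI[of _ 0]) (auto simp: is_ideal_def)
  next
    case (step a f g)
    then obtain m where m: "m \<in> ipow A Y n" "g - x * m \<in> L" by blast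
    obtain k m' where k: "f = k * m'" "k \<in> K" "m' \<in> ipow A Y n" using step by blast
    obtain b where b: "b \<in> A" "k - x * b \<in> L" using Kx[OF k(2)] by blast
    have mA: "m' \<in> A" using k ipow_subset[OF subA Y(2)] by blast
    have "a * m' * (k - x * b) + (g - x * m) \<in> L"
      using idL b m mA step subring_mult[OF subA] by (simp add: is_ideal_def)
    also have "a * m' * (k - x * b) + (g - x * m) = (a * f + g) - x * (a * b * m' + m)"
      by (simp add: k algebra_simps)
    finally show ?case
      using idM[of n] m k b step subring_mult[OF subA, of a b]
      by (intro bexI[of _ "a * b * m' + m"]) (auto simp: is_ideal_def)
  qed
  have "e \<in> ideal_sum L (ipow A Y n)"
    if e: "e \<in> A" "x * e \<in> ideal_sum L (ipow A Y (n + c))" for n e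
  proof -
    obtain l m where lm: "x * e = l + m" "l \<in> L" "m \<in> ipow A Y (n + c)" using e by blast
    have "m = e * x - l" using lm by (simp add: mult.commute)
    moreover have "e * x \<in> K" using idK xK e by (auto simp: is_ideal_def)
    ultimately have "m \<in> K" using ideal_diff[OF subA idK _ subsetD[OF LK lm(2)]] by blast
    then obtain m' where m': "m' \<in> ipow A Y n" "m - x * m' \<in> L" using gen[of m n] c lm(3) by blast
    have "x * (e - m') = l + (m - x * m')" using lm(1) by (simp add: algebra_simps)
    also have "\<dots> \<in> L" using idL lm m' by (simp add: is_ideal_def)
    finally have "e - m' \<in> L"
      using L x e m' ipow_subset[OF subA Y(2)] subring_diff[OF subA]
      unfolding is_prime_ideal_def by blast
    then have "e = (e - m') + m'" "e - m' \<in> L" by auto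
    then show ?thesis using m' by blast
  qed
  then show ?thesis by blast
qed

section \<open>Monomials in the generators of an ideal\<close>

lemma prod_pow_in_ipow:
  assumes A: "is_subring A" "Y \<subseteq> A" and F: "finite F" "F \<subseteq> ipow A Y 1"
  shows "(\<Prod>f\<in>F. f ^ \<alpha> f) \<in> ipow A Y (\<Sum>f\<in>F. \<alpha> f)"
proof -
  have pow: "f ^ n \<in> ipow A Y n" if "f \<in> ipow A Y 1" for f n
  proof (induction n)
    case (Suc n)
    then show ?case using ipow_mult[OF A that, of "f ^ n" n] by simp
  qed (simp add: subring_one[OF A(1)])
  show ?thesis using F
  proof (induction F)
    case empty
    then show ?case by (simp add: subring_one[OF A(1)])
  next
    case (insert f F)
    then have "f ^ \<alpha> f * (\<Prod>f\<in>F. f ^ \<alpha> f) \<in> ipow A Y (\<alpha> f + (\<Sum>f\<in>F. \<alpha> f))"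
      by (intro ipow_mult[OF A] pow) auto
    then show ?case using insert.hyps by simp
  qed
qed

lemma generators_in_ipow:
  assumes "is_subring A" "Y \<subseteq> A"
  shows "Y \<subseteq> ipow A Y 1"
  using ipow_gen_mult[OF assms, of _ 1 0] subring_one[OF assms(1)] by auto

lemma ipow_monomials:
  assumes A: "is_subring A" "Y \<subseteq> A" and "finite Y"
  shows "ipow A Y n \<subseteq> ideal_gen A {\<Prod>y\<in>Y. y ^ \<alpha> y | \<alpha>. (\<Sum>y\<in>Y. \<alpha> y) = n}"
proof (induction n)
  case 0
  have "1 = (\<Prod>y\<in>Y. y ^ 0)" by simp
  then have "1 \<in> {\<Prod>y\<in>Y. y ^ \<alpha> y | \<alpha>. (\<Sum>y\<in>Y. \<alpha> y) = 0}"
    by (intro CollectI exI[of _ "\<lambda>_. 0"]) auto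
  then have "a * 1 + 0 \<in> ideal_gen A {\<Prod>y\<in>Y. y ^ \<alpha> y | \<alpha>. (\<Sum>y\<in>Y. \<alpha> y) = 0}" if "a \<in> A" for a
    using that by (intro ideal_gen.intros)
  then show ?case by auto
next
  case (Suc n)
  let ?I = "ideal_gen A {\<Prod>y\<in>Y. y ^ \<alpha> y | \<alpha>. (\<Sum>y\<in>Y. \<alpha> y) = Suc n}"
  have mult: "y * g \<in> ?I" if y: "y \<in> Y" and g: "g \<in> ideal_gen A {\<Prod>y\<in>Y. y ^ \<alpha> y | \<alpha>. (\<Sum>y\<in>Y. \<alpha> y) = n}" for y g
    using g
  proof (induction g rule: ideal_gen.induct)
    case (step a f g)
    then obtain \<alpha> where \<alpha>: "f = (\<Prod>y\<in>Y. y ^ \<alpha> y)" "(\<Sum>y\<in>Y. \<alpha> y) = n" by blast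
    have "y * f = (\<Prod>z\<in>Y. z ^ (\<alpha>(y := Suc (\<alpha> y))) z)"
      unfolding \<alpha>(1) using \<open>finite Y\<close> y
      by (simp add: prod.remove[of Y y] mult.assoc[symmetric])
    moreover have "(\<Sum>z\<in>Y. (\<alpha>(y := Suc (\<alpha> y))) z) = Suc n"
      unfolding \<alpha>(2)[symmetric] using \<open>finite Y\<close> y by (simp add: sum.remove[of Y y])
    ultimately have "a * (y * f) + y * g \<in> ?I"
      using step by (intro ideal_gen.step) blast+
    then show ?case by (simp add: algebra_simps)
  qed (simp add: ideal_gen.zero)
  show ?case
  proof
    fix a assume "a \<in> ipow A Y (Suc n)"
    then have "a \<in> ideal_gen A {y * g | y g. y \<in> Y \<and> g \<in> ipow A Y n}" by simp
    then show "a \<in> ?I"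
    proof (induction a rule: ideal_gen.induct)
      case (step b f x)
      then obtain y g where "f = y * g" "y \<in> Y" "g \<in> ipow A Y n" by blast
      then have "f \<in> ?I" using mult Suc.IH by blast
      then show ?case using step ideal_gen_add[OF A(1)] ideal_gen_mult[OF A(1)] by blast
    qed (rule ideal_gen.zero)
  qed
qed

text \<open>Let M be the ideal generated by \<open>Y\<close>. A monomial of large degree contains
  some \<open>y ^ k\<close>, which can be traded for an element of \<open>J\<close> at the gain of
  one power of M. The error term is inherent in the intended use: at an isolated zero, M^K lies in
  \<open>J\<close> only near the point.\<close>

lemma ipow_le_of_powers:
  assumes A: "is_subring A" "Y \<subseteq> A" and Y: "finite Y" and J: "is_ideal A J"
    and k: "\<And>y. y \<in> Y \<Longrightarrow> y ^ k \<in> ideal_sum J (ipow A Y (Suc k))"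
  shows "\<exists>K. ipow A Y K \<subseteq> ideal_sum J (ipow A Y (Suc K))"
proof -
  \<comment> \<open>Exponents all below \<open>k\<close> would sum to at most
    \<open>card Y * k\<close>.\<close>
  define K where "K = card Y * k + 1"
  let ?S = "ideal_sum J (ipow A Y (Suc K))"
  have idS: "is_ideal A ?S" by (intro is_ideal_set_plus[OF A(1)] J is_ideal_ipow[OF A])
  have "{\<Prod>y\<in>Y. y ^ \<alpha> y | \<alpha>. (\<Sum>y\<in>Y. \<alpha> y) = K} \<subseteq> ?S"
  proof
    fix f assume "f \<in> {\<Prod>y\<in>Y. y ^ \<alpha> y | \<alpha>. (\<Sum>y\<in>Y. \<alpha> y) = K}"
    then obtain \<alpha> where \<alpha>: "f = (\<Prod>y\<in>Y. y ^ \<alpha> y)" "(\<Sum>y\<in>Y. \<alpha> y) = K" by blast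
    have "\<exists>y\<in>Y. k \<le> \<alpha> y"
    proof (rule ccontr)
      assume "\<not> (\<exists>y\<in>Y. k \<le> \<alpha> y)"
      then have "(\<Sum>y\<in>Y. \<alpha> y) \<le> card Y * k" using sum_bounded_above[of Y \<alpha> k] by (auto simp: not_le less_imp_le)
      then show False using \<alpha>(2) by (simp add: K_def)
    qed
    then obtain y where y: "y \<in> Y" "k \<le> \<alpha> y" by blast
    define \<beta> where "\<beta> = \<alpha>(y := \<alpha> y - k)"
    define g where "g = (\<Prod>z\<in>Y. z ^ \<beta> z)"
    have f: "f = y ^ k * g"
      unfolding \<alpha>(1) g_def using Y y
      by (simp add: prod.remove[of Y y] \<beta>_def mult.assoc[symmetric] power_add[symmetric])
    have "K = k + (\<Sum>z\<in>Y. \<beta> z)"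
      unfolding \<alpha>(2)[symmetric] using Y y by (simp add: sum.remove[of Y y] \<beta>_def)
    then have g: "g \<in> ipow A Y (K - k)"
      using prod_pow_in_ipow[OF A Y generators_in_ipow[OF A], of \<beta>] by (simp add: g_def)
    have "k \<le> K" using \<open>K = k + _\<close> by simp
    obtain j m where jm: "y ^ k = j + m" "j \<in> J" "m \<in> ipow A Y (Suc k)" using k[OF y(1)] by blast
    have "g \<in> A" using g ipow_subset[OF A] by blast
    have "m * g \<in> ipow A Y (Suc k + (K - k))" by (rule ipow_mult[OF A jm(3) g])
    also have "Suc k + (K - k) = Suc K" using \<open>k \<le> K\<close> by simp
    finally have "m * g \<in> ipow A Y (Suc K)" .
    moreover have "g * j \<in> J" using J jm \<open>g \<in> A\<close> unfolding is_ideal_def by blast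
    moreover have "f = g * j + m * g" by (simp add: f jm(1) algebra_simps)
    ultimately show "f \<in> ?S" by blast
  qed
  then have "ideal_gen A {\<Prod>y\<in>Y. y ^ \<alpha> y | \<alpha>. (\<Sum>y\<in>Y. \<alpha> y) = K} \<subseteq> ?S"
    by (rule ideal_gen_least[OF A(1) idS])
  then show ?thesis using ipow_monomials[OF A Y, of K] by blast
qed

text \<open>Multiplying by generators carries the inclusion from one power to the next, so the error
  term can be pushed beyond any given power.\<close>

lemma ipow_le_propagate:
  assumes A: "is_subring A" "Y \<subseteq> A" and J: "is_ideal A J"
    and K: "ipow A Y K \<subseteq> ideal_sum J (ipow A Y (Suc K))"
  shows "ipow A Y K \<subseteq> ideal_sum J (ipow A Y (K + j))"
proof -
  have idS: "is_ideal A (ideal_sum J (ipow A Y n))" for n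
    by (intro is_ideal_set_plus[OF A(1)] J is_ideal_ipow[OF A])
  have J0: "0 \<in> J" using J by (simp add: is_ideal_def)
  have step: "ipow A Y (K + j) \<subseteq> ideal_sum J (ipow A Y (Suc (K + j)))" for j
  proof (induction j)
    case 0
    show ?case using K by simp
  next
    case (Suc j)
    have "{y * g | y g. y \<in> Y \<and> g \<in> ipow A Y (K + j)} \<subseteq> ideal_sum J (ipow A Y (Suc (K + Suc j)))"
    proof
      fix f assume "f \<in> {y * g | y g. y \<in> Y \<and> g \<in> ipow A Y (K + j)}"
      then obtain y g where f: "f = y * g" "y \<in> Y" "g \<in> ipow A Y (K + j)" by blast
      then obtain h m where hm: "g = h + m" "h \<in> J" "m \<in> ipow A Y (Suc (K + j))" using Suc by blast
      have "y * m \<in> ipow A Y (Suc (Suc (K + j)))" by (rule ipow_gen_mult[OF A f(2) hm(3)])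
      moreover have "y * h \<in> J" using J f(2) A(2) hm(2) unfolding is_ideal_def by blast
      moreover have "f = y * h + y * m" by (simp add: f hm algebra_simps)
      ultimately show "f \<in> ideal_sum J (ipow A Y (Suc (K + Suc j)))" unfolding add_Suc_right by blast
    qed
    from ideal_gen_least[OF A(1) idS this] show ?case by simp
  qed
  show ?thesis
  proof (induction j)
    case 0
    show ?case using J0 ideal_sum_right[of J] by simp
  next
    case (Suc j)
    show ?case
    proof
      fix a assume "a \<in> ipow A Y K"
      then obtain h m where hm: "a = h + m" "h \<in> J" "m \<in> ipow A Y (K + j)" using Suc by blast
      then obtain h' m' where hm': "m = h' + m'" "h' \<in> J" "m' \<in> ipow A Y (Suc (K + j))" using step by blast
      have "a = (h + h') + m'" "h + h' \<in> J" using hm hm' J by (auto simp: is_ideal_def add.assoc)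
      then show "a \<in> ideal_sum J (ipow A Y (K + Suc j))" using hm' unfolding add_Suc_right by blast
    qed
  qed
qed

section \<open>Counting dimensions\<close>

abbreviation const_fun :: "'b \<Rightarrow> 'a \<Rightarrow> 'b" where
  "const_fun c \<equiv> (\<lambda>x. c)"

text \<open>The inequality dim A / W >= n in terms of representatives, so that no quotient space has
  to be formed.\<close>

definition has_indep :: "('a \<Rightarrow> 'k::field) set \<Rightarrow> ('a \<Rightarrow> 'k) set \<Rightarrow> nat \<Rightarrow> bool" where
  "has_indep A W n \<longleftrightarrow> (\<exists>b. (\<forall>i<n. b i \<in> A) \<and>
     (\<forall>u. (\<Sum>i<n. const_fun (u i) * b i) \<in> W \<longrightarrow> (\<forall>i<n. u i = 0)))"

lemma has_indep_antimono: "has_indep A W n \<Longrightarrow> W' \<subseteq> W \<Longrightarrow> has_indep A W' n"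
  unfolding has_indep_def by blast

lemma sum_lessThan_add:
  fixes a n :: nat
  shows "(\<Sum>i<a + n. f i) = (\<Sum>i<a. f i) + (\<Sum>i<n. f (a + i) :: 'b::comm_monoid_add)"
  by (induction n) (auto simp: add.assoc)

text \<open>Dimension count along multiplication by \<open>x\<close>: both \<open>W\<close> and the
  multiples of \<open>x\<close> lie in \<open>W1\<close>, so a family independent modulo
  \<open>W1\<close> stays independent modulo all of these, while dividing by \<open>x\<close> shows
  that the multiples by \<open>x\<close> of a family independent modulo \<open>W2\<close> are
  independent modulo \<open>W\<close>.\<close>

lemma has_indep_add:
  fixes A :: "('a \<Rightarrow> 'k::field) set"
  assumes A: "is_subring A" and W1: "is_ideal A W1" "has_indep A W1 a" "W \<subseteq> W1" "x \<in> W1"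
    and W2: "has_indep A W2 a'" "\<And>e. e \<in> A \<Longrightarrow> x * e \<in> W \<Longrightarrow> e \<in> W2"
    and con: "\<And>c. const_fun c \<in> A"
  shows "has_indep A W (a + a')"
proof -
  obtain b where b: "\<And>i. i < a \<Longrightarrow> b i \<in> A"
    and b0: "\<And>u i. (\<Sum>i<a. const_fun (u i) * b i) \<in> W1 \<Longrightarrow> i < a \<Longrightarrow> u i = 0"
    using W1(2) unfolding has_indep_def by blast
  obtain d where d: "\<And>i. i < a' \<Longrightarrow> d i \<in> A"
    and d0: "\<And>u i. (\<Sum>i<a'. const_fun (u i) * d i) \<in> W2 \<Longrightarrow> i < a' \<Longrightarrow> u i = 0"
    using W2(1) unfolding has_indep_def by blast
  have xA: "x \<in> A" using W1 by (auto simp: is_ideal_def)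
  define g where "g i = (if i < a then b i else x * d (i - a))" for i
  have "\<forall>i<a + a'. g i \<in> A"
    using b d subring_mult[OF A xA] by (auto simp: g_def)
  moreover have "u i = 0" if u: "(\<Sum>i<a + a'. const_fun (u i) * g i) \<in> W" and i: "i < a + a'" for u i
  proof -
    define s where "s = (\<Sum>i<a. const_fun (u i) * b i)"
    define r where "r = (\<Sum>i<a'. const_fun (u (a + i)) * d i)"
    have rA: "r \<in> A" unfolding r_def
      using con d by (intro subring_sum[OF A] subring_mult[OF A]) auto
    have eq: "(\<Sum>i<a + a'. const_fun (u i) * g i) = s + x * r"
      unfolding sum_lessThan_add s_def r_def by (simp add: g_def sum_distrib_left mult.left_commute)
    have "r * x \<in> W1" using W1 rA by (simp add: is_ideal_def)
    then have "s + x * r - r * x \<in> W1" using u W1(3) eq by (intro ideal_diff[OF A W1(1)]) auto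
    then have "s \<in> W1" by (simp add: mult.commute)
    then have ua: "u j = 0" if "j < a" for j using b0 that unfolding s_def by blast
    then have "s = 0" unfolding s_def by (intro sum.neutral) (auto simp: fun_eq_iff)
    then have "x * r \<in> W" using u eq by simp
    then have "r \<in> W2" using W2(2) rA by blast
    then have "u (a + j) = 0" if "j < a'" for j using d0[of "\<lambda>i. u (a + i)"] that unfolding r_def by blast
    then show ?thesis using ua i by (metis add_diff_inverse_nat add_less_cancel_left)
  qed
  ultimately show ?thesis unfolding has_indep_def by blast
qed

lemma linear_system_nontrivial:
  fixes c :: "'b \<Rightarrow> 'v \<Rightarrow> 'k::field"
  assumes "finite V" "finite B" "card V < card B"
  shows "\<exists>u. (\<exists>b\<in>B. u b \<noteq> 0) \<and> (\<forall>v\<in>V. (\<Sum>b\<in>B. u b * c b v) = 0)"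
  using assms
proof (induction V arbitrary: B c)
  case empty
  then have "B \<noteq> {}" by auto
  then show ?case by (intro exI[of _ "\<lambda>_. 1"]) auto
next
  case (insert v V)
  show ?case
  proof (cases "\<forall>b\<in>B. c b v = 0")
    case True
    moreover obtain u where "\<exists>b\<in>B. u b \<noteq> 0" "\<forall>v\<in>V. (\<Sum>b\<in>B. u b * c b v) = 0"
      using insert.IH[of B c] insert.prems insert.hyps by auto
    ultimately show ?thesis by auto
  next
    case False
    then obtain b0 where b0: "b0 \<in> B" "c b0 v \<noteq> 0" by blast
    define B' where "B' = B - {b0}"
    have B': "finite B'" "card V < card B'" "b0 \<notin> B'" "B = insert b0 B'"
      using insert b0 by (auto simp: B'_def)
    define c' where "c' b w = c b w - c b v / c b0 v * c b0 w" for b w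
    obtain u where u: "\<exists>b\<in>B'. u b \<noteq> 0" "\<forall>w\<in>V. (\<Sum>b\<in>B'. u b * c' b w) = 0"
      using insert.IH[OF B'(1,2), of c'] by auto
    define s where "s = - (\<Sum>b\<in>B'. u b * c b v) / c b0 v"
    define u' where "u' = u(b0 := s)"
    have sum: "(\<Sum>b\<in>B. u' b * c b w) = s * c b0 w + (\<Sum>b\<in>B'. u b * c b w)" for w
      using B' by (auto simp: u'_def intro!: sum.cong)
    have "(\<Sum>b\<in>B. u' b * c b w) = 0" if "w \<in> V" for w
    proof -
      have "0 = (\<Sum>b\<in>B'. u b * c b w - (u b * c b v) * (c b0 w / c b0 v))"
        using u(2) that by (simp add: c'_def algebra_simps)
      also have "\<dots> = (\<Sum>b\<in>B'. u b * c b w) - (\<Sum>b\<in>B'. u b * c b v) * (c b0 w / c b0 v)"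
        by (simp only: sum_subtractf sum_distrib_right)
      finally show ?thesis by (simp add: sum s_def)
    qed
    moreover have "(\<Sum>b\<in>B. u' b * c b v) = 0" using b0 by (simp add: sum s_def)
    moreover have "\<exists>b\<in>B. u' b \<noteq> 0" using u(1) B' by (auto simp: u'_def)
    ultimately show ?thesis by blast
  qed
qed

text \<open>\<open>poly_funs {}\<close> is the ring of constants, so the lemmas on generated ideals
  apply to linear spans.\<close>

abbreviation linear_span :: "(('i \<Rightarrow> 'k::field) \<Rightarrow> 'k) set \<Rightarrow> (('i \<Rightarrow> 'k) \<Rightarrow> 'k) set" where
  "linear_span S \<equiv> ideal_gen (poly_funs {}) S"

lemma linear_span_finite:
  assumes "finite S" "f \<in> linear_span S"
  shows "\<exists>u. f = (\<Sum>s\<in>S. const_fun (u s) * s)"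
  using assms(2)
proof (induction f rule: ideal_gen.induct)
  case zero
  show ?case by (intro exI[of _ "\<lambda>_. 0"]) (simp add: fun_eq_iff sum_fun_apply)
next
  case (step a s f)
  obtain c where "a = const_fun c" using step(1) unfolding poly_funs_empty by blast
  moreover obtain u where "f = (\<Sum>s\<in>S. const_fun (u s) * s)" using step by blast
  moreover have "(\<Sum>r\<in>S. const_fun ((u(s := u s + c)) r) * r)
      = const_fun (u s + c) * s + (\<Sum>r\<in>S - {s}. const_fun (u r) * r)"
    using assms(1) step(2) by (subst sum.remove[of S s]) (auto intro!: sum.cong)
  moreover have "(\<Sum>r\<in>S. const_fun (u r) * r) = const_fun (u s) * s + (\<Sum>r\<in>S - {s}. const_fun (u r) * r)"
    using assms(1) step(2) by (rule sum.remove)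
  ultimately have "a * s + f = (\<Sum>r\<in>S. const_fun ((u(s := u s + c)) r) * r)"
    by (simp only:) (simp add: fun_eq_iff algebra_simps)
  then show ?case by blast
qed

lemma steinitz_mod:
  assumes W: "is_ideal (poly_funs I) W" and ind: "has_indep (poly_funs I) W n"
    and S: "finite S" "poly_funs I \<subseteq> ideal_sum (linear_span S) W"
  shows "n \<le> card S"
proof (rule ccontr)
  assume "\<not> n \<le> card S"
  obtain b where b: "\<And>i. i < n \<Longrightarrow> b i \<in> poly_funs I"
    and b0: "\<And>u i. (\<Sum>i<n. const_fun (u i) * b i) \<in> W \<Longrightarrow> i < n \<Longrightarrow> u i = 0"
    using ind unfolding has_indep_def by blast
  have "\<exists>c. b i - (\<Sum>s\<in>S. const_fun (c s) * s) \<in> W" if i: "i < n" for i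
  proof -
    obtain f w where "b i = f + w" "f \<in> linear_span S" "w \<in> W" using b[OF i] S(2) by blast
    moreover obtain u where "f = (\<Sum>s\<in>S. const_fun (u s) * s)"
      using linear_span_finite[OF S(1) \<open>f \<in> linear_span S\<close>] by blast
    ultimately have "b i - (\<Sum>s\<in>S. const_fun (u s) * s) = w"
      using \<open>b i = f + w\<close> by (simp only: add_diff_cancel_left')
    then have "b i - (\<Sum>s\<in>S. const_fun (u s) * s) \<in> W" using \<open>w \<in> W\<close> by (simp only:)
    then show ?thesis by (rule exI[of _ u])
  qed
  then have "\<forall>i. \<exists>c. i < n \<longrightarrow> b i - (\<Sum>s\<in>S. const_fun (c s) * s) \<in> W" by blast
  from choice[OF this] obtain c where c: "\<And>i. i < n \<Longrightarrow> b i - (\<Sum>s\<in>S. const_fun (c i s) * s) \<in> W"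
    by blast
  obtain u where u: "\<exists>i<n. u i \<noteq> 0" "\<forall>s\<in>S. (\<Sum>i<n. u i * c i s) = 0"
    using linear_system_nontrivial[OF S(1), of "{..<n}" c] \<open>\<not> n \<le> card S\<close> by auto
  have "const_fun (u i) * (b i - (\<Sum>s\<in>S. const_fun (c i s) * s)) \<in> W" if "i < n" for i
    using W c[OF that] poly_funs.const[of "u i"] unfolding is_ideal_def by blast
  then have "(\<Sum>i<n. const_fun (u i) * (b i - (\<Sum>s\<in>S. const_fun (c i s) * s))) \<in> W"
    by (intro ideal_sum_closed[OF poly_funs_subring W]) simp
  also have "(\<Sum>i<n. const_fun (u i) * (b i - (\<Sum>s\<in>S. const_fun (c i s) * s))) = (\<Sum>i<n. const_fun (u i) * b i)"
  proof
    fix x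
    have "(\<Sum>i<n. u i * (\<Sum>s\<in>S. c i s * s x)) = (\<Sum>s\<in>S. (\<Sum>i<n. u i * c i s) * s x)"
      by (simp add: sum_distrib_left sum_distrib_right sum.swap[of _ S] mult.assoc)
    also have "\<dots> = 0" using u(2) by simp
    finally show "(\<Sum>i<n. const_fun (u i) * (b i - (\<Sum>s\<in>S. const_fun (c i s) * s))) x = (\<Sum>i<n. const_fun (u i) * b i) x"
      by (simp add: sum_fun_apply minus_fun_apply' right_diff_distrib sum_subtractf)
  qed
  finally show False using b0 u(1) by blast
qed

section \<open>Chains through an isolated common zero\<close>

definition vanishing :: "'i set \<Rightarrow> ('i \<Rightarrow> 'k::field) set \<Rightarrow> (('i \<Rightarrow> 'k) \<Rightarrow> 'k) set" where
  "vanishing I X = {f \<in> poly_funs I. \<forall>x\<in>X. f x = 0}"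

definition shifted_coords :: "'i set \<Rightarrow> ('i \<Rightarrow> 'k::field) \<Rightarrow> (('i \<Rightarrow> 'k) \<Rightarrow> 'k) set" where
  "shifted_coords I p = (\<lambda>i x. x i - p i) ` I"

text \<open>The power M^n of the maximal ideal M of \<open>p\<close>. Passing to the coordinate ring
  of a variety \<open>X\<close> amounts to adding \<open>vanishing I X\<close>.\<close>

abbreviation point_power :: "'i set \<Rightarrow> ('i \<Rightarrow> 'k::field) \<Rightarrow> nat \<Rightarrow> (('i \<Rightarrow> 'k) \<Rightarrow> 'k) set" where
  "point_power I p n \<equiv> ipow (poly_funs I) (shifted_coords I p) n"

lemma is_ideal_vanishing: "is_ideal (poly_funs I) (vanishing I X)"
  unfolding is_ideal_def vanishing_def
  using poly_funs_ring(4)[of I] poly_funs_ring(5)[of _ I] poly_funs_ring(3)[of _ I] by auto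

lemma vanishing_antimono: "X \<subseteq> Y \<Longrightarrow> vanishing I Y \<subseteq> vanishing I X"
  by (auto simp: vanishing_def)

lemma closed_separation:
  assumes "closedin (zariski I) X" "x \<in> affine_space I" "x \<notin> X"
  obtains f where "f \<in> vanishing I X" "f x \<noteq> 0"
proof -
  obtain P where P: "P \<subseteq> poly_funs I" "X = zeros I P"
    using assms(1) unfolding closedin_zariski by blast
  then obtain f where f: "f \<in> P" "f x \<noteq> 0" using assms(2,3) by (auto simp: zeros_def)
  then have "f \<in> vanishing I X" using P by (auto simp: zeros_def vanishing_def)
  then show ?thesis using f(2) by (rule that)
qed

lemma zeros_closed:
  assumes "f \<in> poly_funs I"
  shows "closedin (zariski I) {x \<in> affine_space I. f x = 0}"
proof -
  have "{x \<in> affine_space I. f x = 0} = zeros I {f}" "{f} \<subseteq> poly_funs I"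
    using assms by (auto simp: zeros_def)
  then show ?thesis unfolding closedin_zariski by blast
qed

lemma closed_subset_affine: "closedin (zariski I) X \<Longrightarrow> X \<subseteq> affine_space I"
  using closedin_subset[of "zariski I" X] by (simp add: topspace_zariski)

lemma vanishing_prime:
  assumes "irreducible_in (zariski I) X"
  shows "is_prime_ideal (poly_funs I) (vanishing I X)"
  unfolding is_prime_ideal_def
proof (intro conjI ballI impI is_ideal_vanishing)
  have X: "X \<subseteq> affine_space I" "X \<noteq> {}" using assms by (auto simp: irreducible_in_def topspace_zariski)
  then show "1 \<notin> vanishing I X" by (auto simp: vanishing_def)
  fix f g assume fg: "f \<in> poly_funs I" "g \<in> poly_funs I" "f * g \<in> vanishing I X"
  then have "X \<subseteq> {x \<in> affine_space I. f x = 0} \<union> {x \<in> affine_space I. g x = 0}"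
  proof -
    have "f x = 0 \<or> g x = 0" if "x \<in> X" for x using fg(3) that by (auto simp: vanishing_def)
    then show ?thesis using X(1) by blast
  qed
  then have "X \<subseteq> {x \<in> affine_space I. f x = 0} \<or> X \<subseteq> {x \<in> affine_space I. g x = 0}"
    using assms zeros_closed[OF fg(1)] zeros_closed[OF fg(2)] by (simp add: irreducible_in_def)
  then show "f \<in> vanishing I X \<or> g \<in> vanishing I X"
    using fg by (auto simp: vanishing_def)
qed

lemma shifted_coords_subset: "shifted_coords I p \<subseteq> poly_funs I"
proof
  fix f assume "f \<in> shifted_coords I p"
  then obtain i where i: "i \<in> I" "f = (\<lambda>x. x i - p i)" by (auto simp: shifted_coords_def)
  have "(\<lambda>x. x i + (- p i)) \<in> poly_funs I" using i by (intro poly_funs.intros)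
  then show "f \<in> poly_funs I" using i by simp
qed

lemma finite_shifted_coords: "finite I \<Longrightarrow> finite (shifted_coords I p)"
  by (simp add: shifted_coords_def)

lemmas is_ideal_point_power = is_ideal_ipow[OF poly_funs_subring shifted_coords_subset]

lemma point_power_at: "f \<in> point_power I p (Suc n) \<Longrightarrow> f p = 0"
proof -
  assume "f \<in> point_power I p (Suc n)"
  then have "f \<in> ideal_gen (poly_funs I) {y * g | y g. y \<in> shifted_coords I p \<and> g \<in> point_power I p n}" by simp
  then show "f p = 0"
    by (induction f rule: ideal_gen.induct) (auto simp: shifted_coords_def)
qed

lemma diff_value_in_point_power:
  fixes p :: "'i \<Rightarrow> 'k::field"
  assumes "f \<in> poly_funs I"
  shows "f - const_fun (f p) \<in> point_power I p 1"
  using assms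
proof (induction f rule: poly_funs.induct)
  case (const c)
  have eq: "const_fun c - const_fun c = (0 :: ('i \<Rightarrow> 'k) \<Rightarrow> 'k)" by simp
  show ?case unfolding eq using is_ideal_point_power[of I p 1] unfolding is_ideal_def by blast
next
  case (coord i)
  have "(\<lambda>x. x i) - const_fun (p i) = (\<lambda>x. x i - p i)" by (simp add: fun_eq_iff minus_fun_apply')
  then show ?case
    using generators_in_ipow[OF poly_funs_subring shifted_coords_subset, of I p] coord
    by (auto simp: shifted_coords_def simp del: ipow.simps)
next
  case (add f g)
  have eq: "(\<lambda>x. f x + g x) - const_fun (f p + g p) = (f - const_fun (f p)) + (g - const_fun (g p))"
    by (simp add: fun_eq_iff minus_fun_apply')
  show ?case unfolding eq using add is_ideal_point_power[of I p 1] unfolding is_ideal_def by blast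
next
  case (mult f g)
  have eq: "(\<lambda>x. f x * g x) - const_fun (f p * g p)
      = g * (f - const_fun (f p)) + const_fun (f p) * (g - const_fun (g p))"
    by (simp add: fun_eq_iff minus_fun_apply' algebra_simps)
  have "g * (f - const_fun (f p)) \<in> point_power I p 1"
    "const_fun (f p) * (g - const_fun (g p)) \<in> point_power I p 1"
    using mult poly_funs.const[of "f p" I] is_ideal_point_power[of I p 1] unfolding is_ideal_def by blast+
  then show ?case unfolding eq using is_ideal_point_power[of I p 1] unfolding is_ideal_def by blast
qed

lemma in_point_power_one: "f \<in> poly_funs I \<Longrightarrow> f p = 0 \<Longrightarrow> f \<in> point_power I p 1"
proof -
  assume "f \<in> poly_funs I" "f p = 0"
  then have "f - const_fun 0 \<in> point_power I p 1" using diff_value_in_point_power[of f I p] by (simp only:)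
  also have "f - const_fun 0 = f" by (simp add: fun_eq_iff minus_fun_apply')
  finally show ?thesis .
qed

text \<open>Multiplication by a function that vanishes on \<open>Z t\<close> but not on
  \<open>Z (Suc t)\<close> splits the count for \<open>Z (Suc t)\<close> into one for
  \<open>Z t\<close> and an earlier one for \<open>Z (Suc t)\<close> itself. This is Pascal's
  recursion, whence the binomial coefficient. Each unit step of \<open>q\<close> costs a bounded
  number of powers by Artin--Rees, so the exponent is linear in \<open>q\<close>.\<close>

lemma chain_growth:
  fixes Z :: "nat \<Rightarrow> ('i \<Rightarrow> 'k::field) set"
  assumes I: "finite I" and p: "p \<in> Z 0"
    and Z: "\<And>k. k \<le> t \<Longrightarrow> closedin (zariski I) (Z k) \<and> irreducible_in (zariski I) (Z k)"
      "\<And>k. k < t \<Longrightarrow> Z k \<subset> Z (Suc k)"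
  shows "\<exists>c. \<forall>q. has_indep (poly_funs I)
    (ideal_sum (vanishing I (Z t)) (point_power I p (c * q + 1))) (q choose t)"
  using Z
proof (induction t)
  case 0
  \<comment> \<open>Here only the constant 1 is counted. The summand 1 in the exponent makes all
    members of the ideal vanish at \<open>p\<close>, which keeps nonzero constants out.\<close>
  have "has_indep (poly_funs I) (ideal_sum (vanishing I (Z 0)) (point_power I p 1)) 1"
    unfolding has_indep_def
  proof (intro exI[of _ "\<lambda>_. 1"] conjI allI impI)
    show "1 \<in> poly_funs I" by (rule poly_funs_ring)
    fix u :: "nat \<Rightarrow> 'k" and i :: nat
    assume "(\<Sum>i<1. const_fun (u i) * 1) \<in> ideal_sum (vanishing I (Z 0)) (point_power I p 1)" "i < 1"
    then obtain l m where lm: "const_fun (u 0) * 1 = l + m" "l \<in> vanishing I (Z 0)" "m \<in> point_power I p 1"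
      by auto
    have "u 0 = (const_fun (u 0) * 1) p" by simp
    also have "\<dots> = l p + m p" unfolding lm(1) by simp
    also have "\<dots> = 0" using lm(2) p point_power_at[of m I p 0] lm(3) by (auto simp: vanishing_def)
    finally show "u i = 0" using \<open>i < 1\<close> by simp
  qed
  then show ?case by (intro exI[of _ 0]) (simp only: mult_zero_left add_0_left binomial_n_0 simp_thms)
next
  case (Suc t)
  note A = poly_funs_subring[of I, where 'k = 'k]
  let ?A = "poly_funs I :: (('i \<Rightarrow> 'k) \<Rightarrow> 'k) set"
  let ?M = "point_power I p"
  obtain c1 where c1: "\<And>q. has_indep ?A (ideal_sum (vanishing I (Z t)) (?M (c1 * q + 1))) (q choose t)"
  proof -
    have "\<exists>c. \<forall>q. has_indep ?A (ideal_sum (vanishing I (Z t)) (?M (c * q + 1))) (q choose t)"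
      by (rule Suc.IH) (use Suc.prems in auto)
    then show ?thesis using that by blast
  qed
  define L where "L = vanishing I (Z (Suc t))"
  define L1 where "L1 = vanishing I (Z t)"
  have ZZ: "Z t \<subset> Z (Suc t)" using Suc.prems by blast
  then obtain z where z: "z \<in> Z (Suc t)" "z \<notin> Z t" by blast
  have "z \<in> affine_space I" using z(1) closed_subset_affine Suc.prems(1)[of "Suc t"] by blast
  then obtain x where x: "x \<in> L1" "x z \<noteq> 0"
    using closed_separation[of I "Z t" z] z Suc.prems(1)[of t] unfolding L1_def by auto
  have xA: "x \<in> ?A" "x \<notin> L" using x z by (auto simp: L_def L1_def vanishing_def)
  have primeL: "is_prime_ideal ?A L" unfolding L_def by (rule vanishing_prime) (use Suc.prems in blast)
  obtain c2 where c2: "\<And>n e. e \<in> ?A \<Longrightarrow> x * e \<in> ideal_sum L (?M (n + c2)) \<Longrightarrow> e \<in> ideal_sum L (?M n)"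
    using artin_rees_quotient[OF noetherian_poly_funs[OF I] finite_shifted_coords[OF I] shifted_coords_subset[of I p] primeL xA]
    by blast
  \<comment> \<open>One slope has to serve two purposes: \<open>c1\<close> comes from the hypothesis
    for \<open>Z t\<close>, and \<open>c2\<close> is the loss in dividing by
    \<open>x\<close>.\<close>
  define c where "c = max c1 c2"
  note mono = ipow_mono[OF A shifted_coords_subset]
  have idL1: "is_ideal ?A (ideal_sum L1 (?M n))" for n
    unfolding L1_def by (intro is_ideal_set_plus[OF A] is_ideal_vanishing is_ideal_point_power)
  have LL1: "L \<subseteq> L1" unfolding L_def L1_def using ZZ by (intro vanishing_antimono) blast
  have "has_indep ?A (ideal_sum L (?M (c * q + 1))) (q choose Suc t)" for q
  proof (induction q)
    case 0
    show ?case by (simp add: has_indep_def)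
  next
    case (Suc q)
    let ?N = "c * Suc q + 1"
    have "has_indep ?A (ideal_sum L (?M ?N)) ((q choose t) + (q choose Suc t))"
    proof (rule has_indep_add[OF A idL1[of ?N] _ _ _ Suc.IH])
      have "c1 * q \<le> c * Suc q" by (intro mult_le_mono) (simp_all add: c_def)
      then have "c1 * q + 1 \<le> ?N" by simp
      show "has_indep ?A (ideal_sum L1 (?M ?N)) (q choose t)"
        by (rule has_indep_antimono[OF c1[of q]])
          (unfold L1_def, intro ideal_sum_mono order_refl mono, fact)
      show "ideal_sum L (?M ?N) \<subseteq> ideal_sum L1 (?M ?N)"
        using LL1 by (rule ideal_sum_mono) simp
      have "0 \<in> ?M ?N" using is_ideal_point_power unfolding is_ideal_def by blast
      then show "x \<in> ideal_sum L1 (?M ?N)" using x(1) ideal_sum_left by blast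
      show "e \<in> ideal_sum L (?M (c * q + 1))" if "e \<in> ?A" "x * e \<in> ideal_sum L (?M ?N)" for e
      proof (rule c2[OF that(1)])
        have "?M ?N \<subseteq> ?M (c * q + 1 + c2)" by (rule mono) (simp add: c_def)
        then show "x * e \<in> ideal_sum L (?M (c * q + 1 + c2))"
          using that(2) ideal_sum_mono[OF order_refl, of _ _ L] by blast
      qed
      show "const_fun a \<in> ?A" for a by (rule poly_funs.const)
    qed
    then show ?case unfolding binomial_Suc_Suc .
  qed
  then show ?case unfolding L_def by blast
qed

section \<open>Upper bound for the growth at an isolated zero\<close>

lemma linear_span_add: "f \<in> linear_span S \<Longrightarrow> g \<in> linear_span S \<Longrightarrow> f + g \<in> linear_span S"
  by (rule ideal_gen_add[OF poly_funs_subring])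

lemma linear_span_mono: "S \<subseteq> T \<Longrightarrow> linear_span S \<subseteq> linear_span T"
  by (rule ideal_gen_mono) auto

lemma linear_span_mult: "f \<in> linear_span S \<Longrightarrow> y * f \<in> linear_span ((*) y ` S)"
proof (induction f rule: ideal_gen.induct)
  case (step a s f)
  then have "a * (y * s) + y * f \<in> linear_span ((*) y ` S)" by (intro ideal_gen.step imageI)
  then show ?case by (simp add: algebra_simps del: times_fun_apply plus_fun_apply)
next
  case zero
  show ?case unfolding mult_zero_right by (rule ideal_gen.zero)
qed

text \<open>A finite set spanning M^n modulo M^(n+1), multiplied by the finitely many shifted
  coordinates, spans M^(n+1) modulo M^(n+2). Adding up these layers gives a finite spanning set
  modulo M^n.\<close>

lemma finite_codim_point_power:
  fixes p :: "'i \<Rightarrow> 'k::field"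
  assumes I: "finite I"
  shows "\<exists>S. finite S \<and> poly_funs I \<subseteq> ideal_sum (linear_span S) (point_power I p n)"
proof -
  note A = poly_funs_subring[of I, where 'k = 'k]
  let ?M = "point_power I p" and ?Y = "shifted_coords I p"
  have graded: "\<exists>S. finite S \<and> ?M n \<subseteq> ideal_sum (linear_span S) (?M (Suc n))" for n
  proof (induction n)
    case 0
    have "?M 0 \<subseteq> ideal_sum (linear_span {1}) (?M 1)"
    proof
      fix f assume "f \<in> ?M 0"
      then have "f - const_fun (f p) \<in> ?M 1" using diff_value_in_point_power by simp
      moreover have "const_fun (f p) * 1 + 0 \<in> linear_span {1}"
        by (intro ideal_gen.intros poly_funs.const) auto
      moreover have "f = (const_fun (f p) * 1 + 0) + (f - const_fun (f p))" by simp
      ultimately show "f \<in> ideal_sum (linear_span {1}) (?M 1)" by blast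
    qed
    then show ?case unfolding One_nat_def by blast
  next
    case (Suc n)
    then obtain S where S: "finite S" "?M n \<subseteq> ideal_sum (linear_span S) (?M (Suc n))" by blast
    define T where "T = (\<Union>y\<in>?Y. (*) y ` S)"
    have "f \<in> ideal_sum (linear_span T) (?M (Suc (Suc n)))" if "f \<in> ideal_gen (poly_funs I) {y * g | y g. y \<in> ?Y \<and> g \<in> ?M n}" for f
      using that
    proof (induction f rule: ideal_gen.induct)
      case zero
      have "0 \<in> ?M (Suc (Suc n))" using is_ideal_point_power unfolding is_ideal_def by blast
      then show ?case using ideal_sum_left ideal_gen.zero by blast
    next
      case (step a f x)
      obtain y g where yg: "f = y * g" "y \<in> ?Y" "g \<in> ?M n" using step by blast
      have "a * g \<in> ?M n" using is_ideal_point_power yg step unfolding is_ideal_def by blast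
      then obtain s m where sm: "a * g = s + m" "s \<in> linear_span S" "m \<in> ?M (Suc n)" using S(2) by blast
      obtain s' m' where sm': "x = s' + m'" "s' \<in> linear_span T" "m' \<in> ?M (Suc (Suc n))" using step by blast
      have "y * s \<in> linear_span T"
        using linear_span_mult[OF sm(2), of y] linear_span_mono[of "(*) y ` S" T] yg by (auto simp: T_def)
      then have 1: "y * s + s' \<in> linear_span T" using sm' linear_span_add by blast
      have "y * m \<in> ?M (Suc (Suc n))" by (rule ipow_gen_mult[OF A shifted_coords_subset yg(2) sm(3)])
      then have 2: "y * m + m' \<in> ?M (Suc (Suc n))"
        using sm' is_ideal_point_power unfolding is_ideal_def by blast
      have "a * f + x = y * (a * g) + x" by (simp add: yg algebra_simps)
      also have "\<dots> = (y * s + s') + (y * m + m')" by (simp only: sm(1) sm'(1) algebra_simps)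
      finally show ?case using 1 2 by blast
    qed
    then have "?M (Suc n) \<subseteq> ideal_sum (linear_span T) (?M (Suc (Suc n)))"
      unfolding ipow.simps(2)[of _ _ n] by (rule subsetI)
    moreover have "finite T" unfolding T_def using S(1) finite_shifted_coords[OF I] by (intro finite_UN_I finite_imageI)
    ultimately show ?case by blast
  qed
  show ?thesis
  proof (induction n)
    case 0
    have "poly_funs I \<subseteq> ideal_sum (linear_span {}) (point_power I p 0)"
      unfolding ipow.simps(1) using ideal_gen.zero by (rule ideal_sum_right)
    then show ?case by blast
  next
    case (Suc n)
    then obtain S where S: "finite S" "poly_funs I \<subseteq> ideal_sum (linear_span S) (?M n)" by blast
    obtain T where T: "finite T" "?M n \<subseteq> ideal_sum (linear_span T) (?M (Suc n))" using graded by blast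
    have "poly_funs I \<subseteq> ideal_sum (linear_span (S \<union> T)) (?M (Suc n))"
    proof
      fix f :: "('i \<Rightarrow> 'k) \<Rightarrow> 'k" assume "f \<in> poly_funs I"
      then obtain s m where sm: "f = s + m" "s \<in> linear_span S" "m \<in> ?M n" using S by blast
      then obtain s' m' where sm': "m = s' + m'" "s' \<in> linear_span T" "m' \<in> ?M (Suc n)" using T by blast
      have "s + s' \<in> linear_span (S \<union> T)"
        using sm sm' linear_span_mono[of S "S \<union> T"] linear_span_mono[of T "S \<union> T"] by (intro linear_span_add) auto
      moreover have "f = (s + s') + m'" using sm sm' by (simp add: add.assoc)
      ultimately show "f \<in> ideal_sum (linear_span (S \<union> T)) (?M (Suc n))" using sm' by blast
    qed
    then show ?case using S T by blast
  qed
qed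

text \<open>Common zeros of \<open>J\<close> other than \<open>p\<close> are zeros of
  \<open>g\<close>, so by the Nullstellensatz each shifted coordinate times \<open>g\<close> is
  nilpotent modulo \<open>J\<close>. Modulo the maximal ideal of \<open>p\<close> a power of
  \<open>g\<close> is a nonzero constant, and it is cancelled at the cost of an error in the next
  power of that ideal. This replaces localization at \<open>p\<close>.\<close>

lemma isolated_zero_nilpotent:
  fixes X :: "('i \<Rightarrow> 'k::alg_closed_field) set"
  assumes I: "finite I" and X: "closedin (zariski I) X"
    and F: "F \<subseteq> poly_funs I" and g: "g \<in> poly_funs I" "g p \<noteq> 0"
    and iso: "\<And>x. x \<in> X \<Longrightarrow> (\<And>f. f \<in> F \<Longrightarrow> f x = 0) \<Longrightarrow> g x \<noteq> 0 \<Longrightarrow> x = p"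
  defines "J \<equiv> ideal_gen (poly_funs I) (F \<union> vanishing I X)"
  shows "\<exists>K. point_power I p K \<subseteq> ideal_sum J (point_power I p (Suc K))"
proof -
  note A = poly_funs_subring[of I, where 'k = 'k]
  have FA: "F \<union> vanishing I X \<subseteq> poly_funs I" using F by (auto simp: vanishing_def)
  have idJ: "is_ideal (poly_funs I) J" unfolding J_def by (rule is_ideal_gen[OF A FA])
  have base: "F \<union> vanishing I X \<subseteq> J" unfolding J_def using ideal_gen_base[OF A] by blast
  have "\<exists>k. (y * g) ^ k \<in> J" if y: "y \<in> shifted_coords I p" for y
  proof (rule nullstellensatz[OF I idJ])
    show "y * g \<in> poly_funs I" using subring_mult[OF A] y shifted_coords_subset g by blast
    fix x assume x: "x \<in> affine_space I" "\<And>f. f \<in> J \<Longrightarrow> f x = 0"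
    have "x \<in> X"
      using closed_separation[OF X x(1)] x(2) base by blast
    then have "g x = 0 \<or> x = p" using iso x(2) base by blast
    then show "(y * g) x = 0" using y by (auto simp: shifted_coords_def)
  qed
  then obtain k where k: "\<And>y. y \<in> shifted_coords I p \<Longrightarrow> (y * g) ^ k y \<in> J" by metis
  \<comment> \<open>A common exponent; the inserted 0 covers an empty \<open>I\<close>.\<close>
  define e where "e = Max (insert 0 (k ` shifted_coords I p))"
  have "y ^ e \<in> ideal_sum J (point_power I p (Suc e))" if y: "y \<in> shifted_coords I p" for y
  proof -
    have yA: "y \<in> poly_funs I" using y shifted_coords_subset by blast
    have "k y \<le> e" unfolding e_def using y finite_shifted_coords[OF I] by (intro Max_ge) auto
    then have "(y * g) ^ e = (y * g) ^ (e - k y) * (y * g) ^ k y" by (simp add: power_add[symmetric])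
    moreover have "(y * g) ^ (e - k y) \<in> poly_funs I"
      using yA g by (intro subring_power[OF A] subring_mult[OF A])
    ultimately have 1: "y ^ e * g ^ e \<in> J"
      using k[OF y] idJ by (simp add: is_ideal_def power_mult_distrib)
    define a where "a = inverse (g p ^ e)"
    have "(g ^ e) p = g p ^ e" by (simp add: power_fun_apply)
    then have m: "g ^ e - const_fun (g p ^ e) \<in> point_power I p 1"
      using diff_value_in_point_power[of "g ^ e" I p] subring_power[OF A g(1)] by (simp only:)
    have "y ^ e \<in> point_power I p e"
      using prod_pow_in_ipow[OF A shifted_coords_subset, of "{y}" p "\<lambda>_. e"] y
        generators_in_ipow[OF A shifted_coords_subset, of p] by auto
    from ipow_mult[OF A shifted_coords_subset this m]
    have "y ^ e * (g ^ e - const_fun (g p ^ e)) \<in> point_power I p (Suc e)" by (simp del: ipow.simps)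
    then have 2: "const_fun (- a) * (y ^ e * (g ^ e - const_fun (g p ^ e))) \<in> point_power I p (Suc e)"
      using is_ideal_point_power poly_funs.const unfolding is_ideal_def by blast
    have 3: "const_fun a * (y ^ e * g ^ e) \<in> J"
      using idJ 1 poly_funs.const unfolding is_ideal_def by blast
    have "y ^ e = const_fun a * (y ^ e * g ^ e) + const_fun (- a) * (y ^ e * (g ^ e - const_fun (g p ^ e)))"
      using g(2) by (simp add: fun_eq_iff minus_fun_apply' power_fun_apply a_def algebra_simps)
    then show ?thesis using 2 3 by blast
  qed
  then show ?thesis
    by (rule ipow_le_of_powers[OF A shifted_coords_subset finite_shifted_coords[OF I] idJ])
qed

text \<open>Modulo \<open>J\<close> and M^N every function reduces to the span of a finite set
  \<open>V\<close> that does not depend on \<open>N\<close>. The part in \<open>J\<close> is a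
  combination of elements of \<open>F\<close> and of the vanishing ideal, and its coefficients can
  be reduced again. Each round contributes a factor from \<open>F\<close>, and \<open>N\<close> such
  factors lie in M^N because \<open>F\<close> vanishes at \<open>p\<close>. What remains are
  products of monomials in \<open>F\<close> with elements of \<open>V\<close>.\<close>

lemma isolated_zero_growth:
  fixes X :: "('i \<Rightarrow> 'k::alg_closed_field) set"
  assumes I: "finite I" and X: "closedin (zariski I) X"
    and F: "finite F" "F \<subseteq> poly_funs I" "\<And>f. f \<in> F \<Longrightarrow> f p = 0" and g: "g \<in> poly_funs I" "g p \<noteq> 0"
    and iso: "\<And>x. x \<in> X \<Longrightarrow> (\<And>f. f \<in> F \<Longrightarrow> f x = 0) \<Longrightarrow> g x \<noteq> 0 \<Longrightarrow> x = p"
  shows "\<exists>v. \<forall>N. \<exists>S. finite S \<and> card S \<le> v * N ^ card F \<and>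
    poly_funs I \<subseteq> ideal_sum (linear_span S) (ideal_sum (vanishing I X) (point_power I p N))"
proof -
  note A = poly_funs_subring[of I, where 'k = 'k]
  let ?A = "poly_funs I :: (('i \<Rightarrow> 'k) \<Rightarrow> 'k) set"
  let ?M = "point_power I p" and ?L = "vanishing I X"
  define J where "J = ideal_gen ?A (F \<union> ?L)"
  have idJ: "is_ideal ?A J"
    unfolding J_def using F by (intro is_ideal_gen[OF A]) (auto simp: vanishing_def)
  obtain K where K: "?M K \<subseteq> ideal_sum J (?M (Suc K))"
    using isolated_zero_nilpotent[OF I X F(2) g iso] unfolding J_def by blast
  obtain V where V: "finite V" "?A \<subseteq> ideal_sum (linear_span V) (?M K)"
    using finite_codim_point_power[OF I, of p K] by blast
  have split: "\<exists>v j m. f = v + j + m \<and> v \<in> linear_span V \<and> j \<in> J \<and> m \<in> ?M N" if "f \<in> ?A" for f N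
  proof -
    obtain v m where vm: "f = v + m" "v \<in> linear_span V" "m \<in> ?M K" using V(2) \<open>f \<in> ?A\<close> by blast
    then obtain j m' where "m = j + m'" "j \<in> J" "m' \<in> ?M (K + N)"
      using ipow_le_propagate[OF A shifted_coords_subset idJ K, of N] by blast
    moreover have "?M (K + N) \<subseteq> ?M N" by (rule ipow_mono[OF A shifted_coords_subset]) simp
    ultimately have "f = v + j + m' \<and> v \<in> linear_span V \<and> j \<in> J \<and> m' \<in> ?M N"
      using vm by (auto simp: add.assoc simp del: plus_fun_apply)
    then show ?thesis by blast
  qed
  have "\<exists>S. finite S \<and> card S \<le> card V * N ^ card F \<and>
    ?A \<subseteq> ideal_sum (linear_span S) (ideal_sum ?L (?M N))" for N
  proof -
    define mon where "mon \<alpha> = (\<Prod>f\<in>F. f ^ \<alpha> f)" for \<alpha> :: "(('i \<Rightarrow> 'k) \<Rightarrow> 'k) \<Rightarrow> nat"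
    \<comment> \<open>Bounding every exponent by \<open>N\<close> instead of the total degree
      overcounts, but already has the desired order of growth \<open>card F\<close>.\<close>
    define S where "S = (\<lambda>(\<alpha>, v). mon \<alpha> * v) ` ((F \<rightarrow>\<^sub>E {..<N}) \<times> V)"
    define W where "W = ideal_sum ?L (?M N)"
    have finS: "finite S" unfolding S_def using F(1) V(1) by (intro finite_imageI finite_cartesian_product finite_PiE) auto
    have "card S \<le> card ((F \<rightarrow>\<^sub>E {..<N}) \<times> V)"
      unfolding S_def using F(1) V(1) by (intro card_image_le finite_cartesian_product finite_PiE) auto
    also have "\<dots> = card V * N ^ card F" using F(1) by (simp add: card_cartesian_product card_PiE)
    finally have cardS: "card S \<le> card V * N ^ card F" .
    have idW: "is_ideal ?A W"
      unfolding W_def by (intro is_ideal_set_plus[OF A] is_ideal_vanishing is_ideal_point_power)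
    have LW: "?L \<subseteq> W" and MW: "?M N \<subseteq> W"
      using is_ideal_point_power[of I p N] is_ideal_vanishing[of I X]
      unfolding W_def by (auto intro!: ideal_sum_left ideal_sum_right simp: is_ideal_def)
    define U where "U = ideal_sum (linear_span S) W"
    have WU: "W \<subseteq> U" unfolding U_def using ideal_gen.zero by (rule ideal_sum_right)
    have SU: "linear_span S \<subseteq> U" unfolding U_def using idW by (intro ideal_sum_left) (simp add: is_ideal_def)
    have U_add: "a + b \<in> U" if "a \<in> U" "b \<in> U" for a b
    proof -
      from that obtain s w s' w' where *: "a = s + w" "b = s' + w'" "s \<in> linear_span S" "s' \<in> linear_span S" "w \<in> W" "w' \<in> W"
        unfolding U_def by blast
      then have "a + b = (s + s') + (w + w')" by (simp add: algebra_simps del: plus_fun_apply)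
      moreover have "s + s' \<in> linear_span S" "w + w' \<in> W"
        using * linear_span_add idW by (auto simp: is_ideal_def)
      ultimately show ?thesis unfolding U_def by blast
    qed
    have monA: "mon \<alpha> \<in> ?A" for \<alpha>
      unfolding mon_def using F(2) by (intro subring_prod[OF A] subring_power[OF A]) auto
    have monM: "mon \<alpha> \<in> ?M (\<Sum>f\<in>F. \<alpha> f)" for \<alpha>
      unfolding mon_def using F in_point_power_one
      by (intro prod_pow_in_ipow[OF A shifted_coords_subset]) blast+
    \<comment> \<open>\<open>d\<close> bounds the number of factors from \<open>F\<close> still
      missing to reach the power \<open>N\<close>.\<close>
    have "mon \<alpha> * a \<in> U" if "(\<Sum>f\<in>F. \<alpha> f) + d \<ge> N" "a \<in> ?A" for d \<alpha> a
      using that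
    proof (induction d arbitrary: \<alpha> a)
      case 0
      then have "mon \<alpha> \<in> ?M N"
        using monM[of \<alpha>] ipow_mono[OF A shifted_coords_subset, of N "\<Sum>f\<in>F. \<alpha> f" p] by auto
      then have "a * mon \<alpha> \<in> ?M N" using 0 is_ideal_point_power unfolding is_ideal_def by blast
      then show ?case using MW WU by (auto simp: mult.commute simp del: times_fun_apply)
    next
      case (Suc d \<alpha> a)
      show ?case
      proof (cases "(\<Sum>f\<in>F. \<alpha> f) \<ge> N")
        case True
        then have "mon \<alpha> \<in> ?M N"
          using monM[of \<alpha>] ipow_mono[OF A shifted_coords_subset, of N "\<Sum>f\<in>F. \<alpha> f" p] by auto
        then have "a * mon \<alpha> \<in> ?M N" using Suc.prems is_ideal_point_power unfolding is_ideal_def by blast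
        then show ?thesis using MW WU by (auto simp: mult.commute simp del: times_fun_apply)
      next
        case False
        obtain v j m where a: "a = v + j + m" "v \<in> linear_span V" "j \<in> J" "m \<in> ?M N"
          using split[OF Suc.prems(2)] by blast
        have "mon \<alpha> * v \<in> U"
        proof -
          have "\<alpha> f < N" if "f \<in> F" for f
            using member_le_sum[OF that, of \<alpha>] F(1) False by auto
          then have "restrict \<alpha> F \<in> F \<rightarrow>\<^sub>E {..<N}" by auto
          moreover have "mon (restrict \<alpha> F) = mon \<alpha>" unfolding mon_def by (intro prod.cong) auto
          ultimately have "mon \<alpha> * v \<in> S" if "v \<in> V" for v
            using that unfolding S_def by (intro image_eqI[of _ _ "(restrict \<alpha> F, v)"]) auto
          then have "(*) (mon \<alpha>) ` V \<subseteq> S" by blast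
          then show ?thesis using linear_span_mult[OF a(2), of "mon \<alpha>"] linear_span_mono SU by blast
        qed
        moreover have "mon \<alpha> * j \<in> U"
          using a(3) unfolding J_def
        proof (induction j rule: ideal_gen.induct)
          case zero
          show ?case unfolding mult_zero_right using SU ideal_gen.zero by blast
        next
          case (step b f x)
          have "mon \<alpha> * (b * f) \<in> U"
          proof (cases "f \<in> F")
            case True
            define \<beta> where "\<beta> = \<alpha>(f := Suc (\<alpha> f))"
            have "(\<Sum>f\<in>F. \<beta> f) = Suc (\<Sum>f\<in>F. \<alpha> f)"
              using F(1) True by (simp add: \<beta>_def sum.remove[of F f])
            then have "mon \<beta> * b \<in> U" using Suc.prems(1) by (intro Suc.IH step(1)) simp
            moreover have "mon \<beta> = mon \<alpha> * f"
              using F(1) True by (simp add: mon_def \<beta>_def prod.remove[of F f] algebra_simps del: times_fun_apply)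
            ultimately show ?thesis by (simp add: algebra_simps del: times_fun_apply)
          next
            case False
            then have "f \<in> ?L" using step by blast
            moreover have "mon \<alpha> * b \<in> ?A" using subring_mult[OF A monA step(1)] .
            ultimately have "(mon \<alpha> * b) * f \<in> ?L" using is_ideal_vanishing unfolding is_ideal_def by blast
            then show ?thesis using LW WU by (auto simp: mult.assoc simp del: times_fun_apply)
          qed
          then show ?case using U_add step.IH by (simp add: distrib_left del: times_fun_apply plus_fun_apply)
        qed
        moreover have "mon \<alpha> * m \<in> U"
          using a(4) monA is_ideal_point_power MW WU unfolding is_ideal_def by blast
        ultimately show ?thesis using U_add by (simp add: a(1) distrib_left del: times_fun_apply plus_fun_apply)
      qed
    qed
    from this[of "\<lambda>_. 0" N] have "?A \<subseteq> U" by (auto simp: mon_def)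
    then show ?thesis using finS cardS unfolding U_def W_def by blast
  qed
  then show ?thesis by blast
qed

text \<open>\<open>q choose t\<close> grows with order \<open>t\<close> in \<open>q\<close>, while
  the spanning sets allow only order \<open>card F\<close>. The result does the work of Krull's
  height theorem.\<close>

lemma chain_le_card_equations:
  fixes Z :: "nat \<Rightarrow> ('i \<Rightarrow> 'k::alg_closed_field) set"
  assumes I: "finite I" and p: "p \<in> Z 0"
    and Z: "\<And>k. k \<le> t \<Longrightarrow> closedin (zariski I) (Z k) \<and> irreducible_in (zariski I) (Z k)"
      "\<And>k. k < t \<Longrightarrow> Z k \<subset> Z (Suc k)"
    and F: "finite F" "F \<subseteq> poly_funs I" "\<And>f. f \<in> F \<Longrightarrow> f p = 0" and g: "g \<in> poly_funs I" "g p \<noteq> 0"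
    and iso: "\<And>x. x \<in> Z t \<Longrightarrow> (\<And>f. f \<in> F \<Longrightarrow> f x = 0) \<Longrightarrow> g x \<noteq> 0 \<Longrightarrow> x = p"
  shows "t \<le> card F"
proof (rule ccontr)
  assume "\<not> t \<le> card F"
  then have t: "card F < t" by simp
  obtain c where c: "\<And>q. has_indep (poly_funs I)
    (ideal_sum (vanishing I (Z t)) (point_power I p (c * q + 1))) (q choose t)"
    using chain_growth[OF I p Z] by blast
  obtain v where v: "\<And>N. \<exists>S. finite S \<and> card S \<le> v * N ^ card F \<and>
    poly_funs I \<subseteq> ideal_sum (linear_span S) (ideal_sum (vanishing I (Z t)) (point_power I p N))"
  proof -
    have "closedin (zariski I) (Z t)" using Z(1)[of t] by simp
    have "\<exists>v. \<forall>N. \<exists>S. finite S \<and> card S \<le> v * N ^ card F \<and>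
      poly_funs I \<subseteq> ideal_sum (linear_span S) (ideal_sum (vanishing I (Z t)) (point_power I p N))"
    proof (rule isolated_zero_growth[of I "Z t" F p g])
      show "f p = 0" if "f \<in> F" for f using F(3)[OF that] .
      show "x = p" if "x \<in> Z t" "\<And>f. f \<in> F \<Longrightarrow> f x = 0" "g x \<noteq> 0" for x
        by (rule iso[OF that(1) _ that(3)]) (rule that(2))
    qed fact+
    then show ?thesis using that by blast
  qed
  have bound: "q choose t \<le> v * (c * q + 1) ^ card F" for q
  proof -
    obtain S where S: "finite S" "card S \<le> v * (c * q + 1) ^ card F"
      "poly_funs I \<subseteq> ideal_sum (linear_span S) (ideal_sum (vanishing I (Z t)) (point_power I p (c * q + 1)))"
      using v[of "c * q + 1"] by (elim exE conjE)
    have "is_ideal (poly_funs I) (ideal_sum (vanishing I (Z t)) (point_power I p (c * q + 1)))"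
      by (intro is_ideal_set_plus[OF poly_funs_subring] is_ideal_vanishing is_ideal_point_power)
    from steinitz_mod[OF this c S(1,3)] show ?thesis using S(2) by simp
  qed
  \<comment> \<open>At \<open>q = t * y\<close> the binomial coefficient is at least
    \<open>y ^ t\<close>, and the upper bound is at most \<open>C * y ^ card F\<close>. With
    \<open>card F < t\<close>, any \<open>y\<close> above \<open>C\<close> makes the two
    incompatible.\<close>
  define C where "C = v * (c * t + 1) ^ card F"
  define y where "y = Suc C"
  have "y ^ t \<le> (t * y) choose t"
  proof -
    have "t \<le> t * y" by (simp add: y_def)
    then have "(real (t * y) / real t) ^ t \<le> real ((t * y) choose t)"
      using binomial_ge_n_over_k_pow_k[of t "t * y", where 'a = real] by simp
    then have "real (y ^ t) \<le> real ((t * y) choose t)" using t by simp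
    then show ?thesis by (simp only: of_nat_le_iff)
  qed
  also have "\<dots> \<le> v * (c * (t * y) + 1) ^ card F" by (rule bound)
  also have "\<dots> \<le> v * ((c * t + 1) * y) ^ card F"
  proof (intro mult_left_mono power_mono)
    have "(c * t + 1) * y = c * (t * y) + y" by (simp add: algebra_simps)
    then show "c * (t * y) + 1 \<le> (c * t + 1) * y" by (simp add: y_def)
  qed auto
  also have "\<dots> = C * y ^ card F" by (simp only: C_def power_mult_distrib mult.assoc)
  finally have "y ^ t \<le> C * y ^ card F" .
  moreover have "C * y ^ card F < y ^ Suc (card F)" by (simp add: y_def)
  moreover have "y ^ Suc (card F) \<le> y ^ t" using t by (intro power_increasing) (auto simp: y_def)
  ultimately show False by simp
qed

section \<open>Noetherian topology and dimension\<close>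

lemma closedin_zeros: "P \<subseteq> poly_funs I \<Longrightarrow> closedin (zariski I) (zeros I P)"
  unfolding closedin_zariski by blast

lemma zeros_vanishing: "closedin (zariski I) X \<Longrightarrow> zeros I (vanishing I X) = X"
proof
  assume X: "closedin (zariski I) X"
  show "zeros I (vanishing I X) \<subseteq> X"
  proof
    fix x assume x: "x \<in> zeros I (vanishing I X)"
    show "x \<in> X"
    proof (rule ccontr)
      assume "x \<notin> X"
      moreover have "x \<in> affine_space I" using x by (simp add: zeros_def)
      ultimately obtain f where "f \<in> vanishing I X" "f x \<noteq> 0" using closed_separation[OF X] by blast
      then show False using x by (simp add: zeros_def)
    qed
  qed
  show "X \<subseteq> zeros I (vanishing I X)"
    using closed_subset_affine[OF X] by (auto simp: zeros_def vanishing_def)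
qed

lemma wf_closed:
  assumes I: "finite I"
  shows "wf {(X :: ('i \<Rightarrow> 'k::field) set, Y). closedin (zariski I) X \<and> closedin (zariski I) Y \<and> X \<subset> Y}"
  unfolding wf_iff_no_infinite_down_chain
proof
  assume "\<exists>f. \<forall>i. (f (Suc i), f i) \<in> {(X :: ('i \<Rightarrow> 'k) set, Y). closedin (zariski I) X \<and> closedin (zariski I) Y \<and> X \<subset> Y}"
  then obtain X where "\<forall>n. (X (Suc n), X n) \<in> {(X :: ('i \<Rightarrow> 'k) set, Y). closedin (zariski I) X \<and> closedin (zariski I) Y \<and> X \<subset> Y}" ..
  then have X: "\<And>n. closedin (zariski I) (X n)" "\<And>n. X (Suc n) \<subset> X n" by simp_all
  have "\<exists>N. \<forall>n\<ge>N. vanishing I (X n) = vanishing I (X N)"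
    using X(2) by (intro noetherian_chain_stabilizes[OF noetherian_poly_funs[OF I]] is_ideal_vanishing vanishing_antimono) blast
  then obtain N where "vanishing I (X (Suc N)) = vanishing I (X N)" using le_SucI by blast
  then have "X (Suc N) = X N" using zeros_vanishing[OF X(1)] by metis
  then show False using X(2) by blast
qed

lemma closed_decomposition:
  fixes X :: "('i \<Rightarrow> 'k::field) set"
  assumes I: "finite I" and "closedin (zariski I) X"
  shows "\<exists>\<Y>. finite \<Y> \<and> (\<forall>Y\<in>\<Y>. closedin (zariski I) Y \<and> irreducible_in (zariski I) Y) \<and> \<Union>\<Y> = X"
  using assms(2)
proof (induction X rule: wf_induct_rule[OF wf_closed[OF I]])
  case (1 X)
  show ?case
  proof (cases "X = {} \<or> irreducible_in (zariski I) X")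
    case True
    then show ?thesis
    proof
      assume "X = {}"
      then show ?thesis by (intro exI[of _ "{}"]) auto
    next
      assume "irreducible_in (zariski I) X"
      then show ?thesis using 1 by (intro exI[of _ "{X}"]) auto
    qed
  next
    case False
    moreover have "X \<subseteq> topspace (zariski I)" using "1.prems" closedin_subset by blast
    ultimately obtain A B where AB: "closedin (zariski I) A" "closedin (zariski I) B" "X \<subseteq> A \<union> B"
      "\<not> X \<subseteq> A" "\<not> X \<subseteq> B"
      unfolding irreducible_in_def by blast
    have "\<exists>\<Y>. finite \<Y> \<and> (\<forall>Y\<in>\<Y>. closedin (zariski I) Y \<and> irreducible_in (zariski I) Y) \<and> \<Union>\<Y> = X \<inter> D"
      if "closedin (zariski I) D" "\<not> X \<subseteq> D" for D
    proof -
      have "closedin (zariski I) (X \<inter> D)" using "1.prems" that(1) by (rule closedin_Int)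
      then show ?thesis using "1.IH"[of "X \<inter> D"] "1.prems" that(2) by blast
    qed
    from this[OF AB(1,4)] this[OF AB(2,5)] obtain \<A> \<B> where *:
      "finite \<A>" "\<forall>Y\<in>\<A>. closedin (zariski I) Y \<and> irreducible_in (zariski I) Y" "\<Union>\<A> = X \<inter> A"
      "finite \<B>" "\<forall>Y\<in>\<B>. closedin (zariski I) Y \<and> irreducible_in (zariski I) Y" "\<Union>\<B> = X \<inter> B"
      by blast
    then have "\<Union>(\<A> \<union> \<B>) = X" using AB(3) by auto
    then show ?thesis using * by (intro exI[of _ "\<A> \<union> \<B>"]) auto
  qed
qed

section \<open>Irreducible subsets and points\<close>

lemma irreducible_subset_Union:
  assumes "irreducible_in T X" "finite \<Y>" "\<And>Y. Y \<in> \<Y> \<Longrightarrow> closedin T Y" "X \<subseteq> \<Union>\<Y>"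
  shows "\<exists>Y\<in>\<Y>. X \<subseteq> Y"
  using assms(2-4)
proof (induction \<Y>)
  case empty
  then show ?case using assms(1) by (auto simp: irreducible_in_def)
next
  case (insert Y \<Y>)
  have "closedin T Y" using insert.prems(1) by blast
  moreover have "closedin T (\<Union>\<Y>)" using insert by (intro closedin_Union) auto
  moreover have "X \<subseteq> Y \<union> \<Union>\<Y>" using insert.prems(2) by simp
  ultimately have "X \<subseteq> Y \<or> X \<subseteq> \<Union>\<Y>" using assms(1) by (simp add: irreducible_in_def)
  then show ?case using insert by blast
qed

lemma irreducible_in_subtopology:
  "irreducible_in (subtopology T S) X \<longleftrightarrow> irreducible_in T X \<and> X \<subseteq> S"
proof -
  have "(\<forall>A B. closedin (subtopology T S) A \<longrightarrow> closedin (subtopology T S) B \<longrightarrow> X \<subseteq> A \<union> B \<longrightarrow> X \<subseteq> A \<or> X \<subseteq> B)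
    \<longleftrightarrow> (\<forall>A B. closedin T A \<longrightarrow> closedin T B \<longrightarrow> X \<subseteq> A \<union> B \<longrightarrow> X \<subseteq> A \<or> X \<subseteq> B)" (is "?l \<longleftrightarrow> ?r") if "X \<subseteq> S"
  proof
    assume ?l
    show ?r
    proof (intro allI impI)
      fix A B assume AB: "closedin T A" "closedin T B" "X \<subseteq> A \<union> B"
      then have "closedin (subtopology T S) (A \<inter> S)" "closedin (subtopology T S) (B \<inter> S)"
        by (auto simp: closedin_subtopology)
      moreover have "X \<subseteq> (A \<inter> S) \<union> (B \<inter> S)" using AB that by blast
      ultimately show "X \<subseteq> A \<or> X \<subseteq> B" using \<open>?l\<close> by blast
    qed
  next
    assume ?r
    show ?l
    proof (intro allI impI)
      fix A B assume AB: "closedin (subtopology T S) A" "closedin (subtopology T S) B" "X \<subseteq> A \<union> B"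
      then obtain A' B' where "A = A' \<inter> S" "B = B' \<inter> S" "closedin T A'" "closedin T B'"
        by (auto simp: closedin_subtopology)
      then show "X \<subseteq> A \<or> X \<subseteq> B" using \<open>?r\<close> AB(3) that by blast
    qed
  qed
  then show ?thesis unfolding irreducible_in_def topspace_subtopology by (metis le_inf_iff)
qed

lemma singleton_eq_zeros:
  assumes "p \<in> affine_space I"
  shows "{p} = zeros I (shifted_coords I p)"
proof
  show "zeros I (shifted_coords I p) \<subseteq> {p}"
  proof
    fix x assume "x \<in> zeros I (shifted_coords I p)"
    then have "x \<in> affine_space I" "\<And>i. i \<in> I \<Longrightarrow> x i = p i" by (auto simp: zeros_def shifted_coords_def)
    then show "x \<in> {p}" using assms by (auto intro: PiE_ext)
  qed
qed (use assms in \<open>auto simp: zeros_def shifted_coords_def\<close>)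

lemma closedin_singleton: "p \<in> affine_space I \<Longrightarrow> closedin (zariski I) {p}"
  unfolding singleton_eq_zeros by (rule closedin_zeros[OF shifted_coords_subset])

lemma irreducible_singleton: "p \<in> topspace T \<Longrightarrow> irreducible_in T {p}"
  by (auto simp: irreducible_in_def)

text \<open>If the function found so far vanishes at a new point, adding one that vanishes at
  \<open>p\<close> and at the points already treated, but not at the new point, repairs it.\<close>

lemma ex_poly_fun_avoiding:
  fixes p :: "'i \<Rightarrow> 'k::field"
  assumes "finite T" "T \<subseteq> affine_space I" "p \<in> affine_space I" "p \<notin> T"
  shows "\<exists>f\<in>poly_funs I. f p = 0 \<and> (\<forall>y\<in>T. f y \<noteq> 0)"
  using assms
proof (induction T)
  case empty
  then show ?case by (intro bexI[of _ "const_fun 0"]) (auto intro: poly_funs.const)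
next
  case (insert y T)
  then obtain f where f: "f \<in> poly_funs I" "f p = 0" "\<forall>y\<in>T. f y \<noteq> 0" by auto
  show ?case
  proof (cases "f y = 0")
    case False
    then show ?thesis using f by auto
  next
    case True
    have "closedin (zariski I) (\<Union>z\<in>insert p T. {z})"
      using insert by (intro closedin_Union) (auto intro: closedin_singleton)
    then have "closedin (zariski I) (insert p T)" by simp
    then obtain h where "h \<in> vanishing I (insert p T)" "h y \<noteq> 0"
      using insert by (elim closed_separation[of I "insert p T" y]) auto
    then have "f + h \<in> poly_funs I" "(f + h) p = 0" "\<forall>z\<in>insert y T. (f + h) z \<noteq> 0"
      using f True poly_funs_ring(5)[of f I h] by (auto simp: vanishing_def)
    then show ?thesis by blast
  qed
qed

section \<open>Chains, isolating equations and dimension\<close>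

definition irreducible_chain :: "'a topology \<Rightarrow> nat \<Rightarrow> (nat \<Rightarrow> 'a set) \<Rightarrow> bool" where
  "irreducible_chain T t Z \<longleftrightarrow> (\<forall>k\<le>t. closedin T (Z k) \<and> irreducible_in T (Z k)) \<and> (\<forall>k<t. Z k \<subset> Z (Suc k))"

lemma irreducible_chain_mono:
  assumes "irreducible_chain T t Z" "j \<le> k" "k \<le> t"
  shows "Z j \<subseteq> Z k"
  using assms(2,3)
proof (induction k rule: dec_induct)
  case (step n)
  then have "Z n \<subset> Z (Suc n)" using assms(1) by (simp add: irreducible_chain_def)
  then show ?case using step by simp
qed simp

lemma irreducible_chain_extend:
  assumes "irreducible_chain T t Z" "closedin T Y" "irreducible_in T Y" "Z t \<subset> Y"
  shows "irreducible_chain T (Suc t) (Z(Suc t := Y))"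
  using assms by (auto simp: irreducible_chain_def le_Suc_eq less_Suc_eq)

text \<open>A function that vanishes at \<open>p\<close> but on no member of a decomposition of
  \<open>X\<close> other than possibly {p} shortens the chains through \<open>p\<close>: the top of
  a nontrivial chain in its zero set lies properly inside a member of the decomposition, which would
  prolong the chain. Once no chain of positive length is left, \<open>g\<close> removes the members
  that miss \<open>p\<close>.\<close>

lemma ex_isolating_equations:
  fixes X :: "('i \<Rightarrow> 'k::field) set"
  assumes I: "finite I" and p: "p \<in> affine_space I" and X: "closedin (zariski I) X"
    and c: "\<And>t Z. irreducible_chain (zariski I) t Z \<Longrightarrow> p \<in> Z 0 \<Longrightarrow> Z t \<subseteq> X \<Longrightarrow> t \<le> c"
  shows "\<exists>F g. finite F \<and> card F \<le> c \<and> F \<subseteq> poly_funs I \<and> (\<forall>f\<in>F. f p = 0) \<and>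
    g \<in> poly_funs I \<and> g p \<noteq> 0 \<and> (\<forall>x\<in>X. (\<forall>f\<in>F. f x = 0) \<longrightarrow> g x \<noteq> 0 \<longrightarrow> x = p)"
  using X c
proof (induction c arbitrary: X)
  case (0 X)
  obtain \<Y> where \<Y>: "finite \<Y>" "\<And>Y. Y \<in> \<Y> \<Longrightarrow> closedin (zariski I) Y \<and> irreducible_in (zariski I) Y" "\<Union>\<Y> = X"
    using closed_decomposition[OF I "0.prems"(1)] by blast
  define Q where "Q = \<Union>{Y\<in>\<Y>. p \<notin> Y}"
  have "closedin (zariski I) Q" unfolding Q_def using \<Y> by (intro closedin_Union) auto
  then obtain g where g: "g \<in> vanishing I Q" "g p \<noteq> 0"
    using closed_separation[of I Q p] p by (auto simp: Q_def)
  have "x = p" if "x \<in> X" "g x \<noteq> 0" for x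
  proof (rule ccontr)
    assume "x \<noteq> p"
    have "x \<notin> Q" using g that by (auto simp: vanishing_def)
    then have "\<exists>Y\<in>\<Y>. x \<in> Y \<and> p \<in> Y" using that \<Y>(3) by (auto simp: Q_def)
    then obtain Y where Y: "Y \<in> \<Y>" "x \<in> Y" "p \<in> Y" by blast
    have "irreducible_chain (zariski I) 0 (\<lambda>_. {p})"
      using p by (simp add: irreducible_chain_def closedin_singleton irreducible_singleton topspace_zariski)
    then have "irreducible_chain (zariski I) (Suc 0) ((\<lambda>_. {p})(Suc 0 := Y))"
      using Y \<Y>(2)[OF Y(1)] \<open>x \<noteq> p\<close> by (intro irreducible_chain_extend) auto
    then have "Suc 0 \<le> 0" by (rule "0.prems"(2)) (use Y \<Y>(3) in auto)
    then show False by simp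
  qed
  then show ?case using g by (intro exI[of _ "{}"] exI[of _ g]) (auto simp: vanishing_def)
next
  case (Suc c X)
  obtain \<Y> where \<Y>: "finite \<Y>" "\<And>Y. Y \<in> \<Y> \<Longrightarrow> closedin (zariski I) Y \<and> irreducible_in (zariski I) Y" "\<Union>\<Y> = X"
    using closed_decomposition[OF I "Suc.prems"(1)] by blast
  define \<P> where "\<P> = {Y\<in>\<Y>. \<not> Y \<subseteq> {p}}"
  have "\<forall>Y\<in>\<P>. \<exists>y. y \<in> Y \<and> y \<noteq> p" by (auto simp: \<P>_def)
  then obtain w where w: "\<And>Y. Y \<in> \<P> \<Longrightarrow> w Y \<in> Y \<and> w Y \<noteq> p" by metis
  have "w ` \<P> \<subseteq> affine_space I"
  proof
    fix y assume "y \<in> w ` \<P>"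
    then obtain Y where "Y \<in> \<Y>" "y \<in> Y" using w by (auto simp: \<P>_def)
    then show "y \<in> affine_space I" using closed_subset_affine \<Y>(2) by blast
  qed
  moreover have "p \<notin> w ` \<P>" "finite (w ` \<P>)" using w \<Y>(1) by (auto simp: \<P>_def)
  ultimately obtain f where f: "f \<in> poly_funs I" "f p = 0" "\<And>Y. Y \<in> \<P> \<Longrightarrow> f (w Y) \<noteq> 0"
    using ex_poly_fun_avoiding[of "w ` \<P>" I p] p by auto
  define X' where "X' = X \<inter> {x \<in> affine_space I. f x = 0}"
  have X': "closedin (zariski I) X'"
    unfolding X'_def by (intro closedin_Int Suc.prems zeros_closed f)
  have bound: "t \<le> c" if Z: "irreducible_chain (zariski I) t Z" "p \<in> Z 0" "Z t \<subseteq> X'" for t Z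
  proof (cases "t = 0")
    case False
    have irr: "irreducible_in (zariski I) (Z t)" using Z by (simp add: irreducible_chain_def)
    obtain Y where Y: "Y \<in> \<Y>" "Z t \<subseteq> Y"
      using irreducible_subset_Union[OF irr \<Y>(1)] \<Y>(2,3) Z(3) by (auto simp: X'_def)
    \<comment> \<open>As \<open>t\<close> is positive, \<open>Z t\<close> has more than one point,
      so \<open>Y\<close> is among the sets on which \<open>f\<close> was made nonzero somewhere;
      hence \<open>Y\<close> is strictly larger than \<open>Z t\<close>.\<close>
    have "Z 0 \<subset> Z (Suc 0)" using Z(1) False by (simp add: irreducible_chain_def)
    moreover have "Z (Suc 0) \<subseteq> Z t" using irreducible_chain_mono[OF Z(1), of "Suc 0" t] False by simp
    ultimately have "Y \<in> \<P>" using Y Z(2) by (auto simp: \<P>_def)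
    then have "w Y \<in> Y" "w Y \<notin> Z t" using w f(3) Z(3) by (auto simp: X'_def)
    then have "irreducible_chain (zariski I) (Suc t) (Z(Suc t := Y))"
      using Z(1) Y \<Y>(2)[OF Y(1)] by (intro irreducible_chain_extend) auto
    then have "Suc t \<le> Suc c" by (rule Suc.prems(2)) (use Y \<Y>(3) Z(2) in auto)
    then show ?thesis by simp
  qed simp
  obtain F g where F: "finite F" "card F \<le> c" "F \<subseteq> poly_funs I" "\<forall>f\<in>F. f p = 0"
    "g \<in> poly_funs I" "g p \<noteq> 0" "\<forall>x\<in>X'. (\<forall>f\<in>F. f x = 0) \<longrightarrow> g x \<noteq> 0 \<longrightarrow> x = p"
  proof -
    have "\<exists>F g. finite F \<and> card F \<le> c \<and> F \<subseteq> poly_funs I \<and> (\<forall>f\<in>F. f p = 0) \<and>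
      g \<in> poly_funs I \<and> g p \<noteq> 0 \<and> (\<forall>x\<in>X'. (\<forall>f\<in>F. f x = 0) \<longrightarrow> g x \<noteq> 0 \<longrightarrow> x = p)"
      by (rule Suc.IH[OF X']) (rule bound)
    then show ?thesis using that by (elim exE conjE)
  qed
  have "x = p" if "x \<in> X" "\<forall>f\<in>insert f F. f x = 0" "g x \<noteq> 0" for x
  proof -
    have "x \<in> X'" using that closed_subset_affine[OF Suc.prems(1)] by (simp add: X'_def subset_iff)
    then show ?thesis using that(2,3) F(7) by simp
  qed
  moreover have "card (insert f F) \<le> Suc c" using card_insert_le_m1[of "Suc c" F f] F(2) by simp
  ultimately show ?case using F f by (intro exI[of _ "insert f F"] exI[of _ g]) auto
qed

text \<open>The shifted coordinates of a point, at most \<open>card I\<close> many, have that point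
  as their only common zero in the whole affine space, so \<open>g\<close> can be the constant
  1.\<close>

lemma chain_length_bound:
  fixes Z :: "nat \<Rightarrow> ('i \<Rightarrow> 'k::alg_closed_field) set"
  assumes I: "finite I" and Z: "irreducible_chain (zariski I) t Z"
  shows "t \<le> card I"
proof -
  have "irreducible_in (zariski I) (Z 0)" using Z by (simp add: irreducible_chain_def)
  then obtain p where p: "p \<in> Z 0" "p \<in> affine_space I" by (auto simp: irreducible_in_def topspace_zariski)
  have sub: "Z t \<subseteq> affine_space I"
    using Z by (intro closed_subset_affine) (simp add: irreducible_chain_def)
  have "t \<le> card (shifted_coords I p)"
  proof (rule chain_le_card_equations[of I p Z t _ 1])
    show "1 \<in> poly_funs I" by (rule poly_funs_ring)
    show "x = p" if "x \<in> Z t" "\<And>f. f \<in> shifted_coords I p \<Longrightarrow> f x = 0" for x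
    proof -
      have "x \<in> zeros I (shifted_coords I p)" using that sub unfolding zeros_def by blast
      then show ?thesis using singleton_eq_zeros[OF p(2)] by blast
    qed
    show "f p = 0" if "f \<in> shifted_coords I p" for f using that by (auto simp: shifted_coords_def)
  qed (use I p Z in \<open>auto simp: irreducible_chain_def finite_shifted_coords[OF I]
      simp del: subset_iff intro: subsetD[OF shifted_coords_subset]\<close>)
  also have "\<dots> \<le> card I" unfolding shifted_coords_def by (rule card_image_le[OF I])
  finally show ?thesis .
qed

text \<open>Chain lengths are bounded, so the supremum is attained by a natural number. As
  \<open>X\<close> is closed, the chains of the subspace are the chains of the affine space that
  stay inside \<open>X\<close>.\<close>

lemma variety_dim_closed:
  fixes X :: "('i \<Rightarrow> 'k::alg_closed_field) set"
  assumes I: "finite I" and X: "closedin (zariski I) X" "X \<noteq> {}"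
  obtains d Z where "variety_dim I X = ereal (real d)" "irreducible_chain (zariski I) d Z" "Z d \<subseteq> X"
    "\<And>t Z. irreducible_chain (zariski I) t Z \<Longrightarrow> Z t \<subseteq> X \<Longrightarrow> t \<le> d"
proof -
  define S where "S = {t. \<exists>Z. irreducible_chain (zariski I) t Z \<and> Z t \<subseteq> X}"
  have S: "S = {t. \<exists>Z. (\<forall>k\<le>t. closedin (subtopology (zariski I) X) (Z k) \<and>
     irreducible_in (subtopology (zariski I) X) (Z k)) \<and> (\<forall>k<t. Z k \<subset> Z (Suc k))}" (is "_ = {t. \<exists>Z. ?ch t Z}")
  proof -
    have "?ch t Z \<longleftrightarrow> irreducible_chain (zariski I) t Z \<and> Z t \<subseteq> X" for t Z
    proof
      assume "?ch t Z"
      then show "irreducible_chain (zariski I) t Z \<and> Z t \<subseteq> X"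
        by (auto simp: irreducible_chain_def irreducible_in_subtopology closedin_closed_subtopology[OF X(1)])
    next
      assume *: "irreducible_chain (zariski I) t Z \<and> Z t \<subseteq> X"
      then have "Z k \<subseteq> X" if "k \<le> t" for k using irreducible_chain_mono[of "zariski I" t Z k t] that by auto
      then show "?ch t Z" using *
        by (auto simp: irreducible_chain_def irreducible_in_subtopology closedin_closed_subtopology[OF X(1)])
    qed
    then show ?thesis by (simp add: S_def)
  qed
  have bnd: "S \<subseteq> {..card I}" unfolding S_def using chain_length_bound[OF I] by blast
  then have fin: "finite S" by (rule finite_subset) simp
  obtain x where x: "x \<in> X" using X(2) by blast
  then have "x \<in> affine_space I" using closed_subset_affine[OF X(1)] by blast
  then have "irreducible_chain (zariski I) 0 (\<lambda>_. {x})"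
    by (simp add: irreducible_chain_def closedin_singleton irreducible_singleton topspace_zariski)
  then have "0 \<in> S" using x by (auto simp: S_def)
  define d where "d = Max S"
  have d: "d \<in> S" "\<And>t. t \<in> S \<Longrightarrow> t \<le> d"
    using Max_in[OF fin] Max_ge[OF fin] \<open>0 \<in> S\<close> by (auto simp: d_def)
  have "variety_dim I X = Sup {ereal (real t) | t. t \<in> S}"
    unfolding krull_dim_def S by simp
  also have "\<dots> = ereal (real d)"
    using d by (intro antisym Sup_least Sup_upper) auto
  finally show ?thesis using d that unfolding S_def by blast
qed

section \<open>Polynomial maps and products\<close>

lemma polynomial_mapE:
  assumes "polynomial_map K X J \<phi>"
  obtains \<Phi> where "\<And>j. j \<in> J \<Longrightarrow> \<Phi> j \<in> poly_funs K" "\<And>j x. j \<in> J \<Longrightarrow> x \<in> X \<Longrightarrow> \<phi> x j = \<Phi> j x"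
proof -
  have "\<forall>j\<in>J. \<exists>p. p \<in> poly_funs K \<and> (\<forall>x\<in>X. \<phi> x j = p x)"
    using assms unfolding polynomial_map_def by blast
  from bchoice[OF this] show ?thesis using that by blast
qed

lemma polynomial_map_pullback:
  assumes "polynomial_map K X J \<phi>" "f \<in> poly_funs J"
  shows "\<exists>g\<in>poly_funs K. \<forall>x\<in>X. f (\<phi> x) = g x"
proof -
  obtain \<Phi> where \<Phi>: "\<And>j. j \<in> J \<Longrightarrow> \<Phi> j \<in> poly_funs K" "\<And>j x. j \<in> J \<Longrightarrow> x \<in> X \<Longrightarrow> \<phi> x j = \<Phi> j x"
    using polynomial_mapE[OF assms(1)] by blast
  have pf: "(\<lambda>x. f (\<lambda>j. \<Phi> j x)) \<in> poly_funs K"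
    using \<Phi>(1) by (intro poly_funs_compose[OF assms(2)]) simp
  have "f (\<phi> x) = f (\<lambda>j. \<Phi> j x)" if "x \<in> X" for x
  proof (rule poly_funs_cong[OF assms(2)])
    show "\<phi> x j = \<Phi> j x" if "j \<in> J" for j using \<Phi>(2)[OF that \<open>x \<in> X\<close>] .
  qed
  then have "\<forall>x\<in>X. f (\<phi> x) = (\<lambda>x. f (\<lambda>j. \<Phi> j x)) x" by simp
  then show ?thesis using pf by (rule bexI)
qed

lemma closedin_preimage:
  fixes \<phi> :: "('i \<Rightarrow> 'k::field) \<Rightarrow> ('j \<Rightarrow> 'k)"
  assumes X: "closedin (zariski K) X" and \<phi>: "polynomial_map K X J \<phi>" "\<phi> \<in> X \<rightarrow> affine_space J"
    and C: "closedin (zariski J) C"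
  shows "closedin (zariski K) {x \<in> X. \<phi> x \<in> C}"
proof -
  obtain P where P: "P \<subseteq> poly_funs J" "C = zeros J P" using C unfolding closedin_zariski by blast
  have "\<forall>f\<in>P. \<exists>g. g \<in> poly_funs K \<and> (\<forall>x\<in>X. f (\<phi> x) = g x)"
    using polynomial_map_pullback[OF \<phi>(1)] P(1) by blast
  then obtain G where G: "\<And>f. f \<in> P \<Longrightarrow> G f \<in> poly_funs K" "\<And>f x. f \<in> P \<Longrightarrow> x \<in> X \<Longrightarrow> f (\<phi> x) = G f x"
    by metis
  have "closedin (zariski K) (X \<inter> zeros K (G ` P))"
    using G(1) by (intro closedin_Int X closedin_zeros) auto
  also have "X \<inter> zeros K (G ` P) = {x \<in> X. \<phi> x \<in> C}"
  proof -
    have "x \<in> zeros K (G ` P) \<longleftrightarrow> \<phi> x \<in> C" if "x \<in> X" for x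
    proof -
      have "x \<in> affine_space K" "\<phi> x \<in> affine_space J"
        using that closed_subset_affine[OF X] \<phi>(2) by auto
      then show ?thesis using G(2)[OF _ that] by (simp add: P(2) zeros_def)
    qed
    then show ?thesis by blast
  qed
  finally show ?thesis .
qed

lemma irreducible_image:
  fixes \<phi> :: "('i \<Rightarrow> 'k::field) \<Rightarrow> ('j \<Rightarrow> 'k)"
  assumes X: "closedin (zariski K) X" and \<phi>: "polynomial_map K X J \<phi>" "\<phi> \<in> X \<rightarrow> affine_space J"
    and W: "irreducible_in (zariski K) W" "W \<subseteq> X"
  shows "irreducible_in (zariski J) (\<phi> ` W)"
  unfolding irreducible_in_def
proof (intro conjI allI impI)
  show "\<phi> ` W \<subseteq> topspace (zariski J)" using W(2) \<phi>(2) by (auto simp: topspace_zariski)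
  show "\<phi> ` W \<noteq> {}" using W(1) by (simp add: irreducible_in_def)
  fix A B assume AB: "closedin (zariski J) A" "closedin (zariski J) B" "\<phi> ` W \<subseteq> A \<union> B"
  have "W \<subseteq> {x \<in> X. \<phi> x \<in> A} \<union> {x \<in> X. \<phi> x \<in> B}" using AB(3) W(2) by blast
  then have "W \<subseteq> {x \<in> X. \<phi> x \<in> A} \<or> W \<subseteq> {x \<in> X. \<phi> x \<in> B}"
    using W(1) closedin_preimage[OF X \<phi> AB(1)] closedin_preimage[OF X \<phi> AB(2)]
    by (simp add: irreducible_in_def)
  then show "\<phi> ` W \<subseteq> A \<or> \<phi> ` W \<subseteq> B" by blast
qed

section \<open>Products of irreducible closed sets\<close>

definition tuples :: "'i set \<Rightarrow> nat \<Rightarrow> (nat \<Rightarrow> ('i \<Rightarrow> 'k) set) \<Rightarrow> (nat \<times> 'i \<Rightarrow> 'k) set" where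
  "tuples I m Y = {x \<in> affine_space ({..<m} \<times> I). \<forall>j<m. entry I x j \<in> Y j}"

definition upd :: "'i set \<Rightarrow> nat \<Rightarrow> (nat \<times> 'i \<Rightarrow> 'k) \<Rightarrow> nat \<Rightarrow> ('i \<Rightarrow> 'k) \<Rightarrow> (nat \<times> 'i \<Rightarrow> 'k)" where
  "upd I m x j w = (\<lambda>(l, i)\<in>{..<m} \<times> I. if l = j then w i else x (l, i))"

lemma upd_affine: "upd I m x j w \<in> affine_space ({..<m} \<times> I)"
  by (auto simp: upd_def)

lemma entry_upd: "l < m \<Longrightarrow> w \<in> affine_space I \<Longrightarrow> entry I (upd I m x j w) l = (if l = j then w else entry I x l)"
  by (auto simp: entry_def upd_def restrict_def fun_eq_iff PiE_def extensional_def)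

lemma upd_entry: "x \<in> affine_space ({..<m} \<times> I) \<Longrightarrow> upd I m x j (entry I x j) = x"
  by (auto simp: upd_def entry_def restrict_def fun_eq_iff PiE_def extensional_def)

lemma polynomial_map_upd: "polynomial_map I X ({..<m} \<times> I) (upd I m x j)"
  unfolding polynomial_map_def
proof
  fix li assume li: "li \<in> {..<m} \<times> I"
  obtain l i where [simp]: "li = (l, i)" by (cases li)
  show "\<exists>p\<in>poly_funs I. \<forall>w\<in>X. upd I m x j w li = p w"
  proof (cases "l = j")
    case True
    then show ?thesis using li by (intro bexI[of _ "\<lambda>w. w i"]) (auto simp: upd_def intro: poly_funs.coord)
  next
    case False
    then show ?thesis using li
      by (intro bexI[of _ "\<lambda>w. x (l, i)"]) (auto simp: upd_def intro: poly_funs.const)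
  qed
qed

lemma polynomial_map_entry: "j < m \<Longrightarrow> polynomial_map ({..<m} \<times> I) X I (\<lambda>x. entry I x j)"
  unfolding polynomial_map_def
proof
  fix i assume "j < m" "i \<in> I"
  then show "\<exists>p\<in>poly_funs ({..<m} \<times> I). \<forall>x\<in>X. entry I x j i = p x"
    by (intro bexI[of _ "\<lambda>x. x (j, i)"]) (auto simp: entry_def intro: poly_funs.coord)
qed

lemma closedin_affine_space: "closedin (zariski I) (affine_space I)"
  by (metis closedin_topspace topspace_zariski)

lemma closedin_tuples:
  assumes "\<And>j. j < m \<Longrightarrow> closedin (zariski I) (Y j :: ('i \<Rightarrow> 'k::field) set)"
  shows "closedin (zariski ({..<m} \<times> I)) (tuples I m Y)"
proof -
  let ?T = "zariski ({..<m} \<times> I) :: (nat \<times> 'i \<Rightarrow> 'k) topology"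
  let ?V = "affine_space ({..<m} \<times> I) :: (nat \<times> 'i \<Rightarrow> 'k) set"
  have cl: "closedin ?T {x \<in> ?V. entry I x j \<in> Y j}" if "j < m" for j
    using assms[OF that]
    by (intro closedin_preimage[OF closedin_affine_space polynomial_map_entry[OF that]]) (auto simp: entry_def)
  \<comment> \<open>The whole space is inserted so that the family is nonempty also for
    \<open>m = 0\<close>.\<close>
  have "closedin ?T (\<Inter>(insert ?V ((\<lambda>j. {x \<in> ?V. entry I x j \<in> Y j}) ` {..<m})))"
    using cl closedin_affine_space by (intro closedin_Inter) auto
  also have "\<Inter>(insert ?V ((\<lambda>j. {x \<in> ?V. entry I x j \<in> Y j}) ` {..<m})) = tuples I m Y"
    unfolding tuples_def by blast
  finally show ?thesis .
qed

text \<open>The Zariski topology of a product is in general finer than the product topology, so the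
  entries are set free one at a time. For a fixed value \<open>w\<close> of the new entry the slice
  is irreducible and hence lies in one of the two closed sets. The values of either kind form closed
  sets, because replacing one entry is a polynomial map in \<open>w\<close>, and irreducibility of
  \<open>Y j\<close> decides between them.\<close>

lemma irreducible_slice:
  fixes Y :: "nat \<Rightarrow> ('i \<Rightarrow> 'k::field) set"
  assumes Y: "\<And>j. j < m \<Longrightarrow> closedin (zariski I) (Y j) \<and> irreducible_in (zariski I) (Y j)"
    and "finite S" "S \<subseteq> {..<m}" "y \<in> tuples I m Y"
  shows "irreducible_in (zariski ({..<m} \<times> I)) {x \<in> tuples I m Y. \<forall>j<m. j \<notin> S \<longrightarrow> entry I x j = entry I y j}"
  using assms(2-4)
proof (induction S arbitrary: y)
  case empty
  have "x = y" if "x \<in> tuples I m Y" "\<forall>j<m. entry I x j = entry I y j" for x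
  proof (rule PiE_ext)
    show "x \<in> affine_space ({..<m} \<times> I)" "y \<in> affine_space ({..<m} \<times> I)"
      using that(1) empty.prems by (auto simp: tuples_def)
    fix li assume "li \<in> {..<m} \<times> I"
    then obtain l i where li: "li = (l, i)" "l < m" "i \<in> I" by auto
    then have "entry I x l i = entry I y l i" using that by simp
    then show "x li = y li" using li by (simp add: entry_def)
  qed
  then have "{x \<in> tuples I m Y. \<forall>j<m. j \<notin> {} \<longrightarrow> entry I x j = entry I y j} = {y}"
    using empty.prems by auto
  moreover have "y \<in> topspace (zariski ({..<m} \<times> I))"
    using empty.prems by (simp add: tuples_def topspace_zariski)
  ultimately show ?case using irreducible_singleton by metis
next
  case (insert j S y)
  let ?T = "zariski ({..<m} \<times> I) :: (nat \<times> 'i \<Rightarrow> 'k) topology"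
  have jm: "j < m" using insert.prems by simp
  have Yaff: "Y j \<subseteq> affine_space I" using Y[OF jm] closed_subset_affine by blast
  define sl where "sl S y = {x \<in> tuples I m Y. \<forall>j<m. j \<notin> S \<longrightarrow> entry I x j = entry I y j}" for S y
  have upd_tuples: "upd I m x j w \<in> tuples I m Y" if "x \<in> tuples I m Y" "w \<in> Y j" for x w
    using that Yaff by (auto simp: tuples_def upd_affine entry_upd subset_iff simp del: PiE_UNIV_domain)
  have irr: "irreducible_in ?T (sl S (upd I m y j w))" if "w \<in> Y j" for w
    unfolding sl_def using upd_tuples[OF insert.prems(2) that] insert.prems(1) by (intro insert.IH) auto
  have sub: "sl S (upd I m y j w) \<subseteq> sl (insert j S) y" if "w \<in> Y j" for w
    using that Yaff insert.hyps(2) unfolding sl_def by (auto simp: entry_upd subset_iff)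
  have slx: "upd I m x j w \<in> sl S (upd I m y j w)" if "x \<in> sl (insert j S) y" "w \<in> Y j" for x w
  proof -
    have "w \<in> affine_space I" using that(2) Yaff by blast
    then show ?thesis using that upd_tuples[of x w] by (auto simp: sl_def entry_upd)
  qed
  have slD: "\<exists>x'\<in>sl (insert j S) y. x = upd I m x' j w" if "x \<in> sl S (upd I m y j w)" "w \<in> Y j" for x w
  proof
    have w: "w \<in> affine_space I" using that(2) Yaff by blast
    have "entry I x j = w" using that(1) insert.hyps(2) jm w by (simp add: sl_def entry_upd)
    then show "x = upd I m x j w" using that(1) upd_entry[of x m I j] by (simp add: sl_def tuples_def)
    show "x \<in> sl (insert j S) y" using sub[OF that(2)] that(1) by blast
  qed
  have "irreducible_in ?T (sl (insert j S) y)"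
    unfolding irreducible_in_def
  proof (intro conjI allI impI)
    show "sl (insert j S) y \<subseteq> topspace ?T"
      unfolding topspace_zariski sl_def tuples_def by blast
    show "sl (insert j S) y \<noteq> {}" using insert.prems(2) by (auto simp: sl_def)
    fix A B assume AB: "closedin ?T A" "closedin ?T B" "sl (insert j S) y \<subseteq> A \<union> B"
    \<comment> \<open>Letting the remaining entries run through all points of the larger slice
      presents \<open>WW D\<close> as an intersection of closed preimages of
      \<open>D\<close>.\<close>
    define WW where "WW D = {w \<in> Y j. sl S (upd I m y j w) \<subseteq> D}" for D
    have clW: "closedin (zariski I) (WW D)" if D: "closedin ?T D" for D
    proof -
      have cl: "closedin (zariski I) {w \<in> Y j. upd I m x j w \<in> D}" for x
      proof (rule closedin_preimage[OF _ polynomial_map_upd _ D])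
        show "closedin (zariski I) (Y j)" using Y[OF jm] by simp
        show "upd I m x j \<in> Y j \<rightarrow> affine_space ({..<m} \<times> I)" by (intro Pi_I upd_affine)
      qed
      have "closedin (zariski I) (\<Inter>x\<in>sl (insert j S) y. {w \<in> Y j. upd I m x j w \<in> D})"
        using cl insert.prems(2) by (intro closedin_Inter) (auto simp: sl_def)
      also have "(\<Inter>x\<in>sl (insert j S) y. {w \<in> Y j. upd I m x j w \<in> D}) = WW D"
      proof
        show "(\<Inter>x\<in>sl (insert j S) y. {w \<in> Y j. upd I m x j w \<in> D}) \<subseteq> WW D"
        proof
          fix w assume w: "w \<in> (\<Inter>x\<in>sl (insert j S) y. {w \<in> Y j. upd I m x j w \<in> D})"
          moreover have "y \<in> sl (insert j S) y" using insert.prems(2) by (simp add: sl_def)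
          ultimately have "w \<in> Y j" by blast
          then show "w \<in> WW D" unfolding WW_def using w slD by blast
        qed
        show "WW D \<subseteq> (\<Inter>x\<in>sl (insert j S) y. {w \<in> Y j. upd I m x j w \<in> D})"
          unfolding WW_def using slx by blast
      qed
      finally show ?thesis .
    qed
    have "sl S (upd I m y j w) \<subseteq> A \<or> sl S (upd I m y j w) \<subseteq> B" if "w \<in> Y j" for w
    proof -
      have "sl S (upd I m y j w) \<subseteq> A \<union> B" using sub[OF that] AB(3) by blast
      then show ?thesis using irr[OF that] AB(1,2) by (simp add: irreducible_in_def)
    qed
    then have "Y j \<subseteq> WW A \<union> WW B" by (auto simp: WW_def)
    then have "Y j \<subseteq> WW A \<or> Y j \<subseteq> WW B"
      using Y[OF jm] clW[OF AB(1)] clW[OF AB(2)] by (simp add: irreducible_in_def)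
    moreover have "sl (insert j S) y \<subseteq> D" if D: "Y j \<subseteq> WW D" for D
    proof
      fix x assume x: "x \<in> sl (insert j S) y"
      then have xt: "x \<in> tuples I m Y" by (simp add: sl_def)
      then have e: "entry I x j \<in> Y j" using jm by (simp add: tuples_def)
      have "upd I m x j (entry I x j) = x" using xt by (intro upd_entry) (simp add: tuples_def)
      then have "x \<in> sl S (upd I m y j (entry I x j))" using slx[OF x e] by simp
      then show "x \<in> D" using D e by (auto simp: WW_def)
    qed
    ultimately show "sl (insert j S) y \<subseteq> A \<or> sl (insert j S) y \<subseteq> B" by blast
  qed
  then show ?case by (simp add: sl_def)
qed

lemma irreducible_tuples:
  fixes Y :: "nat \<Rightarrow> ('i \<Rightarrow> 'k::field) set"
  assumes "\<And>j. j < m \<Longrightarrow> closedin (zariski I) (Y j) \<and> irreducible_in (zariski I) (Y j)"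
    and "y \<in> tuples I m Y"
  shows "irreducible_in (zariski ({..<m} \<times> I)) (tuples I m Y)"
  using irreducible_slice[of m I Y "{..<m}" y] assms by simp

text \<open>The chains of the entries are climbed one after the other: entry \<open>j\<close> rises
  between the steps \<open>j * d\<close> and \<open>Suc j * d\<close>. Truncated subtraction keeps
  it at the bottom before, and \<open>min d\<close> keeps it at the top afterwards.\<close>

lemma tuples_chain:
  fixes Z :: "nat \<Rightarrow> nat \<Rightarrow> ('i \<Rightarrow> 'k::field) set"
  assumes Z: "\<And>j. j < m \<Longrightarrow> irreducible_chain (zariski I) d (Z j)"
    and p: "p \<in> affine_space ({..<m} \<times> I)" "\<And>j. j < m \<Longrightarrow> entry I p j \<in> Z j 0"
  defines "Zm \<equiv> \<lambda>l. tuples I m (\<lambda>j. Z j (min d (l - j * d)))"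
  shows "irreducible_chain (zariski ({..<m} \<times> I)) (m * d) Zm" and "p \<in> Zm 0"
proof -
  have pZ: "entry I p j \<in> Z j k" if "j < m" "k \<le> d" for j k
    using p(2)[OF that(1)] irreducible_chain_mono[OF Z[OF that(1)], of 0 k] that(2) by auto
  have pPP: "p \<in> Zm l" for l
    using p(1) pZ by (simp add: Zm_def tuples_def)
  then show "p \<in> Zm 0" .
  have ZZ: "closedin (zariski I) (Z j (min d k)) \<and> irreducible_in (zariski I) (Z j (min d k))" if "j < m" for j k
    using Z[OF that] by (simp add: irreducible_chain_def)
  have "Zm l \<subset> Zm (Suc l)" if l: "l < m * d" for l
  proof
    show "Zm l \<subseteq> Zm (Suc l)"
    proof
      fix x assume x: "x \<in> Zm l"
      have "Z j (min d (l - j * d)) \<subseteq> Z j (min d (Suc l - j * d))" if "j < m" for j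
        by (rule irreducible_chain_mono[OF Z[OF that]]) auto
      then show "x \<in> Zm (Suc l)" using x by (auto simp: Zm_def tuples_def)
    qed
    \<comment> \<open>Step \<open>l\<close> moves entry \<open>l div d\<close> from member
      \<open>l mod d\<close> of its chain to the next one. Strictness is witnessed by
      \<open>p\<close> with this entry replaced, since the other entries of \<open>p\<close> belong
      to every member of their chains.\<close>
    define j where "j = l div d"
    have d: "d > 0" using l by (cases d) auto
    have jm: "j < m" unfolding j_def using l by (simp add: less_mult_imp_div_less)
    define k where "k = l mod d"
    have lk: "l = j * d + k" "k < d" using d by (simp_all add: j_def k_def)
    have "Z j k \<subset> Z j (Suc k)" using Z[OF jm] lk(2) by (simp add: irreducible_chain_def)
    then obtain w where w: "w \<in> Z j (Suc k)" "w \<notin> Z j k" by blast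
    have "closedin (zariski I) (Z j (Suc k))" using Z[OF jm] lk(2) by (simp add: irreducible_chain_def)
    then have waff: "w \<in> affine_space I" using w(1) closed_subset_affine by blast
    have "upd I m p j w \<in> Zm (Suc l)"
      unfolding Zm_def tuples_def
    proof (intro CollectI conjI upd_affine allI impI)
      fix i assume "i < m"
      have "min d (Suc l - j * d) = Suc k" using lk by simp
      then show "entry I (upd I m p j w) i \<in> Z i (min d (Suc l - i * d))"
        using w(1) pZ[OF \<open>i < m\<close>] entry_upd[OF \<open>i < m\<close> waff, of p j] by auto
    qed
    moreover have "upd I m p j w \<notin> Zm l"
    proof
      assume "upd I m p j w \<in> Zm l"
      then have "entry I (upd I m p j w) j \<in> Z j (min d (l - j * d))" using jm by (simp add: Zm_def tuples_def)
      moreover have "min d (l - j * d) = k" using lk by simp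
      ultimately show False using w(2) entry_upd[OF jm waff, of p j] by simp
    qed
    ultimately show "Zm l \<noteq> Zm (Suc l)" by blast
  qed
  moreover have "closedin (zariski ({..<m} \<times> I)) (Zm l) \<and> irreducible_in (zariski ({..<m} \<times> I)) (Zm l)" for l
    unfolding Zm_def using ZZ pPP[of l, unfolded Zm_def] by (intro conjI closedin_tuples irreducible_tuples) auto
  ultimately show "irreducible_chain (zariski ({..<m} \<times> I)) (m * d) Zm"
    by (simp add: irreducible_chain_def)
qed

section \<open>Equations over an affine algebraic group\<close>

context affine_algebraic_group
begin

lemma carrier_affine: "carrier G \<subseteq> affine_space I"
  by (rule closed_subset_affine[OF closed_carrier])

section \<open>Word maps\<close>

lemma polynomial_map_mult:
  assumes u: "polynomial_map K X I u" "u \<in> X \<rightarrow> carrier G" and v: "polynomial_map K X I v" "v \<in> X \<rightarrow> carrier G"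
  shows "polynomial_map K X I (\<lambda>x. u x \<otimes> v x)"
  unfolding polynomial_map_def
proof
  fix i assume i: "i \<in> I"
  obtain P where P: "P \<in> poly_funs ({..<2} \<times> I)"
    "\<And>z. z \<in> power_set I (carrier G) 2 \<Longrightarrow> (entry I z 0 \<otimes> entry I z 1) i = P z"
    using polynomial_mult i unfolding polynomial_map_def by blast
  \<comment> \<open>The two values are written as one point in the coordinates of the square of G,
    where multiplication is known to be polynomial.\<close>
  define pair where "pair x = (\<lambda>(l, i)\<in>{..<2::nat} \<times> I. if l = 0 then u x i else v x i)" for x
  have ent: "entry I (pair x) 0 = u x" "entry I (pair x) 1 = v x" if "x \<in> X" for x
  proof -
    have "u x \<in> affine_space I" "v x \<in> affine_space I" using that u(2) v(2) carrier_affine by blast+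
    then show "entry I (pair x) 0 = u x" "entry I (pair x) 1 = v x"
      by (auto simp: entry_def pair_def restrict_def fun_eq_iff PiE_def extensional_def)
  qed
  have "polynomial_map K X ({..<2} \<times> I) pair"
    unfolding polynomial_map_def
  proof
    fix li assume li: "li \<in> {..<2::nat} \<times> I"
    obtain l i where [simp]: "li = (l, i)" by (cases li)
    have "i \<in> I" using li by simp
    then obtain p q where "p \<in> poly_funs K" "q \<in> poly_funs K" "\<forall>x\<in>X. u x i = p x" "\<forall>x\<in>X. v x i = q x"
      using u(1) v(1) unfolding polynomial_map_def by blast
    then show "\<exists>p\<in>poly_funs K. \<forall>x\<in>X. pair x li = p x"
      using li by (cases "l = 0") (auto simp: pair_def)
  qed
  then obtain g where g: "g \<in> poly_funs K" "\<forall>x\<in>X. P (pair x) = g x"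
    using polynomial_map_pullback[OF _ P(1)] by blast
  have "(u x \<otimes> v x) i = g x" if "x \<in> X" for x
  proof -
    have "pair x \<in> power_set I (carrier G) 2"
      unfolding power_set_def
    proof (intro CollectI conjI allI impI)
      show "pair x \<in> affine_space ({..<2} \<times> I)" by (auto simp: pair_def)
      fix j :: nat assume "j < 2"
      then have "j = 0 \<or> j = 1" by auto
      then show "entry I (pair x) j \<in> carrier G" using ent[OF that] u(2) v(2) that by auto
    qed
    then show ?thesis using P(2)[of "pair x"] ent[OF that] g(2) that by simp
  qed
  then show "\<exists>p\<in>poly_funs K. \<forall>x\<in>X. (u x \<otimes> v x) i = p x" using g(1) by blast
qed

lemma polynomial_map_inv:
  assumes u: "polynomial_map K X I u" "u \<in> X \<rightarrow> carrier G"
  shows "polynomial_map K X I (\<lambda>x. inv (u x))"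
  unfolding polynomial_map_def
proof
  fix i assume i: "i \<in> I"
  obtain P where P: "P \<in> poly_funs I" "\<And>z. z \<in> carrier G \<Longrightarrow> (inv z) i = P z"
    using polynomial_inv i unfolding polynomial_map_def by blast
  obtain g where g: "g \<in> poly_funs K" "\<forall>x\<in>X. P (u x) = g x"
    using polynomial_map_pullback[OF u(1) P(1)] by blast
  have "(inv (u x)) i = g x" if "x \<in> X" for x
    using P(2)[OF funcset_mem[OF u(2) that]] g(2) that by simp
  then show "\<exists>p\<in>poly_funs K. \<forall>x\<in>X. (inv (u x)) i = p x" using g(1) by blast
qed

lemma polynomial_map_const: "polynomial_map K X I (\<lambda>x. a)"
  unfolding polynomial_map_def by (auto intro: poly_funs.const)

lemma entry_power_set: "x \<in> power_set I X m \<Longrightarrow> j < m \<Longrightarrow> entry I x j \<in> X"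
  by (simp add: power_set_def)

lemma word_value_polynomial:
  assumes "v \<in> lists (letters G m)"
  shows "polynomial_map ({..<m} \<times> I) (power_set I (carrier G) m) I (\<lambda>x. word_value G (entry I x) v)
    \<and> (\<lambda>x. word_value G (entry I x) v) \<in> power_set I (carrier G) m \<rightarrow> carrier G"
  using assms
proof (induction v rule: lists.induct)
  case Nil
  then show ?case by (simp add: word_value_def polynomial_map_const)
next
  case (Cons l v)
  let ?X = "power_set I (carrier G) m"
  have "polynomial_map ({..<m} \<times> I) ?X I (\<lambda>x. letter_value G (entry I x) l)
    \<and> (\<lambda>x. letter_value G (entry I x) l) \<in> ?X \<rightarrow> carrier G"
  proof (cases l)
    case (Unknown j)
    then have "j < m" using Cons.hyps by (auto simp: letters_def)
    then show ?thesis using Unknown polynomial_map_entry[of j m I] entry_power_set by auto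
  next
    case (Inv_Unknown j)
    then have "j < m" using Cons.hyps by (auto simp: letters_def)
    then have "(\<lambda>x. entry I x j) \<in> ?X \<rightarrow> carrier G" using entry_power_set by auto
    then show ?thesis using Inv_Unknown polynomial_map_inv[OF polynomial_map_entry[OF \<open>j < m\<close>], of ?X]
      by auto
  next
    case (Coefficient a)
    then have "a \<in> carrier G" using Cons.hyps by (auto simp: letters_def)
    then show ?thesis using Coefficient by (simp add: polynomial_map_const)
  qed
  moreover have "word_value G g (l # v) = letter_value G g l \<otimes> word_value G g v" for g
    by (simp add: word_value_def)
  ultimately show ?case using Cons.IH polynomial_map_mult by (auto simp: Pi_iff)
qed

text \<open>Homogeneity of G: for a point \<open>z\<close> of the smallest member, left translation
  by \<open>a \<otimes> inv z\<close> moves \<open>z\<close> to \<open>a\<close> and the whole chain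
  with it.\<close>

lemma translated_chain:
  assumes Z: "irreducible_chain (zariski I) d Z" "Z d \<subseteq> carrier G" and a: "a \<in> carrier G"
  shows "\<exists>Z'. irreducible_chain (zariski I) d Z' \<and> a \<in> Z' 0 \<and> Z' d \<subseteq> carrier G"
proof -
  have "irreducible_in (zariski I) (Z 0)" using Z by (simp add: irreducible_chain_def)
  then obtain z where z: "z \<in> Z 0" by (auto simp: irreducible_in_def)
  have Zc: "Z k \<subseteq> carrier G" if "k \<le> d" for k using irreducible_chain_mono[OF Z(1) that] Z(2) by blast
  then have zc: "z \<in> carrier G" using z by blast
  define b where "b = a \<otimes> inv z"
  have b: "b \<in> carrier G" using a zc by (simp add: b_def)
  have pm: "polynomial_map I (carrier G) I (\<lambda>x. c \<otimes> x)" if "c \<in> carrier G" for c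
  proof (rule polynomial_map_mult)
    show "polynomial_map I (carrier G) I (\<lambda>x. x)"
      unfolding polynomial_map_def by (auto intro: poly_funs.coord)
  qed (use that polynomial_map_const in auto)
  have aff: "(\<lambda>x. c \<otimes> x) \<in> carrier G \<rightarrow> affine_space I" if "c \<in> carrier G" for c
    using that carrier_affine by blast
  define Z' where "Z' k = (\<lambda>x. b \<otimes> x) ` Z k" for k
  \<comment> \<open>An image under a translation is a preimage under the inverse translation, and
    preimages of closed sets under polynomial maps are closed.\<close>
  have im: "(\<lambda>x. b \<otimes> x) ` W = {x \<in> carrier G. inv b \<otimes> x \<in> W}" if "W \<subseteq> carrier G" for W
  proof
    show "(\<lambda>x. b \<otimes> x) ` W \<subseteq> {x \<in> carrier G. inv b \<otimes> x \<in> W}"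
      using that b by (auto simp: m_assoc[symmetric] subset_iff)
    show "{x \<in> carrier G. inv b \<otimes> x \<in> W} \<subseteq> (\<lambda>x. b \<otimes> x) ` W"
    proof
      fix x assume x: "x \<in> {x \<in> carrier G. inv b \<otimes> x \<in> W}"
      then have "x = b \<otimes> (inv b \<otimes> x)" using b by (simp add: m_assoc[symmetric])
      then show "x \<in> (\<lambda>x. b \<otimes> x) ` W" using x by blast
    qed
  qed
  have "irreducible_chain (zariski I) d Z'"
    unfolding irreducible_chain_def
  proof (intro conjI allI impI)
    fix k assume k: "k \<le> d"
    have Zk: "closedin (zariski I) (Z k)" "irreducible_in (zariski I) (Z k)"
      using Z(1) k by (auto simp: irreducible_chain_def)
    show "closedin (zariski I) (Z' k)"
      unfolding Z'_def im[OF Zc[OF k]]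
      using b by (intro closedin_preimage[OF closed_carrier pm aff Zk(1)]) auto
    show "irreducible_in (zariski I) (Z' k)"
      unfolding Z'_def by (rule irreducible_image[OF closed_carrier pm[OF b] aff[OF b] Zk(2) Zc[OF k]])
  next
    fix k assume k: "k < d"
    then have "Z k \<subset> Z (Suc k)" using Z(1) by (simp add: irreducible_chain_def)
    moreover have "inj_on (\<lambda>x. b \<otimes> x) (carrier G)" using b by (auto simp: inj_on_def)
    moreover have "Z (Suc k) \<subseteq> carrier G" using Zc k by simp
    ultimately show "Z' k \<subset> Z' (Suc k)"
      unfolding Z'_def by (metis image_strict_mono inj_on_subset)
  qed
  moreover have "a \<in> Z' 0"
  proof -
    have "a = b \<otimes> z" using a zc by (simp add: b_def m_assoc)
    then show ?thesis using z by (auto simp: Z'_def)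
  qed
  moreover have "Z' d \<subseteq> carrier G" using Zc b by (auto simp: Z'_def)
  ultimately show ?thesis by blast
qed

section \<open>The variety of solutions and its components\<close>

lemma power_set_tuples: "power_set I X m = tuples I m (\<lambda>_. X)"
  by (simp add: power_set_def tuples_def)

lemma closedin_solutions:
  assumes "\<And>v. v \<in> set vs \<Longrightarrow> v \<in> lists (letters G m)"
  shows "closedin (zariski ({..<m} \<times> I)) (solutions I G m vs)"
proof -
  let ?X = "power_set I (carrier G) m" and ?T = "zariski ({..<m} \<times> I) :: (nat \<times> 'i \<Rightarrow> 'k) topology"
  have X: "closedin ?T ?X"
    unfolding power_set_tuples by (intro closedin_tuples closed_carrier)
  have one: "closedin (zariski I) {\<one>}" using carrier_affine by (intro closedin_singleton) auto
  have cl: "closedin ?T {x \<in> ?X. word_value G (entry I x) v \<in> {\<one>}}" if "v \<in> set vs" for v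
    using word_value_polynomial[OF assms[OF that]] carrier_affine one
    by (intro closedin_preimage[OF X]) auto
  \<comment> \<open>Inserting \<open>?X\<close> keeps the family nonempty when there are no
    equations.\<close>
  have "closedin ?T (\<Inter>(insert ?X ((\<lambda>v. {x \<in> ?X. word_value G (entry I x) v \<in> {\<one>}}) ` set vs)))"
    using cl X by (intro closedin_Inter) auto
  also have "\<Inter>(insert ?X ((\<lambda>v. {x \<in> ?X. word_value G (entry I x) v \<in> {\<one>}}) ` set vs)) = solutions I G m vs"
    unfolding solutions_def by blast
  finally show ?thesis .
qed

lemma finite_tuple_coords: "finite ({..<m::nat} \<times> I)"
  using finite_coords by simp

lemma dimension_of_solutions:
  assumes vs: "\<And>v. v \<in> set vs \<Longrightarrow> v \<in> lists (letters G m)"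
    and C: "irreducible_component_of (subtopology (zariski ({..<m} \<times> I)) (solutions I G m vs)) C"
  obtains c d where "variety_dim ({..<m} \<times> I) C = ereal (real c)" "variety_dim I (carrier G) = ereal (real d)"
    "m * d \<le> length vs * d + c"
proof -
  let ?K = "{..<m} \<times> I" and ?S = "solutions I G m vs"
  let ?T = "zariski ?K :: (nat \<times> 'i \<Rightarrow> 'k) topology"
  note finK = finite_tuple_coords[of m]
  have S: "closedin ?T ?S" by (rule closedin_solutions[OF vs])
  have Cirr: "irreducible_in ?T C" "C \<subseteq> ?S"
    and Cmax: "\<And>D. irreducible_in ?T D \<Longrightarrow> D \<subseteq> ?S \<Longrightarrow> C \<subseteq> D \<Longrightarrow> D = C"
    using C unfolding irreducible_component_of_def irreducible_in_subtopology by blast+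
  obtain \<Y> where \<Y>: "finite \<Y>" "\<And>Y. Y \<in> \<Y> \<Longrightarrow> closedin ?T Y \<and> irreducible_in ?T Y" "\<Union>\<Y> = ?S"
    using closed_decomposition[OF finK S] by blast
  have comp: "Y = C" if "Y \<in> \<Y>" "C \<subseteq> Y" for Y
    using Cmax[of Y] \<Y>(2)[OF that(1)] \<Y>(3) that by blast
  have "C \<in> \<Y>"
    using irreducible_subset_Union[OF Cirr(1) \<Y>(1)] \<Y>(2,3) Cirr(2) comp by blast
  then have Ccl: "closedin ?T C" using \<Y>(2) by blast
  have Cne: "C \<noteq> {}" using Cirr by (simp add: irreducible_in_def)
  obtain c where c: "variety_dim ?K C = ereal (real c)"
    "\<And>t Z. irreducible_chain ?T t Z \<Longrightarrow> Z t \<subseteq> C \<Longrightarrow> t \<le> c"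
    using variety_dim_closed[OF finK Ccl Cne] by metis
  obtain d Z0 where d: "variety_dim I (carrier G) = ereal (real d)" "irreducible_chain (zariski I) d Z0" "Z0 d \<subseteq> carrier G"
    "\<And>t Z. irreducible_chain (zariski I) t Z \<Longrightarrow> Z t \<subseteq> carrier G \<Longrightarrow> t \<le> d"
  proof -
    have "carrier G \<noteq> {}" using one_closed by blast
    from variety_dim_closed[OF finite_coords closed_carrier this] show ?thesis using that by metis
  qed
  \<comment> \<open>If \<open>C\<close> lay in the union of the other members of the decomposition,
    irreducibility would put it inside a single one of them, which maximality excludes. So
    \<open>C\<close> has a point outside \<open>Q\<close>.\<close>
  define Q where "Q = \<Union>(\<Y> - {C})"
  have Q: "closedin ?T Q" unfolding Q_def using \<Y> by (intro closedin_Union) auto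
  have "\<not> C \<subseteq> Q"
  proof
    assume "C \<subseteq> Q"
    then obtain Y where "Y \<in> \<Y> - {C}" "C \<subseteq> Y"
      using irreducible_subset_Union[OF Cirr(1), of "\<Y> - {C}"] \<Y>(1,2) unfolding Q_def by blast
    then show False using comp by blast
  qed
  then obtain p where p: "p \<in> C" "p \<notin> Q" by blast
  have pS: "p \<in> ?S" using p Cirr by blast
  have pX: "p \<in> power_set I (carrier G) m" using pS by (simp add: solutions_def)
  have paff: "p \<in> affine_space ?K" using pX by (simp add: power_set_def)
  obtain g0 where g0: "g0 \<in> vanishing ?K Q" "g0 p \<noteq> 0"
    using closed_separation[OF Q paff p(2)] by blast
  obtain F1 g1 where F1: "finite F1" "card F1 \<le> c" "F1 \<subseteq> poly_funs ?K" "\<forall>f\<in>F1. f p = 0"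
    "g1 \<in> poly_funs ?K" "g1 p \<noteq> 0" "\<forall>x\<in>C. (\<forall>f\<in>F1. f x = 0) \<longrightarrow> g1 x \<noteq> 0 \<longrightarrow> x = p"
  proof -
    have "\<exists>F g. finite F \<and> card F \<le> c \<and> F \<subseteq> poly_funs ?K \<and> (\<forall>f\<in>F. f p = 0) \<and>
      g \<in> poly_funs ?K \<and> g p \<noteq> 0 \<and> (\<forall>x\<in>C. (\<forall>f\<in>F. f x = 0) \<longrightarrow> g x \<noteq> 0 \<longrightarrow> x = p)"
      by (rule ex_isolating_equations[OF finK paff Ccl]) (erule c(2))
    then show ?thesis using that by (elim exE conjE)
  qed
  have one_aff: "\<one> \<in> affine_space I" by (rule subsetD[OF carrier_affine one_closed])
  obtain H h where H: "finite H" "card H \<le> d" "H \<subseteq> poly_funs I" "\<forall>f\<in>H. f \<one> = 0"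
    "h \<in> poly_funs I" "h \<one> \<noteq> 0" "\<forall>x\<in>carrier G. (\<forall>f\<in>H. f x = 0) \<longrightarrow> h x \<noteq> 0 \<longrightarrow> x = \<one>"
  proof -
    have "\<exists>F g. finite F \<and> card F \<le> d \<and> F \<subseteq> poly_funs I \<and> (\<forall>f\<in>F. f \<one> = 0) \<and>
      g \<in> poly_funs I \<and> g \<one> \<noteq> 0 \<and> (\<forall>x\<in>carrier G. (\<forall>f\<in>F. f x = 0) \<longrightarrow> g x \<noteq> 0 \<longrightarrow> x = \<one>)"
      by (rule ex_isolating_equations[OF finite_coords one_aff closed_carrier]) (erule d(4))
    then show ?thesis using that by (elim exE conjE)
  qed
  define X where "X = power_set I (carrier G) m"
  \<comment> \<open>\<open>rp (f, v)\<close> will be a polynomial that agrees on the power of G with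
    \<open>f\<close> composed with the word map of \<open>v\<close>.\<close>
  have "\<forall>fv\<in>poly_funs I \<times> set vs. \<exists>q. q \<in> poly_funs ?K \<and> (\<forall>x\<in>X. (fst fv) (word_value G (entry I x) (snd fv)) = q x)"
    using polynomial_map_pullback word_value_polynomial[OF vs] unfolding X_def by fastforce
  from bchoice[OF this] obtain rp where rp: "\<And>f v. f \<in> poly_funs I \<Longrightarrow> v \<in> set vs \<Longrightarrow> rp (f, v) \<in> poly_funs ?K"
    "\<And>f v x. f \<in> poly_funs I \<Longrightarrow> v \<in> set vs \<Longrightarrow> x \<in> X \<Longrightarrow> f (word_value G (entry I x) v) = rp (f, v) x"
    by auto
  have wp: "word_value G (entry I p) v = \<one>" if "v \<in> set vs" for v
    using pS that by (simp add: solutions_def)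
  have pX': "p \<in> X" using pX by (simp add: X_def)
  define F where "F = F1 \<union> rp ` (H \<times> set vs)"
  \<comment> \<open>One factor for each source of unwanted common zeros: \<open>g0\<close> excludes
    the rest of the solution variety, \<open>g1\<close> excludes zeros of \<open>F1\<close> on
    \<open>C\<close> other than \<open>p\<close>, and the factors from \<open>h\<close> exclude
    tuples at which a word takes a value other than the identity that is still a zero of
    \<open>H\<close>.\<close>
  define g where "g = g0 * g1 * (\<Prod>v\<in>set vs. rp (h, v))"
  obtain Z where Z: "\<And>j. j < m \<Longrightarrow> irreducible_chain (zariski I) d (Z j) \<and> entry I p j \<in> Z j 0 \<and> Z j d \<subseteq> carrier G"
  proof -
    have "\<forall>j. \<exists>Z'. j < m \<longrightarrow> irreducible_chain (zariski I) d Z' \<and> entry I p j \<in> Z' 0 \<and> Z' d \<subseteq> carrier G"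
      using translated_chain[OF d(2,3)] entry_power_set[OF pX] by blast
    from choice[OF this] show ?thesis using that by blast
  qed
  define Zm where "Zm = (\<lambda>l. tuples I m (\<lambda>j. Z j (min d (l - j * d))))"
  have Zm: "irreducible_chain ?T (m * d) Zm" "p \<in> Zm 0"
    unfolding Zm_def using Z by (intro tuples_chain[OF _ paff]; blast)+
  have ZmX: "Zm (m * d) \<subseteq> X"
  proof -
    have "Z j (min d k) \<subseteq> carrier G" if "j < m" for j k
      using irreducible_chain_mono[of "zariski I" d "Z j" "min d k" d] Z[OF that] by auto
    then show ?thesis unfolding Zm_def X_def power_set_tuples tuples_def by blast
  qed
  have "m * d \<le> card F"
  proof (rule chain_le_card_equations[of ?K p Zm "m * d" F g])
    show "finite ?K" by (rule finK)
    show "p \<in> Zm 0" by (rule Zm(2))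
    show "closedin ?T (Zm k) \<and> irreducible_in ?T (Zm k)" if "k \<le> m * d" for k
      using Zm(1) that by (simp add: irreducible_chain_def)
    show "Zm k \<subset> Zm (Suc k)" if "k < m * d" for k
      using Zm(1) that by (simp add: irreducible_chain_def)
    show "finite F" using F1(1) H(1) by (simp add: F_def)
    show "F \<subseteq> poly_funs ?K" using F1(3) H(3) rp(1) by (auto simp: F_def)
    show "f p = 0" if f: "f \<in> F" for f
    proof (cases "f \<in> F1")
      case False
      then obtain q v where qv: "q \<in> H" "v \<in> set vs" "f = rp (q, v)" using f by (auto simp: F_def)
      then have "f p = q \<one>" using rp(2)[of q v p] wp[OF qv(2)] H(3) pX' by auto
      then show ?thesis using qv(1) H(4) by simp
    qed (use F1(4) in blast)
    show "g \<in> poly_funs ?K"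
      unfolding g_def using g0(1) F1(5) rp(1)[OF H(5)]
      by (intro poly_funs_ring(3) poly_funs_ring(8)) (auto simp: vanishing_def)
    have "rp (h, v) p \<noteq> 0" if "v \<in> set vs" for v
      using rp(2)[OF H(5) that pX'] wp[OF that] H(6) by simp
    then show "g p \<noteq> 0" using g0(2) F1(6) by (simp add: g_def prod_fun_apply)
    show "x = p" if x: "x \<in> Zm (m * d)" "\<And>f. f \<in> F \<Longrightarrow> f x = 0" "g x \<noteq> 0" for x
    proof -
      have xX: "x \<in> X" using x(1) ZmX by blast
      have gx: "g0 x \<noteq> 0" "g1 x \<noteq> 0" "\<And>v. v \<in> set vs \<Longrightarrow> rp (h, v) x \<noteq> 0"
        using x(3) by (auto simp: g_def prod_fun_apply)
      have "word_value G (entry I x) v = \<one>" if v: "v \<in> set vs" for v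
      proof -
        have "word_value G (entry I x) v \<in> carrier G"
          using word_value_polynomial[OF vs[OF v]] xX by (auto simp: X_def)
        moreover have "f (word_value G (entry I x) v) = 0" if "f \<in> H" for f
        proof -
          have "rp (f, v) \<in> F" using that v by (auto simp: F_def)
          then show ?thesis using rp(2)[of f v x] that H(3) v xX x(2) by auto
        qed
        moreover have "h (word_value G (entry I x) v) \<noteq> 0"
          using rp(2)[OF H(5) v xX] gx(3)[OF v] by simp
        ultimately show ?thesis using H(7) by blast
      qed
      then have "x \<in> ?S" using xX by (simp add: solutions_def X_def)
      moreover have "x \<notin> Q" using g0(1) gx(1) by (auto simp: vanishing_def)
      ultimately have "x \<in> C" using \<Y>(3) by (auto simp: Q_def)
      moreover have "\<forall>f\<in>F1. f x = 0" using x(2) by (simp add: F_def)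
      ultimately show ?thesis using F1(7) gx(2) by blast
    qed
  qed
  also have "card F \<le> card F1 + card (rp ` (H \<times> set vs))" unfolding F_def by (rule card_Un_le)
  \<comment> \<open>Repeated words and coinciding pull-backs can only lower the number of
    polynomials.\<close>
  also have "\<dots> \<le> c + length vs * d"
  proof (rule add_mono[OF F1(2)])
    have "card (rp ` (H \<times> set vs)) \<le> card (H \<times> set vs)" using H(1) by (intro card_image_le) simp
    also have "\<dots> = card H * card (set vs)" by (rule card_cartesian_product)
    also have "\<dots> \<le> d * length vs" using H(2) card_length by (rule mult_le_mono)
    finally show "card (rp ` (H \<times> set vs)) \<le> length vs * d" by (simp add: mult.commute)
  qed
  finally have "m * d \<le> length vs * d + c" by simp
  then show ?thesis using that c(1) d(1) by blast
qed

end

theorem theorem0: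
  fixes I :: "'i set"
    and G :: "('i \<Rightarrow> 'k::alg_closed_field) monoid"
    and m n :: nat
    and vs :: "('i \<Rightarrow> 'k) letter list list"
    and C :: "(nat \<times> 'i \<Rightarrow> 'k) set"
  assumes "affine_algebraic_group I G"
    and "length vs = n"
    and "\<And>v. v \<in> set vs \<Longrightarrow> v \<in> lists (letters G m)"
    and "irreducible_component_of (subtopology (zariski ({..<m} \<times> I)) (solutions I G m vs)) C"
  shows "variety_dim ({..<m} \<times> I) C \<ge> ereal (real m - real n) * variety_dim I (carrier G)"
proof -
  interpret affine_algebraic_group I G by fact
  obtain c d where cd: "variety_dim ({..<m} \<times> I) C = ereal (real c)" "variety_dim I (carrier G) = ereal (real d)"
    "m * d \<le> length vs * d + c"
    by (rule dimension_of_solutions[OF assms(3,4)])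
  \<comment> \<open>The inequality moves to the reals before subtracting, as m - n may be
    negative.\<close>
  have "real (m * d) \<le> real (n * d + c)" using cd(3) assms(2) by (simp only: of_nat_le_iff)
  then have "(real m - real n) * real d \<le> real c" by (simp add: algebra_simps)
  then show ?thesis by (simp add: cd)
qed

end
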